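(* Consider the planted dense subgraph model: for $\rho=\rho_n\in[0,1]$ and $0\le p_0\le p_1\le1$ (depending on $n$), draw $\theta\in\{0,1\}^n$ with i.i.d. $\mathrm{Ber}(\rho)$ entries and, conditionally on $\theta$, draw $Y_{i,j}\sim\mathrm{Ber}(p_0+(p_1-p_0)\theta_i\theta_j)$ independently for $1\le i<j\le n$; $Y$ is observed. Put $\lambda=\frac{p_1-p_0}{\sqrt{p_0(1-p_0)}}$ and suppose that $$\frac1n\ll p_0\le p_1\ll1,\qquad \frac{(\log n)^2}{\sqrt n}\ll\rho\ll\frac1{\log n},\qquad \lambda^2\rho^2n\ll\frac1{(\log n)^2}.$$ Assume that the low-degree heuristic holds for the hidden informative sample problems associated with this model (see context). Then any algorithm which, given $Y$, outputs an estimator $\mathcal X=\mathcal X(Y)$ achieving weak recovery of $\Theta=(p_1-p_0)\theta\theta^{\top}$, i.e. $\mathbb E\big[\langle\mathcal X,\Theta\rangle/(\|\mathcal X\|\,\|\Theta\|)\big]\ge c$ for some constant $c>0$, requires running time $\exp\big(\Omega(\lambda^{-2}(\log n)^{-4})\big)$.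
   Context: Asymptotic notation is with respect to $n\to\infty$; $x_n\ll y_n$ means $x_n/y_n\to0$. The parameters are known. Inner product and norm are Euclidean/Frobenius; the ratio in weak recovery is read as $0$ when its denominator vanishes. Low-degree heuristic. Let $P=P_n,Q=Q_n$ be probability measures on $\mathbb R^{N}$, $N=N_n$. For a degree $D=D_n$ put $\mathsf{Adv}_{\le D}(P;Q)=\sup_f \mathbb E_P[f]/\sqrt{\mathbb E_Q[f^2]}$, the supremum over real polynomials $f$ on $\mathbb R^N$ of degree at most $D$. A $\{0,1\}$-valued algorithm $\mathcal A$ achieves strong detection if $Q(\mathcal A=1)+P(\mathcal A=0)\to0$, and weak detection if this sum is at most $1-\epsilon$ for some fixed $\epsilon>0$. The low-degree heuristic holds for testing $P$ against $Q$ if: (1) whenever $\mathsf{Adv}_{\le D}(P;Q)=O(1)$ there is a constant $C$ such that no algorithm with running time $N^{D/(C\log N)}$ achieves strong detection; (2) whenever $\mathsf{Adv}_{\le D}(P;Q)=1+o(1)$ there is a constant $C$ such that no algorithm with running time $N^{D/(C\log N)}$ achieves weak detection. Hidden informative sample problem with base pair $(P,Q)$ and sample number $M=M_n$: test between $\overline Q$, the law of $(\mathsf Y_1,\dots,\mathsf Y_M)$ i.i.d. from $Q$, and $\overline P$, the law of $(\mathsf Y_1,\dots,\mathsf Y_M)$ where $\kappa$ is uniform on $\{1,\dots,M\}$ and, given $\kappa$, the $\mathsf Y_j$ are independent with $\mathsf Y_\kappa\sim P$ and $\mathsf Y_j\sim Q$ for $j\ne\kappa$ (dimension $MN$). The associated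 problems: the base pair is ($P$ = law of the planted dense subgraph $Y$ on $m$ vertices with parameters $p_0,p_1,\rho$; $Q$ = law of an Erdős–Rényi graph on $m$ vertices with edge probability $p_0$), for any sequence $m=m_n\to\infty$ and any parameters satisfying the displayed assumptions with $m$ in place of $n$; the sample number is any $M$ with $\Delta\ll M\le N\Delta$, where $\Delta>1$ is an upper bound for $\mathsf{Adv}_{\le D}(P;Q)^2$ and $N$ is the dimension of the base pair. The constant $C$ in the heuristic may be taken independent of the choice of $M$. *)

theory Defs
  imports
    "HOL-Probability.Probability"
    "HOL-Library.Landau_Symbols"
    "HOL-Library.Log_Nat"
begin

section \<open>Algorithms and running time\<close>

text \<open>
  Running time is measured on a random access machine in structured form: while-programs over
  integer arrays with the logarithmic cost criterion (every evaluated subexpression, in particular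
  every address, is charged the bit length of its value), so that time agrees with multitape Turing
  machine time up to a polynomial.  The memory consists of arrays numbered by the program text
  and indexed by integers, initially zero except for input and coins.

  An algorithm for a sequence of problems is a sequence of programs, one for each \<open>n\<close>.  Thus
  dimension, model parameters and anything derived from them may be built into the program; since
  the length of the program counts towards its running time, no other advice comes for free.
\<close>

type_synonym memory = "nat \<Rightarrow> int \<Rightarrow> int"

datatype aexp =
    Lit int
  | Cell nat aexp
  | Add aexp aexp
  | Sub aexp aexp
  | Mul aexp aexp

datatype com =
    Pass
  | Store nat aexp aexp
  | Seq com com
  | Cond aexp com com
  | Loop aexp com

definition bits :: "int \<Rightarrow> nat" where
  "bits z = 1 + floorlog 2 (nat \<bar>z\<bar>)"

fun aval :: "aexp \<Rightarrow> memory \<Rightarrow> int" where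
  "aval (Lit z) s = z"
| "aval (Cell a e) s = s a (aval e s)"
| "aval (Add e f) s = aval e s + aval f s"
| "aval (Sub e f) s = aval e s - aval f s"
| "aval (Mul e f) s = aval e s * aval f s"

fun atime :: "aexp \<Rightarrow> memory \<Rightarrow> nat" where
  "atime (Lit z) s = bits z"
| "atime (Cell a e) s = bits (s a (aval e s)) + atime e s"
| "atime (Add e f) s = bits (aval e s + aval f s) + atime e s + atime f s"
| "atime (Sub e f) s = bits (aval e s - aval f s) + atime e s + atime f s"
| "atime (Mul e f) s = bits (aval e s * aval f s) + atime e s + atime f s"

fun asize :: "aexp \<Rightarrow> nat" where
  "asize (Lit z) = bits z"
| "asize (Cell a e) = 1 + asize e"
| "asize (Add e f) = 1 + asize e + asize f"
| "asize (Sub e f) = 1 + asize e + asize f"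
| "asize (Mul e f) = 1 + asize e + asize f"

fun csize :: "com \<Rightarrow> nat" where
  "csize Pass = 1"
| "csize (Store a e f) = 1 + asize e + asize f"
| "csize (Seq c d) = 1 + csize c + csize d"
| "csize (Cond b c d) = 1 + asize b + csize c + csize d"
| "csize (Loop b c) = 1 + asize b + csize c"

text \<open>\<open>exec c s k t\<close>: started in memory \<open>s\<close>, the program \<open>c\<close> halts in memory \<open>t\<close> after time \<open>k\<close>.\<close>

inductive exec :: "com \<Rightarrow> memory \<Rightarrow> nat \<Rightarrow> memory \<Rightarrow> bool" where
  Pass: "exec Pass s 1 s"
| Store: "exec (Store a e f) s (1 + atime e s + atime f s)
            (s(a := (s a)(aval e s := aval f s)))"
| Seq: "exec c s k t \<Longrightarrow> exec d t l u \<Longrightarrow> exec (Seq c d) s (k + l) u"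
| Cond_True: "aval b s > 0 \<Longrightarrow> exec c s k t \<Longrightarrow> exec (Cond b c d) s (1 + atime b s + k) t"
| Cond_False: "aval b s \<le> 0 \<Longrightarrow> exec d s k t \<Longrightarrow> exec (Cond b c d) s (1 + atime b s + k) t"
| Loop_False: "aval b s \<le> 0 \<Longrightarrow> exec (Loop b c) s (1 + atime b s) s"
| Loop_True: "aval b s > 0 \<Longrightarrow> exec c s k t \<Longrightarrow> exec (Loop b c) t l u \<Longrightarrow>
    exec (Loop b c) s (1 + atime b s + k + l) u"

inductive_cases exec_elims:
  "exec Pass s k t" "exec (Store a e f) s k t" "exec (Seq c d) s k t"
  "exec (Cond b c d) s k t" "exec (Loop b c) s k t"

lemma exec_deterministic:
  "exec c s k t \<Longrightarrow> exec c s k' t' \<Longrightarrow> k' = k \<and> t' = t"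
proof (induction arbitrary: k' t' rule: exec.induct)
  case (Pass s)
  then show ?case by (auto elim: exec_elims)
next
  case (Store a e f s)
  then show ?case by (auto elim: exec_elims)
next
  case (Seq c s k t d l u)
  from Seq.prems show ?case
    by (rule exec_elims(3)) (blast dest: Seq.IH)
next
  case (Cond_True b s c k t d)
  from Cond_True.prems show ?case
    by (rule exec_elims(4)) (use Cond_True.hyps(1) in \<open>auto dest: Cond_True.IH\<close>)
next
  case (Cond_False b s d k t c)
  from Cond_False.prems show ?case
    by (rule exec_elims(4)) (use Cond_False.hyps(1) in \<open>auto dest: Cond_False.IH\<close>)
next
  case (Loop_False b s c)
  from Loop_False.prems show ?case
    by (rule exec_elims(5)) (use Loop_False.hyps in auto)
next
  case (Loop_True b s c k t l u)
  from Loop_True.prems show ?case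
    by (rule exec_elims(5)) (use Loop_True.hyps(1) in \<open>auto dest!: Loop_True.IH(1) dest: Loop_True.IH(2)\<close>)
qed

text \<open>
  The observation is a bit vector \<open>y\<close> indexed by a finite set \<open>I\<close>; coordinate \<open>i\<close> is stored
  at address \<open>addr i\<close> of array 0.  Array 1 holds \<open>r\<close> independent fair coins.  The function \<open>F\<close>
  is what the program computes from observation and coins; \<open>out\<close> relates the final memory to
  the result.
\<close>

definition init_mem :: "('i \<Rightarrow> nat) \<Rightarrow> ('i \<Rightarrow> bool) \<Rightarrow> (nat \<Rightarrow> bool) \<Rightarrow> memory" where
  "init_mem addr y \<omega> = (\<lambda>a z.
     if a = 0 then of_bool (\<exists>i. y i \<and> int (addr i) = z)
     else if a = 1 then of_bool (z \<ge> 0 \<and> \<omega> (nat z))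
     else 0)"

definition coins :: "nat \<Rightarrow> (nat \<Rightarrow> bool) pmf" where
  "coins r = Pi_pmf {..<r} False (\<lambda>_. bernoulli_pmf (1 / 2))"

definition computes_in_time ::
  "('i \<Rightarrow> nat) \<Rightarrow> 'i set \<Rightarrow> nat \<Rightarrow> (memory \<Rightarrow> 'b \<Rightarrow> bool) \<Rightarrow>
   (('i \<Rightarrow> bool) \<Rightarrow> (nat \<Rightarrow> bool) \<Rightarrow> 'b) \<Rightarrow> real \<Rightarrow> bool"
where
  "computes_in_time addr I r out F \<tau> \<longleftrightarrow>
     (\<exists>c. real (csize c) \<le> \<tau> \<and>
        (\<forall>y \<omega>. (\<forall>i. y i \<longrightarrow> i \<in> I) \<longrightarrow> (\<forall>k. \<omega> k \<longrightarrow> k < r) \<longrightarrow>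
           (\<exists>k s. exec c (init_mem addr y \<omega>) k s \<and> real k \<le> \<tau> \<and> out s (F y \<omega>))))"

definition out_bit :: "memory \<Rightarrow> bool \<Rightarrow> bool" where
  "out_bit s b \<longleftrightarrow> b = (s 2 0 \<noteq> 0)"

text \<open>
  Matrices are output as rational matrices: array 2 holds the numerators and array 3 the
  denominators of the entries, in row-major order.
\<close>

definition out_matrix :: "nat \<Rightarrow> memory \<Rightarrow> (nat \<Rightarrow> nat \<Rightarrow> real) \<Rightarrow> bool" where
  "out_matrix n s A \<longleftrightarrow>
     (\<forall>i<n. \<forall>j<n. A i j = of_int (s 2 (int (i * n + j))) / of_int (s 3 (int (i * n + j))))"


section \<open>Low-degree advantage and detection\<close>

text \<open>
  Polynomials of degree at most \<open>D\<close> in the variables \<open>x i\<close>, \<open>i \<in> I\<close>, as functions; a multiset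
  of indices represents a monomial.
\<close>

definition poly_funs :: "'i set \<Rightarrow> nat \<Rightarrow> (('i \<Rightarrow> real) \<Rightarrow> real) set" where
  "poly_funs I D = {f. \<exists>A c. finite A \<and> (\<forall>\<mu>\<in>A. set_mset \<mu> \<subseteq> I \<and> size \<mu> \<le> D) \<and>
     f = (\<lambda>x. \<Sum>\<mu>\<in>A. c \<mu> * (\<Prod>i\<in>#\<mu>. x i))}"

text \<open>
  The laws live on \<open>{0,1}\<^sup>I \<subseteq> \<real>\<^sup>I\<close>.  In \<^typ>\<open>ereal\<close> a positive number divided by \<open>0\<close> is \<open>\<infinity>\<close>
  and \<open>0 / 0 = 0\<close>, as wanted if \<open>\<real>\<^sup>I\<close> carries polynomials vanishing almost surely under \<open>Q\<close>.
\<close>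

definition Adv :: "nat \<Rightarrow> 'i set \<Rightarrow> ('i \<Rightarrow> bool) pmf \<Rightarrow> ('i \<Rightarrow> bool) pmf \<Rightarrow> ereal" where
  "Adv D I P Q = (SUP f\<in>poly_funs I D.
     ereal (measure_pmf.expectation P (\<lambda>y. f (\<lambda>i. of_bool (y i)))) /
     ereal (sqrt (measure_pmf.expectation Q (\<lambda>y. (f (\<lambda>i. of_bool (y i)))\<^sup>2))))"

definition error_sum ::
  "('i \<Rightarrow> bool) pmf \<Rightarrow> ('i \<Rightarrow> bool) pmf \<Rightarrow> nat \<Rightarrow> (('i \<Rightarrow> bool) \<Rightarrow> (nat \<Rightarrow> bool) \<Rightarrow> bool) \<Rightarrow> real" where
  "error_sum P Q r A =
     measure_pmf.prob (pair_pmf Q (coins r)) {(y, \<omega>). A y \<omega>} +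
     measure_pmf.prob (pair_pmf P (coins r)) {(y, \<omega>). \<not> A y \<omega>}"

definition strong_detection where
  "strong_detection P Q r A \<longleftrightarrow> (\<lambda>n. error_sum (P n) (Q n) (r n) (A n)) \<longlonglongrightarrow> 0"

definition weak_detection where
  "weak_detection P Q r A \<longleftrightarrow>
     (\<exists>\<epsilon>>0. \<forall>\<^sub>F n in sequentially. error_sum (P n) (Q n) (r n) (A n) \<le> 1 - \<epsilon>)"

text \<open>
  The low-degree heuristic at degree \<open>D\<close> with constant \<open>C\<close>.  The dimension is \<open>N = card I\<close>.
\<close>

definition low_degree_heuristic ::
  "real \<Rightarrow> (nat \<Rightarrow> nat) \<Rightarrow> (nat \<Rightarrow> 'i \<Rightarrow> nat) \<Rightarrow> (nat \<Rightarrow> 'i set) \<Rightarrow>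
   (nat \<Rightarrow> ('i \<Rightarrow> bool) pmf) \<Rightarrow> (nat \<Rightarrow> ('i \<Rightarrow> bool) pmf) \<Rightarrow> bool" where
  "low_degree_heuristic C D addr I P Q \<longleftrightarrow>
     (let N = (\<lambda>n. real (card (I n)));
          admissible = (\<lambda>r A. \<forall>\<^sub>F n in sequentially.
            computes_in_time (addr n) (I n) (r n) out_bit (A n)
              (N n powr (real (D n) / (C * ln (N n)))))
      in ((\<exists>K::real. \<forall>\<^sub>F n in sequentially. Adv (D n) (I n) (P n) (Q n) \<le> ereal K) \<longrightarrow>
            \<not> (\<exists>r A. admissible r A \<and> strong_detection P Q r A)) \<and>
         ((\<lambda>n. Adv (D n) (I n) (P n) (Q n)) \<longlonglongrightarrow> 1 \<longrightarrow>
            \<not> (\<exists>r A. admissible r A \<and> weak_detection P Q r A)))"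


section \<open>Hidden informative sample problem\<close>

text \<open>Coordinate \<open>i\<close> of the \<open>j\<close>-th sample has index \<open>(j, i)\<close>; samples are numbered from \<open>0\<close>.\<close>

definition hidden_null :: "nat \<Rightarrow> ('i \<Rightarrow> bool) pmf \<Rightarrow> (nat \<times> 'i \<Rightarrow> bool) pmf" where
  "hidden_null M Q = map_pmf case_prod (Pi_pmf {..<M} (\<lambda>_. False) (\<lambda>_. Q))"

definition hidden_planted ::
  "nat \<Rightarrow> ('i \<Rightarrow> bool) pmf \<Rightarrow> ('i \<Rightarrow> bool) pmf \<Rightarrow> (nat \<times> 'i \<Rightarrow> bool) pmf" where
  "hidden_planted M P Q = do {
     \<kappa> \<leftarrow> pmf_of_set {..<M};
     map_pmf case_prod (Pi_pmf {..<M} (\<lambda>_. False) (\<lambda>j. if j = \<kappa> then P else Q))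
   }"


section \<open>Planted dense subgraph\<close>

definition edges :: "nat \<Rightarrow> (nat \<times> nat) set" where
  "edges n = {(i, j). i < j \<and> j < n}"

definition edge_addr :: "nat \<Rightarrow> nat \<times> nat \<Rightarrow> nat" where
  "edge_addr n = (\<lambda>(i, j). i * n + j)"

definition hidden_edge_addr :: "nat \<Rightarrow> nat \<times> (nat \<times> nat) \<Rightarrow> nat" where
  "hidden_edge_addr n = (\<lambda>(k, e). k * n\<^sup>2 + edge_addr n e)"

text \<open>Joint law of \<open>(\<theta>, Y)\<close>.\<close>

definition pds_joint ::
  "nat \<Rightarrow> real \<Rightarrow> real \<Rightarrow> real \<Rightarrow> ((nat \<Rightarrow> bool) \<times> (nat \<times> nat \<Rightarrow> bool)) pmf" where
  "pds_joint n p0 p1 \<rho> = do {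
     \<theta> \<leftarrow> Pi_pmf {..<n} False (\<lambda>_. bernoulli_pmf \<rho>);
     Y \<leftarrow> Pi_pmf (edges n) False
            (\<lambda>(i, j). bernoulli_pmf (p0 + (p1 - p0) * of_bool (\<theta> i) * of_bool (\<theta> j)));
     return_pmf (\<theta>, Y)
   }"

definition pds :: "nat \<Rightarrow> real \<Rightarrow> real \<Rightarrow> real \<Rightarrow> (nat \<times> nat \<Rightarrow> bool) pmf" where
  "pds n p0 p1 \<rho> = map_pmf snd (pds_joint n p0 p1 \<rho>)"

definition erdos_renyi :: "nat \<Rightarrow> real \<Rightarrow> (nat \<times> nat \<Rightarrow> bool) pmf" where
  "erdos_renyi n p = Pi_pmf (edges n) False (\<lambda>_. bernoulli_pmf p)"

definition snr :: "real \<Rightarrow> real \<Rightarrow> real" where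
  "snr p0 p1 = (p1 - p0) / sqrt (p0 * (1 - p0))"

text \<open>
  The parameter regime for sequences of graphs on \<open>m n\<close> vertices.  In contrast to convergence of
  the quotient, \<open>o(_)\<close> is not satisfied vacuously where the right-hand side vanishes.
\<close>

definition pds_regime ::
  "(nat \<Rightarrow> nat) \<Rightarrow> (nat \<Rightarrow> real) \<Rightarrow> (nat \<Rightarrow> real) \<Rightarrow> (nat \<Rightarrow> real) \<Rightarrow> bool" where
  "pds_regime m p0 p1 \<rho> \<longleftrightarrow>
     filterlim m at_top sequentially \<and>
     (\<forall>n. 0 \<le> \<rho> n \<and> \<rho> n \<le> 1 \<and> 0 \<le> p0 n \<and> p0 n \<le> p1 n \<and> p1 n \<le> 1) \<and>
     (\<lambda>n. 1 / real (m n)) \<in> o(p0) \<and>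
     p1 \<in> o(\<lambda>_. 1) \<and>
     (\<lambda>n. (ln (real (m n)))\<^sup>2 / sqrt (real (m n))) \<in> o(\<rho>) \<and>
     \<rho> \<in> o(\<lambda>n. 1 / ln (real (m n))) \<and>
     (\<lambda>n. (snr (p0 n) (p1 n))\<^sup>2 * (\<rho> n)\<^sup>2 * real (m n)) \<in> o(\<lambda>n. 1 / (ln (real (m n)))\<^sup>2)"

text \<open>
  The low-degree heuristic for all hidden informative sample problems associated with the model.
  The constant \<open>C\<close> is chosen before the sample number \<open>M\<close>.
\<close>

definition pds_low_degree_heuristic :: bool where
  "pds_low_degree_heuristic \<longleftrightarrow>
     (\<forall>m p0 p1 \<rho> D (\<Delta> :: nat \<Rightarrow> real).
        pds_regime m p0 p1 \<rho> \<longrightarrow>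
        (\<forall>n. \<Delta> n > 1 \<and>
           (Adv (D n) (edges (m n)) (pds (m n) (p0 n) (p1 n) (\<rho> n)) (erdos_renyi (m n) (p0 n)))\<^sup>2
             \<le> ereal (\<Delta> n)) \<longrightarrow>
        (\<exists>C>0. \<forall>M :: nat \<Rightarrow> nat.
           \<Delta> \<in> o(\<lambda>n. real (M n)) \<longrightarrow>
           (\<forall>n. 1 \<le> M n \<and> real (M n) \<le> real (card (edges (m n))) * \<Delta> n) \<longrightarrow>
           low_degree_heuristic C D
             (\<lambda>n. hidden_edge_addr (m n))
             (\<lambda>n. {..<M n} \<times> edges (m n))
             (\<lambda>n. hidden_planted (M n) (pds (m n) (p0 n) (p1 n) (\<rho> n)) (erdos_renyi (m n) (p0 n)))
             (\<lambda>n. hidden_null (M n) (erdos_renyi (m n) (p0 n)))))"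


section \<open>Weak recovery\<close>

definition frob_inner :: "nat \<Rightarrow> (nat \<Rightarrow> nat \<Rightarrow> real) \<Rightarrow> (nat \<Rightarrow> nat \<Rightarrow> real) \<Rightarrow> real" where
  "frob_inner n A B = (\<Sum>i<n. \<Sum>j<n. A i j * B i j)"

definition frob_norm :: "nat \<Rightarrow> (nat \<Rightarrow> nat \<Rightarrow> real) \<Rightarrow> real" where
  "frob_norm n A = sqrt (frob_inner n A A)"

definition signal :: "real \<Rightarrow> real \<Rightarrow> (nat \<Rightarrow> bool) \<Rightarrow> nat \<Rightarrow> nat \<Rightarrow> real" where
  "signal p0 p1 \<theta> = (\<lambda>i j. (p1 - p0) * of_bool (\<theta> i) * of_bool (\<theta> j))"

definition expected_correlation ::
  "nat \<Rightarrow> real \<Rightarrow> real \<Rightarrow> real \<Rightarrow> nat \<Rightarrow>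
   ((nat \<times> nat \<Rightarrow> bool) \<Rightarrow> (nat \<Rightarrow> bool) \<Rightarrow> nat \<Rightarrow> nat \<Rightarrow> real) \<Rightarrow> real" where
  "expected_correlation n p0 p1 \<rho> r X =
     measure_pmf.expectation (pair_pmf (pds_joint n p0 p1 \<rho>) (coins r))
       (\<lambda>((\<theta>, Y), \<omega>). frob_inner n (X Y \<omega>) (signal p0 p1 \<theta>) /
          (frob_norm n (X Y \<omega>) * frob_norm n (signal p0 p1 \<theta>)))"

definition weak_recovery where
  "weak_recovery p0 p1 \<rho> r X \<longleftrightarrow>
     (\<exists>c>0. \<forall>\<^sub>F n in sequentially. expected_correlation n (p0 n) (p1 n) (\<rho> n) (r n) (X n) \<ge> c)"

end

theory Submission
  imports Defs "HOL-Real_Asymp.Real_Asymp"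
begin

text \<open>
  A recovery algorithm that is too fast yields a test that is too fast.  Take a base pair of graphs with
  larger edge probabilities \<open>h0\<close>, \<open>h1\<close> and split the edges of each sample by a mask: thinned by
  the mask, a planted sample looks like the original model, so the estimator applied to it correlates
  with the community, while given the thinned graph the held-out edges are still independent.  On a
  superlevel set of the estimated matrix the held-out edges are therefore denser under the planted
  law, whereas under the null law a Chernoff bound makes this exponentially unlikely.  That is unlikely enough
  to survive a union bound over all samples of the hidden informative sample problem, so scanning the
  samples one after the other achieves weak detection.  An averaging argument fixes the mask, hence the
  scan needs no randomness besides that of the estimator.

  Hiding the informative sample among \<open>M\<close> ones divides the excess of the squared advantage by \<open>M\<close>; with
  \<open>M\<close> close to its maximal value \<open>N \<Delta>\<close> the advantage is \<open>1 + o(1)\<close> at degree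
  \<open>D = 1 / (\<lambda>\<^sup>2 (log n)\<^sup>2)\<close>.  The heuristic then forbids running time \<open>exp (D / C)\<close>, but the scan
  takes \<open>exp (O(log n + 1 / (\<lambda>\<^sup>2 (log n) ^ 4)))\<close> times the square of the running time of the estimator.
\<close>

section \<open>Programs and their running time\<close>

text \<open>M must be far larger than \<open>\<Delta>\<close> for the advantage to tend to 1,
  whereas the union bound needs a false alarm probability below 1/M. Hence the Chernoff exponent of
  the test must beat log \<open>\<Delta>\<close>, which is of order V = x \<rho>^4 n^2 with x the
  squared signal-to-noise ratio of the base pair. With R = (\<rho> n)^2 and H = h1 - h0 that
  exponent has the order of the smaller of H R and H^2 R / p0, and V is smaller still by the factors
  H \<rho>^2 / p0 and \<rho>^2, which vanish in the limit. The same V governs the running time,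
  since M is of order exp(O(V)) up to powers of n. The assumption on \<lambda>^2 \<rho>^2 n,
  squared, bounds V by O(1 / (\<lambda>^2 (log n)^4) + log n), and D exceeds 1 / (\<lambda>^2 (log
  n)^4) by a factor (log n)^2, of which the scan uses up only one logarithm. Two obstacles shape the
  rest. The cells that the estimator writes are unknown, so every sample is processed in its own
  residue class of addresses, where memory is still blank. And a failing lower bound fails only for
  infinitely many n, so the heuristic is applied along a subsequence.\<close>

lemma bits_le_iff: "bits z \<le> Suc k \<longleftrightarrow> \<bar>z\<bar> < 2 ^ k"
proof -
  have "bits z \<le> Suc k \<longleftrightarrow> nat \<bar>z\<bar> < 2 ^ k"
    by (simp add: bits_def floorlog_le_iff)
  also have "\<dots> \<longleftrightarrow> \<bar>z\<bar> < 2 ^ k"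
    by (simp add: nat_less_iff)
  finally show ?thesis .
qed

lemma bits_pos: "1 \<le> bits z"
  by (simp add: bits_def)

lemma bits_less: "\<bar>z\<bar> < 2 ^ (bits z - 1)"
  using bits_le_iff[of z "bits z - 1"] bits_pos[of z] by simp

lemma bits_mono: "\<bar>x\<bar> \<le> \<bar>y\<bar> \<Longrightarrow> bits x \<le> bits y"
  unfolding bits_def by (intro add_left_mono floorlog_mono nat_mono) auto

lemma bits_0 [simp]: "bits 0 = 1" and bits_1 [simp]: "bits 1 = 2"
  by (simp_all add: bits_def floorlog_def)

lemma bits_add: "bits (x + y) \<le> bits x + bits y"
proof -
  have *: "(2::int) ^ (bits x - 1) + 2 ^ (bits y - 1) \<le> 2 ^ (bits x + bits y - 1)"
  proof -
    have "(2::int) ^ (bits x - 1) \<le> 2 ^ (bits x + bits y - 2)"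
      "(2::int) ^ (bits y - 1) \<le> 2 ^ (bits x + bits y - 2)"
      using bits_pos[of x] bits_pos[of y] by (auto intro!: power_increasing)
    moreover have "(2::int) ^ (bits x + bits y - 1) = 2 * 2 ^ (bits x + bits y - 2)"
      using bits_pos[of x] bits_pos[of y]
      by (metis Nat.le_diff_conv2 Suc_diff_Suc add_mono_thms_linordered_semiring(1) diff_diff_left
          less_eq_Suc_le numeral_2_eq_2 one_add_one plus_1_eq_Suc power_Suc)
    ultimately show ?thesis by linarith
  qed
  have "\<bar>x + y\<bar> < 2 ^ (bits x + bits y - 1)"
    using bits_less[of x] bits_less[of y] * by linarith
  then have "bits (x + y) \<le> Suc (bits x + bits y - 1)"
    using bits_le_iff by blast
  then show ?thesis using bits_pos[of x] by simp
qed

lemma bits_uminus [simp]: "bits (- x) = bits x"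
  by (simp add: bits_def)

lemma bits_diff: "bits (x - y) \<le> bits x + bits y"
  using bits_add[of x "- y"] by simp

lemma bits_mult: "bits (x * y) \<le> bits x + bits y"
proof -
  have "\<bar>x * y\<bar> < 2 ^ (bits x - 1) * 2 ^ (bits y - 1)"
    unfolding abs_mult using bits_less[of x] bits_less[of y]
    by (intro mult_strict_mono') auto
  then have "\<bar>x * y\<bar> < 2 ^ (bits x - 1 + (bits y - 1))"
    by (simp add: power_add)
  then have "bits (x * y) \<le> Suc (bits x - 1 + (bits y - 1))"
    using bits_le_iff by blast
  then show ?thesis using bits_pos[of x] bits_pos[of y] by simp
qed

lemma bits_aval_le_atime: "bits (aval e s) \<le> atime e s"
  by (cases e) auto

text \<open>Every value written has been charged its bit length, so a cell either keeps its old
  length or is bounded by the running time. This controls the memory that one run of the estimator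
  leaves to the rest of the scan.\<close>

lemma exec_bits:
  "exec c s k t \<Longrightarrow> bits (t a z) \<le> max (bits (s a z)) k"
proof (induction arbitrary: a z rule: exec.induct)
  case (Store b e f s)
  have "bits (aval f s) \<le> atime f s" by (rule bits_aval_le_atime)
  then show ?case by auto
next
  case (Seq c s k t d l u)
  from Seq.IH(1)[of a z] Seq.IH(2)[of a z] show ?case by linarith
next
  case (Cond_True b s c k t d)
  from Cond_True.IH[of a z] show ?case by linarith
next
  case (Cond_False b s d k t c)
  from Cond_False.IH[of a z] show ?case by linarith
next
  case (Loop_True b s c k t l u)
  from Loop_True.IH(1)[of a z] Loop_True.IH(2)[of a z] show ?case by linarith
qed auto

lemma exec_time_pos: "exec c s k t \<Longrightarrow> 1 \<le> k"
  by (induction rule: exec.induct) auto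

lemma atime_pos: "1 \<le> atime e s"
  using bits_aval_le_atime[of e s] bits_pos[of "aval e s"] by linarith

text \<open>Crude but compositional bounds: no literal and no memory cell exceeds \<open>B\<close> bits.\<close>

fun nodes :: "aexp \<Rightarrow> nat" where
  "nodes (Lit z) = 1"
| "nodes (Cell a e) = 1 + nodes e"
| "nodes (Add e f) = 1 + nodes e + nodes f"
| "nodes (Sub e f) = 1 + nodes e + nodes f"
| "nodes (Mul e f) = 1 + nodes e + nodes f"

fun lits_le :: "nat \<Rightarrow> aexp \<Rightarrow> bool" where
  "lits_le B (Lit z) \<longleftrightarrow> bits z \<le> B"
| "lits_le B (Cell a e) \<longleftrightarrow> lits_le B e"
| "lits_le B (Add e f) \<longleftrightarrow> lits_le B e \<and> lits_le B f"
| "lits_le B (Sub e f) \<longleftrightarrow> lits_le B e \<and> lits_le B f"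
| "lits_le B (Mul e f) \<longleftrightarrow> lits_le B e \<and> lits_le B f"

lemma bits_aval_le_nodes:
  assumes "lits_le B e" "\<And>a z. bits (s a z) \<le> B"
  shows "bits (aval e s) \<le> nodes e * B"
  using assms(1)
proof (induction e)
  case (Cell a e)
  then show ?case using assms(2)[of a "aval e s"] by (simp add: trans_le_add1)
next
  case (Add e f)
  then show ?case using bits_add[of "aval e s" "aval f s"] by (simp add: algebra_simps)
next
  case (Sub e f)
  then show ?case using bits_diff[of "aval e s" "aval f s"] by (simp add: algebra_simps)
next
  case (Mul e f)
  then show ?case using bits_mult[of "aval e s" "aval f s"] by (simp add: algebra_simps)
qed auto

text \<open>Induction step at a binary operator for the quadratic time bound: a node is charged the
  bit length of its value, which itself grows linearly with the size of the subtree.\<close>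

lemma square_sum_le: "(x + y) * B + x\<^sup>2 * B + y\<^sup>2 * B \<le> (1 + x + y)\<^sup>2 * (B::nat)"
proof -
  have "(1 + x + y)\<^sup>2 * B = (x + y) * B + x\<^sup>2 * B + y\<^sup>2 * B + (1 + x + y + 2 * x * y) * B"
    by (simp add: power2_eq_square algebra_simps)
  then show ?thesis by linarith
qed

lemma atime_le_nodes:
  assumes "lits_le B e" "\<And>a z. bits (s a z) \<le> B"
  shows "atime e s \<le> (nodes e)\<^sup>2 * B"
  using assms(1)
proof (induction e)
  case (Cell a e)
  have "bits (s a (aval e s)) + atime e s \<le> B + (nodes e)\<^sup>2 * B"
    using Cell assms(2) by (intro add_mono) auto
  also have "\<dots> \<le> (1 + nodes e)\<^sup>2 * B" by (simp add: power2_eq_square algebra_simps)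
  finally show ?case by simp
next
  case (Add e f)
  have "bits (aval (Add e f) s) \<le> (nodes e + nodes f) * B"
    using bits_add[of "aval e s" "aval f s"] bits_aval_le_nodes[of B e s] bits_aval_le_nodes[of B f s]
      Add.prems assms(2) by (simp add: algebra_simps)
  then show ?case using Add square_sum_le[of "nodes e" "nodes f" B] by simp
next
  case (Sub e f)
  have "bits (aval (Sub e f) s) \<le> (nodes e + nodes f) * B"
    using bits_diff[of "aval e s" "aval f s"] bits_aval_le_nodes[of B e s] bits_aval_le_nodes[of B f s]
      Sub.prems assms(2) by (simp add: algebra_simps)
  then show ?case using Sub square_sum_le[of "nodes e" "nodes f" B] by simp
next
  case (Mul e f)
  have "bits (aval (Mul e f) s) \<le> (nodes e + nodes f) * B"
    using bits_mult[of "aval e s" "aval f s"] bits_aval_le_nodes[of B e s] bits_aval_le_nodes[of B f s]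
      Mul.prems assms(2) by (simp add: algebra_simps)
  then show ?case using Mul square_sum_le[of "nodes e" "nodes f" B] by simp
qed auto

lemma asize_le_nodes: "lits_le B e \<Longrightarrow> 1 \<le> B \<Longrightarrow> asize e \<le> nodes e * B"
  by (induction e) (auto simp: algebra_simps)

section \<open>Running a program inside one residue class of addresses\<close>

text \<open>Arrays 0, 2, 3 and 4 belong to the scan: input, verdict, sample counter and score. The
  arrays of the simulated program therefore move up by 5, except for the coins: their number is not
  bounded, so they are not copied but shared out by address within array 1.\<close>

definition slot :: "nat \<Rightarrow> nat" where
  "slot a = (if a = 1 then 1 else a + 5)"

text \<open>Address z becomes z M + j, with j the sample counter in array 3. Different samples use
  disjoint residue classes modulo M, so each run finds blank memory, whatever the earlier runs have
  written.\<close>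

definition strided :: "int \<Rightarrow> aexp \<Rightarrow> aexp" where
  "strided M e = Add (Mul e (Lit M)) (Cell 3 (Lit 0))"

fun strided_aexp :: "int \<Rightarrow> aexp \<Rightarrow> aexp" where
  "strided_aexp M (Lit z) = Lit z"
| "strided_aexp M (Cell a e) = Cell (slot a) (strided M (strided_aexp M e))"
| "strided_aexp M (Add e f) = Add (strided_aexp M e) (strided_aexp M f)"
| "strided_aexp M (Sub e f) = Sub (strided_aexp M e) (strided_aexp M f)"
| "strided_aexp M (Mul e f) = Mul (strided_aexp M e) (strided_aexp M f)"

fun strided_com :: "int \<Rightarrow> com \<Rightarrow> com" where
  "strided_com M Pass = Pass"
| "strided_com M (Store a e f) =
     Store (slot a) (strided M (strided_aexp M e)) (strided_aexp M f)"
| "strided_com M (Seq c d) = Seq (strided_com M c) (strided_com M d)"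
| "strided_com M (Cond b c d) = Cond (strided_aexp M b) (strided_com M c) (strided_com M d)"
| "strided_com M (Loop b c) = Loop (strided_aexp M b) (strided_com M c)"

definition view :: "int \<Rightarrow> int \<Rightarrow> memory \<Rightarrow> memory" where
  "view M j s = (\<lambda>a z. s (slot a) (z * M + j))"

lemma slot_eq_iff [simp]: "slot a = slot b \<longleftrightarrow> a = b"
  by (auto simp: slot_def)

lemma slot_neq [simp]: "slot a \<noteq> 0" "slot a \<noteq> 2" "slot a \<noteq> 3" "slot a \<noteq> 4" "slot a \<noteq> 6"
  by (auto simp: slot_def)

lemma slot_cases: "a \<in> {0, 2, 3, 4, 6} \<or> (\<exists>b. a = slot b)"
proof -
  have "a = slot (if a = 1 then 1 else a - 5)" if "a \<notin> {0, 2, 3, 4, 6}"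
    using that by (auto simp: slot_def)
  then show ?thesis by blast
qed

lemma aval_strided [simp]: "aval (strided M e) s = aval e s * M + s 3 0"
  by (simp add: strided_def)

lemma aval_strided_aexp:
  "s 3 0 = j \<Longrightarrow> aval (strided_aexp M e) s = aval e (view M j s)"
  by (induction e) (auto simp: view_def)

lemma atime_strided_le:
  assumes "bits (s 3 0) \<le> bits M"
  shows "atime (strided M e) s \<le> atime e s + 2 * bits (aval e s) + (5 * bits M + 1)"
proof -
  have "bits (aval e s * M) \<le> bits (aval e s) + bits M"
    by (rule bits_mult)
  moreover have "bits (aval e s * M + s 3 0) \<le> bits (aval e s * M) + bits (s 3 0)"
    by (rule bits_add)
  ultimately show ?thesis using assms by (simp add: strided_def)
qed

text \<open>The potential \<open>3 * bits\<close> pays for the address arithmetic of an enclosing \<open>Cell\<close>.\<close>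

lemma atime_strided_aexp:
  assumes j: "s 3 0 = j" "bits j \<le> bits M" and F: "F = 5 * bits M + 5"
  shows "atime (strided_aexp M e) s + 3 * bits (aval e (view M j s)) \<le> F * atime e (view M j s)"
proof (induction e)
  case (Lit z)
  then show ?case using F by simp
next
  case (Cell a e)
  let ?v = "view M j s"
  have a: "atime (strided M (strided_aexp M e)) s
      \<le> atime (strided_aexp M e) s + 2 * bits (aval e ?v) + (5 * bits M + 1)"
    using atime_strided_le[of s M "strided_aexp M e"] j by (simp add: aval_strided_aexp)
  have b: "s (slot a) (aval e ?v * M + j) = ?v a (aval e ?v)"
    by (simp add: view_def)
  have c: "4 * bits (?v a (aval e ?v)) + (5 * bits M + 1) \<le> F * bits (?v a (aval e ?v))"
    unfolding F by (cases "bits (?v a (aval e ?v))")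
      (use bits_pos[of "?v a (aval e ?v)"] in \<open>auto simp: algebra_simps\<close>)
  show ?case using a Cell c j by (simp add: b aval_strided_aexp distrib_left)
next
  case (Add e f)
  let ?x = "bits (aval (Add e f) (view M j s))"
  have "4 * ?x \<le> F * ?x" using F by (intro mult_right_mono) auto
  with Add show ?case
    unfolding strided_aexp.simps atime.simps aval.simps distrib_left aval_strided_aexp[where s = s and j = j, OF j(1)]
    by linarith
next
  case (Sub e f)
  let ?x = "bits (aval (Sub e f) (view M j s))"
  have "4 * ?x \<le> F * ?x" using F by (intro mult_right_mono) auto
  with Sub show ?case
    unfolding strided_aexp.simps atime.simps aval.simps distrib_left aval_strided_aexp[where s = s and j = j, OF j(1)]
    by linarith
next
  case (Mul e f)
  let ?x = "bits (aval (Mul e f) (view M j s))"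
  have "4 * ?x \<le> F * ?x" using F by (intro mult_right_mono) auto
  with Mul show ?case
    unfolding strided_aexp.simps atime.simps aval.simps distrib_left aval_strided_aexp[where s = s and j = j, OF j(1)]
    by linarith
qed

lemma view_update:
  assumes "M > 0"
  shows "view M j (s(slot a := (s (slot a))(z * M + j := v)))
    = (view M j s)(a := (view M j s a)(z := v))"
  using assms by (auto simp: view_def fun_eq_iff)

definition unaffected :: "int \<Rightarrow> int \<Rightarrow> memory \<Rightarrow> memory \<Rightarrow> bool" where
  "unaffected M j s t \<longleftrightarrow>
     (\<forall>a\<in>{0, 2, 3, 4, 6}. t a = s a) \<and> (\<forall>a z. z mod M \<noteq> j mod M \<longrightarrow> t a z = s a z)"

lemma unaffected_refl: "unaffected M j s s"
  and unaffected_trans: "unaffected M j s t \<Longrightarrow> unaffected M j t u \<Longrightarrow> unaffected M j s u"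
  by (auto simp: unaffected_def)

text \<open>Simulation through \<open>view\<close>: a command acts on the residue class of j as the
  original acts on its memory, and address arithmetic costs a factor linear in
  \<open>bits M\<close>. The counter in array 3 must survive every subprogram, since all addresses
  depend on it; \<open>unaffected\<close> carries this through sequences and loops.\<close>

lemma exec_strided:
  assumes "exec c v k v'" "v = view M j s" "s 3 0 = j" "bits j \<le> bits M" "M > 0"
    and F: "F = 5 * bits M + 5"
  shows "\<exists>k' t. exec (strided_com M c) s k' t \<and> v' = view M j t \<and> unaffected M j s t \<and> k' \<le> F * k"
  using assms(1-3)
proof (induction arbitrary: s rule: exec.induct)
  case (Pass v)
  then show ?case using exec.Pass unaffected_refl F by fastforce
next
  case (Store a e f v)
  let ?t = "s(slot a := (s (slot a))(aval e v * M + j := aval f v))"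
  let ?k = "1 + atime (strided M (strided_aexp M e)) s + atime (strided_aexp M f) s"
  have "exec (strided_com M (Store a e f)) s ?k ?t"
    using exec.Store[of "slot a" "strided M (strided_aexp M e)" "strided_aexp M f" s] Store
    by (simp add: aval_strided_aexp)
  moreover have "v(a := (v a)(aval e v := aval f v)) = view M j ?t"
    unfolding view_update[OF \<open>M > 0\<close>] Store ..
  moreover have "unaffected M j s ?t"
    using assms(5) by (auto simp: unaffected_def)
  moreover have "?k \<le> F * (1 + atime e v + atime f v)"
  proof -
    have "atime (strided M (strided_aexp M e)) s
        \<le> atime (strided_aexp M e) s + 2 * bits (aval e v) + (5 * bits M + 1)"
      using atime_strided_le[of s M "strided_aexp M e"] assms(4) Store by (simp add: aval_strided_aexp)
    moreover have "atime (strided_aexp M e) s + 3 * bits (aval e v) \<le> F * atime e v"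
      using atime_strided_aexp[of s j M F e] Store assms(4) F by simp
    moreover have "atime (strided_aexp M f) s + 3 * bits (aval f v) \<le> F * atime f v"
      using atime_strided_aexp[of s j M F f] Store assms(4) F by simp
    ultimately show ?thesis unfolding distrib_left by (simp add: F)
  qed
  ultimately show ?case by blast
next
  case (Seq c v k t d l u)
  from Seq.IH(1)[OF Seq.prems] obtain k1 s1 where 1: "exec (strided_com M c) s k1 s1"
    "t = view M j s1" "unaffected M j s s1" "k1 \<le> F * k" by blast
  then have "s1 3 0 = j" using Seq.prems by (auto simp: unaffected_def)
  from Seq.IH(2)[OF 1(2) this] obtain k2 s2 where 2: "exec (strided_com M d) s1 k2 s2"
    "u = view M j s2" "unaffected M j s1 s2" "k2 \<le> F * l" by blast
  have "exec (strided_com M (Seq c d)) s (k1 + k2) s2" using 1 2 by (auto intro: exec.Seq)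
  moreover have "k1 + k2 \<le> F * (k + l)" using 1 2 by (simp add: distrib_left)
  ultimately show ?case using 1 2 unaffected_trans by blast
next
  case (Cond_True b v c k t d)
  from Cond_True.IH[OF Cond_True.prems] obtain k1 s1 where 1: "exec (strided_com M c) s k1 s1"
    "t = view M j s1" "unaffected M j s s1" "k1 \<le> F * k" by blast
  have "exec (strided_com M (Cond b c d)) s (1 + atime (strided_aexp M b) s + k1) s1"
    using exec.Cond_True[of "strided_aexp M b" s "strided_com M c"] 1 Cond_True
    by (simp add: aval_strided_aexp)
  moreover have "1 + atime (strided_aexp M b) s + k1 \<le> F * (1 + atime b v + k)"
    using atime_strided_aexp[of s j M F b] Cond_True assms(4) F 1
    unfolding distrib_left by simp
  ultimately show ?case using 1 by blast
next
  case (Cond_False b v d k t c)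
  from Cond_False.IH[OF Cond_False.prems] obtain k1 s1 where 1: "exec (strided_com M d) s k1 s1"
    "t = view M j s1" "unaffected M j s s1" "k1 \<le> F * k" by blast
  have "exec (strided_com M (Cond b c d)) s (1 + atime (strided_aexp M b) s + k1) s1"
    using exec.Cond_False[of "strided_aexp M b" s "strided_com M d"] 1 Cond_False
    by (simp add: aval_strided_aexp)
  moreover have "1 + atime (strided_aexp M b) s + k1 \<le> F * (1 + atime b v + k)"
    using atime_strided_aexp[of s j M F b] Cond_False assms(4) F 1
    unfolding distrib_left by simp
  ultimately show ?case using 1 by blast
next
  case (Loop_False b v c)
  have "exec (strided_com M (Loop b c)) s (1 + atime (strided_aexp M b) s) s"
    using exec.Loop_False[of "strided_aexp M b" s "strided_com M c"] Loop_False
    by (simp add: aval_strided_aexp)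
  moreover have "1 + atime (strided_aexp M b) s \<le> F * (1 + atime b v)"
    using atime_strided_aexp[of s j M F b] Loop_False assms(4) F
    unfolding distrib_left by simp
  ultimately show ?case using Loop_False unaffected_refl by blast
next
  case (Loop_True b v c k t l u)
  from Loop_True.IH(1)[OF Loop_True.prems] obtain k1 s1 where 1: "exec (strided_com M c) s k1 s1"
    "t = view M j s1" "unaffected M j s s1" "k1 \<le> F * k" by blast
  then have "s1 3 0 = j" using Loop_True.prems by (auto simp: unaffected_def)
  from Loop_True.IH(2)[OF 1(2) this] obtain k2 s2 where 2: "exec (strided_com M (Loop b c)) s1 k2 s2"
    "u = view M j s2" "unaffected M j s1 s2" "k2 \<le> F * l" by blast
  have "exec (strided_com M (Loop b c)) s (1 + atime (strided_aexp M b) s + k1 + k2) s2"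
    using exec.Loop_True[of "strided_aexp M b" s "strided_com M c" k1 s1 k2 s2] 1 2 Loop_True
    by (simp add: aval_strided_aexp)
  moreover have "1 + atime (strided_aexp M b) s + k1 + k2 \<le> F * (1 + atime b v + k + l)"
    using atime_strided_aexp[of s j M F b] Loop_True assms(4) F 1 2
    unfolding distrib_left by simp
  ultimately show ?case using 1 2 unaffected_trans by blast
qed

lemma asize_strided_aexp: "asize (strided_aexp M e) \<le> (bits M + 6) * asize e"
proof (induction e)
  case (Lit z)
  then show ?case by simp
qed (auto simp: strided_def algebra_simps)

lemma csize_strided_com: "csize (strided_com M c) \<le> (bits M + 6) * csize c"
proof (induction c)
  case (Store a e f)
  then show ?case using asize_strided_aexp[of M e] asize_strided_aexp[of M f]
    by (simp add: strided_def algebra_simps)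
next
  case (Cond b c d)
  then show ?case using asize_strided_aexp[of M b] by (simp add: algebra_simps)
next
  case (Loop b c)
  then show ?case using asize_strided_aexp[of M b] by (simp add: algebra_simps)
qed (auto simp: algebra_simps)

section \<open>Compositional upper bounds on running times\<close>

definition run :: "memory \<Rightarrow> com \<Rightarrow> nat \<Rightarrow> memory \<Rightarrow> bool" where
  "run s c K t \<longleftrightarrow> (\<exists>k\<le>K. exec c s k t)"

lemma run_mono: "run s c K t \<Longrightarrow> K \<le> L \<Longrightarrow> run s c L t"
  by (auto simp: run_def intro: order_trans)

lemma run_Seq: "run s c K t \<Longrightarrow> run t d L w \<Longrightarrow> run s (Seq c d) (K + L) w"
  unfolding run_def by (meson add_mono exec.Seq)

lemma run_Store:
  "atime e s \<le> K \<Longrightarrow> atime f s \<le> K \<Longrightarrow>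
     run s (Store a e f) (1 + 2 * K) (s(a := (s a)(aval e s := aval f s)))"
  unfolding run_def by (rule exI, rule conjI[OF _ exec.Store]) simp

lemma run_Pass: "1 \<le> K \<Longrightarrow> run s Pass K s"
  unfolding run_def using exec.Pass by blast

lemma run_Cond:
  assumes "atime b s \<le> K" "aval b s > 0 \<Longrightarrow> run s c L t" "aval b s \<le> 0 \<Longrightarrow> run s d L t"
  shows "run s (Cond b c d) (1 + K + L) t"
proof (cases "aval b s > 0")
  case True
  with assms obtain k where "k \<le> L" "exec c s k t" by (auto simp: run_def)
  then show ?thesis unfolding run_def using exec.Cond_True[OF True] assms(1)
    by (intro exI[of _ "1 + atime b s + k"]) auto
next
  case False
  with assms obtain k where "k \<le> L" "exec d s k t" by (auto simp: run_def)
  then show ?thesis unfolding run_def using exec.Cond_False[of b s d k t c] assms(1) False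
    by (intro exI[of _ "1 + atime b s + k"]) auto
qed

fun seqs :: "com list \<Rightarrow> com" where
  "seqs [] = Pass"
| "seqs (c # cs) = Seq c (seqs cs)"

lemma csize_seqs: "(\<And>c. c \<in> set cs \<Longrightarrow> csize c \<le> K) \<Longrightarrow> csize (seqs cs) \<le> length cs * (K + 1) + 1"
proof (induction cs)
  case (Cons c cs)
  then have "csize c \<le> K" "csize (seqs cs) \<le> length cs * (K + 1) + 1" by auto
  then show ?case by (simp add: algebra_simps)
qed simp

text \<open>Edges are handled by straight-line code with one block per edge, because the mask bits
  and addresses of an edge are literals of the program. The invariant is indexed by the prefix
  already processed.\<close>

lemma run_seqs_append:
  assumes "\<And>ys x zs s. xs = ys @ x # zs \<Longrightarrow> I ys s \<Longrightarrow> \<exists>t. run s (f x) K t \<and> I (ys @ [x]) t"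
    and "xs = ys @ zs" "I ys s"
  shows "\<exists>t. run s (seqs (map f zs)) (length zs * K + 1) t \<and> I xs t"
  using assms(2,3)
proof (induction zs arbitrary: ys s)
  case Nil
  then show ?case using run_Pass[of 1] by auto
next
  case (Cons x zs)
  from assms(1)[OF Cons.prems] obtain s' where 1: "run s (f x) K s'" "I (ys @ [x]) s'" by blast
  with Cons.IH[of "ys @ [x]" s'] Cons.prems obtain t where
    2: "run s' (seqs (map f zs)) (length zs * K + 1) t" "I xs t" by auto
  from run_Seq[OF 1(1) 2(1)] 2(2) show ?case by (auto simp: algebra_simps)
qed

lemma run_seqs:
  assumes "\<And>ys x zs s. xs = ys @ x # zs \<Longrightarrow> I ys s \<Longrightarrow> \<exists>t. run s (f x) K t \<and> I (ys @ [x]) t"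
    and "I [] s"
  shows "\<exists>t. run s (seqs (map f xs)) (length xs * K + 1) t \<and> I xs t"
proof (rule run_seqs_append[of xs I f K "[]" xs s])
  show "\<exists>t. run s (f x) K t \<and> I (ys @ [x]) t" if "xs = ys @ x # zs" "I ys s" for ys x zs s
    using that by (rule assms(1))
qed (use assms(2) in simp_all)

lemma run_Loop:
  assumes step: "\<And>j s. j < M \<Longrightarrow> I j s \<Longrightarrow> aval b s > 0 \<and> (\<exists>t. run s c K t \<and> I (Suc j) t)"
    and stop: "\<And>s. I M s \<Longrightarrow> aval b s \<le> 0"
    and time: "\<And>j s. I j s \<Longrightarrow> atime b s \<le> L"
  shows "j \<le> M \<Longrightarrow> I j s \<Longrightarrow> \<exists>t. run s (Loop b c) ((M - j) * (1 + L + K) + (1 + L)) t \<and> I M t"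
proof (induction "M - j" arbitrary: j s)
  case 0
  then have "I M s" by simp
  then show ?case using exec.Loop_False[OF stop[of s], of c] time[of M s] 0
    by (fastforce simp: run_def)
next
  case (Suc d)
  then have j: "j < M" by simp
  from step[OF j Suc.prems(2)] obtain t where 1: "aval b s > 0" "run s c K t" "I (Suc j) t" by blast
  have "d = M - Suc j" "Suc j \<le> M" using Suc.hyps(2) j by auto
  from Suc.hyps(1)[OF this 1(3)] obtain w where
    2: "run t (Loop b c) ((M - Suc j) * (1 + L + K) + (1 + L)) w" "I M w" by blast
  from 1 2 obtain k l where k: "k \<le> K" "exec c s k t"
    "l \<le> (M - Suc j) * (1 + L + K) + (1 + L)" "exec (Loop b c) t l w"
    by (auto simp: run_def)
  have "M - j = Suc (M - Suc j)" using j by simp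
  then have "(M - j) * (1 + L + K) = (1 + L + K) + (M - Suc j) * (1 + L + K)"
    by (metis mult_Suc)
  then have "1 + atime b s + k + l \<le> (M - j) * (1 + L + K) + (1 + L)"
    using k time[OF Suc.prems(2)] by linarith
  then show ?case using exec.Loop_True[OF 1(1) k(2,4)] 2(2) unfolding run_def by blast
qed

section \<open>The scan test and its program\<close>

text \<open>The estimate need not be symmetric; the flag selects the triangle of the matrix that is
  read.\<close>

definition entry :: "bool \<Rightarrow> (nat \<Rightarrow> nat \<Rightarrow> 'a) \<Rightarrow> nat \<times> nat \<Rightarrow> 'a" where
  "entry d A e = (case e of (i, j) \<Rightarrow> if d then A j i else A i j)"

text \<open>Thresholds range over the entries themselves, so there are at most n^2 candidate sets
  and no real threshold has to be represented. Positivity is required because entries near 0 carry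
  no correlation.\<close>

definition superlevel :: "nat \<Rightarrow> (nat \<times> nat \<Rightarrow> real) \<Rightarrow> nat \<times> nat \<Rightarrow> (nat \<times> nat) set" where
  "superlevel n Z f = {e \<in> edges n. 0 < Z e \<and> Z f \<le> Z e}"

text \<open>The mask prescribes the new value both for a present and for an absent edge. Switching
  absent edges on is the second degree of freedom that makes it possible to match two edge
  probabilities at once.\<close>

definition thin :: "('e \<Rightarrow> bool \<times> bool) \<Rightarrow> ('e \<Rightarrow> bool) \<Rightarrow> 'e \<Rightarrow> bool" where
  "thin w y e = (if y e then fst (w e) else snd (w e))"

text \<open>Integer form of the excess of present edges over a rate of P / Q per edge.\<close>

definition score :: "int \<Rightarrow> int \<Rightarrow> 'e set \<Rightarrow> ('e \<Rightarrow> bool) \<Rightarrow> int" where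
  "score P Q A y = (\<Sum>e\<in>A. Q * of_bool (y e) - P)"

text \<open>Here y' is the thinned graph seen by the estimator. Its edges are left out, since only
  on the remaining ones is y independent of the estimate.\<close>

definition scan_accepts ::
  "nat \<Rightarrow> int \<Rightarrow> int \<Rightarrow> int \<Rightarrow> (nat \<times> nat \<Rightarrow> real) \<Rightarrow> (nat \<times> nat \<Rightarrow> bool) \<Rightarrow>
    (nat \<times> nat \<Rightarrow> bool) \<Rightarrow> bool" where
  "scan_accepts n P Q S Z y' y \<longleftrightarrow> (\<exists>f\<in>edges n. S < score P Q (superlevel n Z f - {e. y' e}) y)"

lemma finite_edges [simp]: "finite (edges n)"
  by (rule finite_subset[of _ "{..<n} \<times> {..<n}"]) (auto simp: edges_def)

lemma card_edges_le: "card (edges n) \<le> n\<^sup>2"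
proof -
  have "card (edges n) \<le> card ({..<n} \<times> {..<n})"
    by (intro card_mono) (auto simp: edges_def)
  then show ?thesis by (simp add: power2_eq_square)
qed

lemma mult_add_eq_iff: "j < n \<Longrightarrow> j' < n \<Longrightarrow> i * n + j = i' * n + j' \<longleftrightarrow> i = i' \<and> j = (j'::nat)"
  by (metis add.commute add_right_cancel div_mult_self1 div_less mod_less mod_mult_self1 not_less_zero)

lemma inj_on_edge_addr: "inj_on (edge_addr n) (edges n)"
  by (auto simp: inj_on_def edge_addr_def edges_def mult_add_eq_iff)

lemma edge_addr_less: "e \<in> edges n \<Longrightarrow> edge_addr n e < n\<^sup>2"
proof -
  assume "e \<in> edges n"
  then obtain i j where e: "e = (i, j)" "i < j" "j < n" by (auto simp: edges_def)
  have "i * n + j < Suc i * n" using e by simp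
  also have "\<dots> \<le> n * n" using e by (intro mult_right_mono) auto
  finally show ?thesis by (simp add: edge_addr_def e power2_eq_square)
qed

lemma inj_on_hidden_edge_addr: "inj_on (hidden_edge_addr n) (A \<times> edges n)"
  using inj_on_edge_addr[of n] edge_addr_less
  by (auto simp: inj_on_def hidden_edge_addr_def mult_add_eq_iff)

lemma init_mem_addr:
  assumes "inj_on addr I" "i \<in> I" "\<And>i. y i \<Longrightarrow> i \<in> I"
  shows "init_mem addr y \<omega> 0 (int (addr i)) = of_bool (y i)"
proof -
  have "(\<exists>k. y k \<and> addr k = addr i) \<longleftrightarrow> y i"
    using assms by (auto simp: inj_on_def)
  then show ?thesis by (simp add: init_mem_def)
qed

lemma init_mem_bits: "bits (init_mem addr y \<omega> a z) \<le> 2"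
  by (auto simp: init_mem_def)

text \<open>Multiplication by squared denominators preserves order, and the added 1 turns a weak
  inequality of integers into the strict one that \<open>Cond\<close> tests. Vanishing denominators
  agree with division by 0: such an entry is 0, never positive, and as a threshold it admits every
  positive entry, because both products that are compared vanish.\<close>

lemma entry_compare:
  assumes "Ze = of_int a / of_int b" "Zf = of_int c / (of_int d :: real)"
  shows "(0 < Ze \<and> Zf \<le> Ze) \<longleftrightarrow> a * b > 0 \<and> 1 + (a * b * (d * d) - c * d * (b * b)) > 0"
proof (cases "b = 0")
  case True
  then show ?thesis using assms by simp
next
  case b: False
  have 1: "0 < Ze \<longleftrightarrow> a * b > 0"
    unfolding assms by (simp add: zero_less_divide_iff zero_less_mult_iff)
  show ?thesis
  proof (cases "d = 0")
    case True
    then show ?thesis using 1 assms by auto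
  next
    case d: False
    have *: "x / p \<le> y / q \<longleftrightarrow> x * q \<le> y * p" if "p > 0" "q > 0" for x y p q :: real
      using that by (simp add: field_simps)
    have "Zf \<le> Ze \<longleftrightarrow> real_of_int (c * d) / of_int (d * d) \<le> of_int (a * b) / of_int (b * b)"
      using b d unfolding assms by simp
    also have "\<dots> \<longleftrightarrow> real_of_int (c * d) * of_int (b * b) \<le> of_int (a * b) * of_int (d * d)"
      using * b d by (metis not_real_square_gt_zero of_int_eq_0_iff of_int_mult)
    also have "\<dots> \<longleftrightarrow> c * d * (b * b) \<le> a * b * (d * d)"
      by (metis of_int_le_iff of_int_mult)
    finally show ?thesis using 1 by auto
  qed
qed

text \<open>
  The arrays of the simulated program live in the slots, strided over the samples.  Array 3 counts
  the samples, array 4 accumulates the score.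
\<close>

locale scan_program =
  fixes n M B :: nat and w :: "nat \<times> nat \<Rightarrow> bool \<times> bool" and d :: bool
    and P Q S :: int and c :: com and es :: "(nat \<times> nat) list"
  assumes M_pos: "0 < M"
    and mask: "\<And>e. snd (w e) \<Longrightarrow> e \<in> edges n"
    and es: "set es = edges n" "distinct es"
    and B: "4 \<le> B" "bits (int M) \<le> B" "bits (int (n\<^sup>2)) \<le> B"
      "bits P \<le> B" "bits Q \<le> B" "bits S \<le> B"
      "bits (int (n\<^sup>2) * (\<bar>P\<bar> + \<bar>Q\<bar>)) \<le> B"
begin

definition "input e =
  Cell 0 (Add (Mul (Cell 3 (Lit 0)) (Lit (int (n\<^sup>2)))) (Lit (int (edge_addr n e))))"

text \<open>On bits, the choice between the two mask values u and v is the affine function y (u - v)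
  + v.\<close>

definition "thinned e =
  Add (Mul (input e) (Lit (of_bool (fst (w e)) - of_bool (snd (w e))))) (Lit (of_bool (snd (w e))))"

definition "copy e = Store 5 (strided (int M) (Lit (int (edge_addr n e)))) (thinned e)"

definition "cell_addr e = int (entry d (\<lambda>i j. i * n + j) e)"

text \<open>7 and 8 are the slots of the output arrays 2 and 3, numerators and denominators.\<close>

definition "num e = Cell 7 (strided (int M) (Lit (cell_addr e)))"
definition "den e = Cell 8 (strided (int M) (Lit (cell_addr e)))"

definition "pos_entry e = Mul (num e) (den e)"

definition "above_entry f e = Add (Lit 1)
  (Sub (Mul (pos_entry e) (Mul (den f) (den f))) (Mul (pos_entry f) (Mul (den e) (den e))))"

definition "add_edge f e =
  Cond (pos_entry e) (Cond (above_entry f e) (Cond (Sub (Lit 1) (thinned e))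
    (Store 4 (Lit 0) (Add (Cell 4 (Lit 0)) (Sub (Mul (Lit Q) (input e)) (Lit P))))
    Pass) Pass) Pass"

definition "scan_level f =
  Seq (Store 4 (Lit 0) (Lit 0)) (Seq (seqs (map (add_edge f) es))
    (Cond (Sub (Cell 4 (Lit 0)) (Lit S)) (Store 2 (Lit 0) (Lit 1)) Pass))"

definition "scan_sample =
  Seq (seqs (map copy es)) (Seq (strided_com (int M) c) (Seq (seqs (map scan_level es))
    (Store 3 (Lit 0) (Add (Cell 3 (Lit 0)) (Lit 1)))))"

definition "scan_all = Loop (Sub (Lit (int M)) (Cell 3 (Lit 0))) scan_sample"

lemmas exp_defs = input_def thinned_def num_def den_def pos_entry_def above_entry_def strided_def

lemma addr_bits:
  "e \<in> edges n \<Longrightarrow> bits (int (edge_addr n e)) \<le> B"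
  "e \<in> edges n \<Longrightarrow> bits (cell_addr e) \<le> B"
proof -
  assume e: "e \<in> edges n"
  have "edge_addr n e < n\<^sup>2" by (rule edge_addr_less[OF e])
  then have "bits (int (edge_addr n e)) \<le> bits (int (n\<^sup>2))"
    by (intro bits_mono) (simp only: abs_of_nat of_nat_le_iff)
  then show "bits (int (edge_addr n e)) \<le> B" using B(3) by linarith
  obtain i j where ij: "e = (i, j)" "i < j" "j < n" using e by (auto simp: edges_def)
  have *: "a * n + b \<le> n\<^sup>2" if "a < n" "b < n" for a b
  proof -
    have "a * n + b \<le> Suc a * n" using that by simp
    also have "\<dots> \<le> n * n" using that by (intro mult_right_mono) auto
    finally show ?thesis by (simp add: power2_eq_square)
  qed
  have "entry d (\<lambda>i j. i * n + j) e \<le> n\<^sup>2"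
    using ij *[of i j] *[of j i] by (auto simp: entry_def)
  then have "bits (cell_addr e) \<le> bits (int (n\<^sup>2))"
    unfolding cell_addr_def by (intro bits_mono) (simp only: abs_of_nat of_nat_le_iff)
  then show "bits (cell_addr e) \<le> B" using B(3) by linarith
qed

lemma bits_small: "bits (of_bool b) \<le> B" "bits (of_bool b - of_bool b') \<le> B" "bits 1 \<le> B" "bits 0 \<le> B"
  using B(1) by (auto simp: bits_def floorlog_def)

lemma exp_lits:
  assumes "e \<in> edges n"
  shows "lits_le B (input e)" "lits_le B (thinned e)" "lits_le B (num e)" "lits_le B (den e)"
    "lits_le B (pos_entry e)" "lits_le B (strided (int M) (Lit (int (edge_addr n e))))"
  using addr_bits[OF assms] B bits_small by (auto simp: exp_defs)

lemma above_entry_lits: "e \<in> edges n \<Longrightarrow> f \<in> edges n \<Longrightarrow> lits_le B (above_entry f e)"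
  using exp_lits[of e] exp_lits[of f] bits_small by (auto simp: above_entry_def)

text \<open>The largest of these expressions, \<open>above_entry\<close>, has 65 nodes. The square
  4900 of the round bound 70 is the constant in all the time estimates that follow.\<close>

lemma exp_nodes:
  "nodes (input e) \<le> 70" "nodes (thinned e) \<le> 70" "nodes (pos_entry e) \<le> 70"
  "nodes (above_entry f e) \<le> 70" "nodes (strided (int M) (Lit z)) \<le> 70"
  "nodes (Sub (Lit 1) (thinned e)) \<le> 70"
  "nodes (Add (Cell 4 (Lit 0)) (Sub (Mul (Lit Q) (input e)) (Lit P))) \<le> 70"
  by (simp_all add: exp_defs)

lemma atime_le:
  assumes "lits_le B e" "nodes e \<le> 70" "\<And>a z. bits (s a z) \<le> B"
  shows "atime e s \<le> 4900 * B"
proof -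
  have "atime e s \<le> (nodes e)\<^sup>2 * B" by (rule atime_le_nodes[OF assms(1,3)])
  also have "\<dots> \<le> 70\<^sup>2 * B" using assms(2) by (intro mult_right_mono power_mono) auto
  finally show ?thesis by simp
qed

lemma asize_le:
  assumes "lits_le B e" "nodes e \<le> 70"
  shows "asize e \<le> 70 * B"
proof -
  have "asize e \<le> nodes e * B" using B by (intro asize_le_nodes assms) auto
  also have "\<dots> \<le> 70 * B" using assms(2) by (rule mult_right_mono) simp
  finally show ?thesis .
qed

lemma length_es: "length es \<le> n\<^sup>2"
  using card_edges_le[of n] es distinct_card[of es] by simp

context
  fixes y :: "nat \<times> (nat \<times> nat) \<Rightarrow> bool" and \<omega> :: "nat \<Rightarrow> bool"
  assumes y: "\<And>i. y i \<Longrightarrow> i \<in> {..<M} \<times> edges n"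
begin

definition "init = init_mem (hidden_edge_addr n) y \<omega>"

abbreviation "sample j \<equiv> (\<lambda>e. y (j, e))"

definition "coin j = (\<lambda>z. \<omega> (z * M + j))"

lemma init_input:
  assumes "j < M" "e \<in> edges n"
  shows "init 0 (int j * int (n\<^sup>2) + int (edge_addr n e)) = of_bool (y (j, e))"
proof -
  have "int j * int (n\<^sup>2) + int (edge_addr n e) = int (hidden_edge_addr n (j, e))"
    by (simp add: hidden_edge_addr_def)
  then show ?thesis
    using init_mem_addr[OF inj_on_hidden_edge_addr, of "(j, e)" "{..<M}" n y \<omega>] assms y
    unfolding init_def by auto
qed

lemma aval_input:
  assumes "j < M" "e \<in> edges n" "s 0 = init 0" "s 3 0 = int j"
  shows "aval (input e) s = of_bool (y (j, e))"
  using init_input[OF assms(1,2)] assms(3,4) by (simp add: input_def)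

lemma aval_thinned:
  assumes "j < M" "e \<in> edges n" "s 0 = init 0" "s 3 0 = int j"
  shows "aval (thinned e) s = of_bool (thin w (sample j) e)"
  using aval_input[OF assms] by (auto simp: thinned_def thin_def)

lemma thin_edges: "thin w (sample j) e \<Longrightarrow> e \<in> edges n"
  using y[of "(j, e)"] mask[of e] by (auto simp: thin_def split: if_splits)

definition copied :: "nat \<Rightarrow> memory \<Rightarrow> (nat \<times> nat) list \<Rightarrow> memory" where
  "copied j s xs = s(5 := (\<lambda>z. if \<exists>e\<in>set xs. z = int (edge_addr n e) * int M + int j
     then of_bool (\<exists>e\<in>set xs. z = int (edge_addr n e) * int M + int j \<and> thin w (sample j) e)
     else s 5 z))"

lemma copied_bits:
  assumes "\<And>a z. bits (s a z) \<le> B"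
  shows "bits (copied j s xs a z) \<le> B"
  using assms bits_small by (auto simp: copied_def)

lemma copied_step:
  assumes "e \<in> edges n" "set xs \<subseteq> edges n"
  shows "(copied j s xs)(5 := (copied j s xs 5)(int (edge_addr n e) * int M + int j
      := of_bool (thin w (sample j) e))) = copied j s (xs @ [e])"
proof -
  have "edge_addr n e = edge_addr n e' \<longleftrightarrow> e' = e" if "e' \<in> set xs" for e'
    using inj_on_edge_addr[of n] assms that by (auto simp: inj_on_def)
  then show ?thesis
    using M_pos by (fastforce simp: copied_def fun_eq_iff)
qed

lemma run_copy:
  assumes s: "s 0 = init 0" "s 3 0 = int j" "j < M" and bits: "\<And>a z. bits (s a z) \<le> B"
  shows "run s (seqs (map copy es)) (length es * (1 + 2 * (4900 * B)) + 1) (copied j s es)"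
proof -
  have "\<exists>t. run s (seqs (map copy es)) (length es * (1 + 2 * (4900 * B)) + 1) t \<and> t = copied j s es"
  proof (rule run_seqs[where I = "\<lambda>xs t. t = copied j s xs"])
    fix ys x zs t
    assume es': "es = ys @ x # zs" and t: "t = copied j s ys"
    have x: "x \<in> edges n" "set ys \<subseteq> edges n" using es(1) es' by auto
    have t': "t 0 = init 0" "t 3 0 = int j" using s t by (auto simp: copied_def)
    have tb: "\<And>a z. bits (t a z) \<le> B" unfolding t by (rule copied_bits[OF bits])
    have "run t (copy x) (1 + 2 * (4900 * B))
       (t(5 := (t 5)(int (edge_addr n x) * int M + int j := of_bool (thin w (sample j) x))))"
      using run_Store[of "strided (int M) (Lit (int (edge_addr n x)))" t "4900 * B" "thinned x" 5]
        atime_le[OF _ _ tb] exp_lits[OF x(1)] exp_nodes t'(2) aval_thinned[OF s(3) x(1) t']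
      by (simp add: copy_def)
    then show "\<exists>t'. run t (copy x) (1 + 2 * (4900 * B)) t' \<and> t' = copied j s (ys @ [x])"
      using copied_step[OF x] unfolding t by auto
  qed (auto simp: copied_def fun_eq_iff)
  then show ?thesis by simp
qed

text \<open>Residues from j on are untouched so far. Apart from the copied graph the simulated
  program thus sees zeros, and its array 1 shows the coins at positions congruent to j. Negative
  addresses remain negative because j < M.\<close>

lemma view_copied:
  assumes "j < M"
    and s: "\<And>a z. int j \<le> z mod int M \<Longrightarrow> s (slot a) z = init (slot a) z"
  shows "view (int M) (int j) (copied j s es) = init_mem (edge_addr n) (thin w (sample j)) (coin j)"
proof -
  have mod: "(z * int M + int j) mod int M = int j" for z using assms(1) by simp
  have 5: "s 5 (z * int M + int j) = 0" for z
    using s[of "z * int M + int j" 0] mod[of z] by (simp add: slot_def init_def init_mem_def)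
  have 1: "s 1 (z * int M + int j) = of_bool (z \<ge> 0 \<and> coin j (nat z))" for z
  proof -
    have "(0 \<le> z * int M + int j) = (0 \<le> z)"
    proof
      assume "0 \<le> z * int M + int j"
      moreover have "z * int M + int j < 0" if "z < 0"
      proof -
        have "z * int M \<le> (-1) * int M" using that by (intro mult_right_mono) auto
        then show ?thesis using assms(1) by linarith
      qed
      ultimately show "0 \<le> z" by linarith
    qed simp
    moreover have "nat (z * int M + int j) = nat z * M + j" if "0 \<le> z"
      using that by (simp add: nat_add_distrib nat_mult_distrib)
    ultimately show ?thesis
      using s[of "z * int M + int j" 1] mod[of z]
      by (auto simp: slot_def init_def init_mem_def coin_def)
  qed
  have other: "s (a + 5) (z * int M + int j) = 0" if "a \<noteq> 1" for a z
    using s[of "z * int M + int j" a] mod[of z] that by (simp add: slot_def init_def init_mem_def)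
  show ?thesis
  proof (intro ext)
    fix a :: nat and z :: int
    consider "a = 0" | "a = 1" | "a \<noteq> 0" "a \<noteq> 1" by blast
    then show "view (int M) (int j) (copied j s es) a z
      = init_mem (edge_addr n) (thin w (sample j)) (coin j) a z"
    proof cases
      case 1
      have "(\<exists>e. thin w (sample j) e \<and> int (edge_addr n e) = z)
          \<longleftrightarrow> (\<exists>e\<in>edges n. z = int (edge_addr n e) \<and> thin w (sample j) e)"
        using thin_edges by auto
      then show ?thesis
        using 1 M_pos 5 by (auto simp: view_def copied_def slot_def init_mem_def es(1))
    next
      case 2
      then show ?thesis using 1[of z] by (simp add: view_def copied_def slot_def init_mem_def)
    next
      case 3
      then show ?thesis using other by (auto simp: view_def copied_def slot_def init_mem_def)
    qed
  qed
qed


definition with_score :: "memory \<Rightarrow> int \<Rightarrow> int \<Rightarrow> memory" where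
  "with_score s x b = s(4 := (s 4)(0 := x), 2 := (s 2)(0 := b))"

lemma with_score_bits:
  "\<lbrakk>\<And>a z. bits (s a z) \<le> B; bits x \<le> B; bits b \<le> B\<rbrakk> \<Longrightarrow> bits (with_score s x b a z) \<le> B"
  by (auto simp: with_score_def)

lemma aval_with_score:
  "aval (input e) (with_score s x b) = aval (input e) s"
  "aval (thinned e) (with_score s x b) = aval (thinned e) s"
  "aval (pos_entry e) (with_score s x b) = aval (pos_entry e) s"
  "aval (above_entry f e) (with_score s x b) = aval (above_entry f e) s"
  by (simp_all add: exp_defs with_score_def)

lemma score_bits:
  assumes "A \<subseteq> edges n"
  shows "bits (score P Q A z) \<le> B"
proof -
  have "\<bar>score P Q A z\<bar> \<le> (\<Sum>e\<in>A. \<bar>Q * of_bool (z e) - P\<bar>)"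
    unfolding score_def by (rule sum_abs)
  also have "\<dots> \<le> (\<Sum>e\<in>A. \<bar>P\<bar> + \<bar>Q\<bar>)"
    by (intro sum_mono) (auto simp: of_bool_def)
  also have "\<dots> = int (card A) * (\<bar>P\<bar> + \<bar>Q\<bar>)" by simp
  also have "\<dots> \<le> int (n\<^sup>2) * (\<bar>P\<bar> + \<bar>Q\<bar>)"
    by (intro mult_right_mono of_nat_mono order_trans[OF card_mono[OF finite_edges assms] card_edges_le])
      auto
  finally have "bits (score P Q A z) \<le> bits (int (n\<^sup>2) * (\<bar>P\<bar> + \<bar>Q\<bar>))"
    by (intro bits_mono) linarith
  then show ?thesis using B by linarith
qed

context
  fixes j :: nat and s :: memory and A :: "nat \<Rightarrow> nat \<Rightarrow> real"
  assumes s: "s 0 = init 0" "s 3 0 = int j" "j < M" and s_bits: "\<And>a z. bits (s a z) \<le> B"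
    and out: "out_matrix n (view (int M) (int j) s) A"
begin

abbreviation "level f \<equiv> superlevel n (entry d A) f - {e. thin w (sample j) e}"

lemma entry_quotient:
  assumes "e \<in> edges n"
  shows "entry d A e = of_int (aval (num e) s) / of_int (aval (den e) s)"
proof -
  obtain i k where e: "e = (i, k)" "i < n" "k < n" using assms by (auto simp: edges_def)
  have "aval (num e) s = view (int M) (int j) s 2 (cell_addr e)"
    "aval (den e) s = view (int M) (int j) s 3 (cell_addr e)"
    using s by (simp_all add: num_def den_def view_def slot_def)
  then show ?thesis using out e by (auto simp: out_matrix_def cell_addr_def entry_def)
qed

lemma level_iff:
  assumes "e \<in> edges n" "f \<in> edges n"
  shows "e \<in> level f \<longleftrightarrow> aval (pos_entry e) s > 0 \<and> aval (above_entry f e) s > 0 \<and>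
    aval (Sub (Lit 1) (thinned e)) s > 0"
  using entry_compare[OF entry_quotient[OF assms(1)] entry_quotient[OF assms(2)]] assms(1)
    aval_thinned[OF s(3) assms(1) s(1,2)]
  by (auto simp: superlevel_def pos_entry_def above_entry_def)

lemma run_add_edge:
  assumes e: "e \<in> edges n" "f \<in> edges n" and b: "bits x \<le> B" "bits b \<le> B"
  shows "run (with_score s x b) (add_edge f e) (30000 * B)
    (with_score s (x + (if e \<in> level f then Q * of_bool (y (j, e)) - P else 0)) b)"
    (is "run ?t _ _ ?t'")
proof -
  note tb = with_score_bits[OF s_bits b]
  have in_t: "aval (input e) ?t = of_bool (y (j, e))"
    unfolding aval_with_score by (rule aval_input[OF s(3) e(1) s(1,2)])
  have store: "e \<in> level f \<Longrightarrow>
    run ?t (Store 4 (Lit 0) (Add (Cell 4 (Lit 0)) (Sub (Mul (Lit Q) (input e)) (Lit P))))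
      (1 + 2 * (4900 * B)) ?t'"
  proof -
    assume lev: "e \<in> level f"
    have "?t(4 := (?t 4)(aval (Lit 0) ?t :=
      aval (Add (Cell 4 (Lit 0)) (Sub (Mul (Lit Q) (input e)) (Lit P))) ?t)) = ?t'"
      using lev in_t by (simp add: with_score_def fun_eq_iff)
    moreover have "atime (Lit 0) ?t \<le> 4900 * B"
      using B by simp
    moreover have "atime (Add (Cell 4 (Lit 0)) (Sub (Mul (Lit Q) (input e)) (Lit P))) ?t \<le> 4900 * B"
      using exp_lits(1)[OF e(1)] B by (intro atime_le exp_nodes tb) auto
    ultimately show ?thesis using run_Store by metis
  qed
  have skip: "e \<notin> level f \<Longrightarrow> run ?t Pass (1 + 2 * (4900 * B)) ?t'"
  proof -
    assume "e \<notin> level f"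
    then have "?t' = ?t" by (simp only: if_False add_0_right)
    then show ?thesis using run_Pass by simp
  qed
  have lev: "e \<in> level f \<longleftrightarrow> aval (pos_entry e) ?t > 0 \<and> aval (above_entry f e) ?t > 0 \<and>
      aval (Sub (Lit 1) (thinned e)) ?t > 0"
    unfolding level_iff[OF e] by (simp add: aval_with_score)
  have at: "atime (pos_entry e) ?t \<le> 4900 * B" "atime (above_entry f e) ?t \<le> 4900 * B"
    "atime (Sub (Lit 1) (thinned e)) ?t \<le> 4900 * B"
    using exp_lits[OF e(1)] above_entry_lits[OF e] bits_small
    by (intro atime_le exp_nodes tb; simp)+
  let ?L = "1 + 2 * (4900 * B)"
  have c1: "aval (pos_entry e) ?t > 0 \<Longrightarrow> aval (above_entry f e) ?t > 0 \<Longrightarrow>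
    run ?t (Cond (Sub (Lit 1) (thinned e))
    (Store 4 (Lit 0) (Add (Cell 4 (Lit 0)) (Sub (Mul (Lit Q) (input e)) (Lit P)))) Pass)
    (1 + 4900 * B + ?L) ?t'"
    by (rule run_Cond[OF at(3) store skip]) (use lev in auto)
  have c2: "aval (pos_entry e) ?t > 0 \<Longrightarrow>
    run ?t (Cond (above_entry f e) (Cond (Sub (Lit 1) (thinned e))
    (Store 4 (Lit 0) (Add (Cell 4 (Lit 0)) (Sub (Mul (Lit Q) (input e)) (Lit P)))) Pass) Pass)
    (1 + 4900 * B + (1 + 4900 * B + ?L)) ?t'"
    by (rule run_Cond[OF at(2) c1 run_mono[OF skip]]) (use lev in auto)
  \<comment> \<open>Three guards at 4900 B each and a store at twice that amount to 24500 B plus a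
    constant.\<close>
  have "run ?t (add_edge f e) (1 + 4900 * B + (1 + 4900 * B + (1 + 4900 * B + ?L))) ?t'"
    unfolding add_edge_def
    by (rule run_Cond[OF at(1) c2 run_mono[OF skip]]) (use lev in auto)
  then show ?thesis by (rule run_mono) (use B in simp)
qed

lemma run_scan_level:
  assumes f: "f \<in> edges n" and b: "bits x \<le> B" "bits b \<le> B"
  shows "run (with_score s x b) (scan_level f) (30000 * B * (length es + 2))
    (with_score s (score P Q (level f) (sample j))
      (if S < score P Q (level f) (sample j) then 1 else b))"
proof -
  let ?x = "\<lambda>ys. score P Q (level f \<inter> set ys) (sample j)"
  have x_bits: "bits (score P Q (level f \<inter> C) (sample j)) \<le> B" for C
    by (rule score_bits) (auto simp: superlevel_def)
  have 1: "run (with_score s x b) (Store 4 (Lit 0) (Lit 0)) (1 + 2 * (4900 * B)) (with_score s 0 b)"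
    using run_Store[of "Lit 0" "with_score s x b" "4900 * B" "Lit 0" 4] B
    by (simp add: with_score_def fun_upd_twist)
  have "\<exists>t. run (with_score s 0 b) (seqs (map (add_edge f) es)) (length es * (30000 * B) + 1) t \<and>
    t = with_score s (?x es) b"
  proof (rule run_seqs[where I = "\<lambda>ys t. t = with_score s (?x ys) b"])
    fix ys e zs t
    assume eq: "es = ys @ e # zs" and t: "t = with_score s (?x ys) b"
    have e: "e \<in> edges n" "e \<notin> set ys" using es eq by auto
    have "?x (ys @ [e]) = ?x ys + (if e \<in> level f then Q * of_bool (y (j, e)) - P else 0)"
      using e(2) by (auto simp: score_def Int_insert_right)
    then show "\<exists>t'. run t (add_edge f e) (30000 * B) t' \<and> t' = with_score s (?x (ys @ [e])) b"
      using run_add_edge[OF e(1) f x_bits b(2)] unfolding t by auto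
  qed (simp add: score_def)
  moreover have "level f \<inter> set es = level f" using es(1) by (auto simp: superlevel_def)
  ultimately have 2: "run (with_score s 0 b) (seqs (map (add_edge f) es))
      (length es * (30000 * B) + 1) (with_score s (score P Q (level f) (sample j)) b)"
    by simp
  let ?t = "with_score s (score P Q (level f) (sample j)) b"
  have tb: "bits (?t a z) \<le> B" for a z
    using x_bits[of UNIV] b(2) s_bits by (intro with_score_bits) auto
  have a1: "atime (Sub (Cell 4 (Lit 0)) (Lit S)) ?t \<le> 4900 * B"
    using B by (intro atime_le tb) auto
  have a2: "run ?t (Store 2 (Lit 0) (Lit 1)) (1 + 2 * (4900 * B))
      (with_score s (score P Q (level f) (sample j)) 1)"
    using run_Store[of "Lit 0" ?t "4900 * B" "Lit 1" 2] B by (simp add: with_score_def fun_upd_twist)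
  have 3: "run ?t (Cond (Sub (Cell 4 (Lit 0)) (Lit S)) (Store 2 (Lit 0) (Lit 1)) Pass)
     (1 + 4900 * B + (1 + 2 * (4900 * B))) (with_score s (score P Q (level f) (sample j))
      (if S < score P Q (level f) (sample j) then 1 else b))"
    by (rule run_Cond[OF a1]) (use a2 run_Pass in \<open>auto simp: with_score_def\<close>)
  have "1 + 2 * (4900 * B) + ((length es * (30000 * B) + 1) + (1 + 4900 * B + (1 + 2 * (4900 * B))))
      \<le> 30000 * B * (length es + 2)"
    using B(1) by (simp add: algebra_simps)
  then show ?thesis
    unfolding scan_level_def by (rule run_mono[OF run_Seq[OF 1 run_Seq[OF 2 3]]])
qed

lemma run_scan_levels:
  "\<exists>x b. run s (seqs (map scan_level es)) (length es * (30000 * B * (length es + 2)) + 1)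
     (with_score s x b) \<and> bits x \<le> B \<and> bits b \<le> B \<and>
     (b \<noteq> 0 \<longleftrightarrow> s 2 0 \<noteq> 0 \<or> scan_accepts n P Q S (entry d A) (thin w (sample j)) (sample j))"
proof -
  let ?I = "\<lambda>ys t. \<exists>x b. t = with_score s x b \<and> bits x \<le> B \<and> bits b \<le> B \<and>
     (b \<noteq> 0 \<longleftrightarrow> s 2 0 \<noteq> 0 \<or> (\<exists>f\<in>set ys. S < score P Q (level f) (sample j)))"
  have "\<exists>t. run s (seqs (map scan_level es)) (length es * (30000 * B * (length es + 2)) + 1) t \<and> ?I es t"
  proof (rule run_seqs)
    fix ys f zs t
    assume eq: "es = ys @ f # zs" and "?I ys t"
    then obtain x b where t: "t = with_score s x b" "bits x \<le> B" "bits b \<le> B"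
      "b \<noteq> 0 \<longleftrightarrow> s 2 0 \<noteq> 0 \<or> (\<exists>f\<in>set ys. S < score P Q (level f) (sample j))" by blast
    have f: "f \<in> edges n" using es eq by auto
    let ?t' = "with_score s (score P Q (level f) (sample j))
      (if S < score P Q (level f) (sample j) then 1 else b)"
    have "bits (score P Q (level f) (sample j)) \<le> B"
      by (rule score_bits) (auto simp: superlevel_def)
    then have "?I (ys @ [f]) ?t'"
      using t bits_small
      by (intro exI[of _ "score P Q (level f) (sample j)"]
          exI[of _ "if S < score P Q (level f) (sample j) then 1 else b"]) auto
    then show "\<exists>t'. run t (scan_level f) (30000 * B * (length es + 2)) t' \<and> ?I (ys @ [f]) t'"
      using run_scan_level[OF f t(2,3)] unfolding t(1) by blast
  next
    show "?I [] s"
      using s_bits by (intro exI[of _ "s 4 0"] exI[of _ "s 2 0"]) (auto simp: with_score_def)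
  qed
  then show ?thesis using es(1) unfolding scan_accepts_def by fastforce
qed

end


context
  fixes X :: "(nat \<times> nat \<Rightarrow> bool) \<Rightarrow> (nat \<Rightarrow> bool) \<Rightarrow> nat \<Rightarrow> nat \<Rightarrow> real" and r T :: nat
  assumes \<omega>: "\<And>k. \<omega> k \<Longrightarrow> k < r * M"
    and T: "T \<le> B"
    and prog: "\<And>y \<omega>. (\<And>e. y e \<Longrightarrow> e \<in> edges n) \<Longrightarrow> (\<And>k. \<omega> k \<Longrightarrow> k < r) \<Longrightarrow>
      \<exists>k s. exec c (init_mem (edge_addr n) y \<omega>) k s \<and> k \<le> T \<and> out_matrix n s (X y \<omega>)"
begin

abbreviation "accepts j \<equiv> scan_accepts n P Q S
  (entry d (X (thin w (sample j)) (coin j))) (thin w (sample j)) (sample j)"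

text \<open>The condition on residues from j on keeps the memory of the pending samples blank, and
  the last clause makes the time estimates for one sample available again for the next.\<close>

definition inv :: "nat \<Rightarrow> memory \<Rightarrow> bool" where
  "inv j s \<longleftrightarrow> s 0 = init 0 \<and> s 3 0 = int j \<and>
     (\<forall>a z. int j \<le> z mod int M \<longrightarrow> s (slot a) z = init (slot a) z) \<and>
     (s 2 0 \<noteq> 0 \<longleftrightarrow> (\<exists>i<j. accepts i)) \<and> (\<forall>a z. bits (s a z) \<le> B)"

lemma inv_init: "inv 0 init"
proof -
  have "bits (init a z) \<le> B" for a z
    using init_mem_bits[of "hidden_edge_addr n" y \<omega> a z] B unfolding init_def by linarith
  then show ?thesis by (simp add: inv_def init_def init_mem_def)
qed

lemma sample_time:
  "(length es * (1 + 2 * (4900 * B)) + 1) + ((5 * bits (int M) + 5) * T +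
    ((length es * (30000 * B * (length es + 2)) + 1) + (1 + 2 * (4900 * B))))
    \<le> 200000 * (n\<^sup>2 + 1)\<^sup>2 * B\<^sup>2"
proof -
  let ?E = "n\<^sup>2" and ?N = "(n\<^sup>2 + 1)\<^sup>2 * B\<^sup>2"
  have "1 \<le> ?N" "B \<le> ?N" "B * B \<le> ?N" "?E * B \<le> ?N" "?E \<le> ?N" "?E * (B * ?E) \<le> ?N"
  proof -
    have B: "1 \<le> B\<^sup>2" "B \<le> B\<^sup>2" using B(1) by (auto simp: power2_eq_square)
    have E: "1 \<le> (?E + 1)\<^sup>2" "?E \<le> (?E + 1)\<^sup>2" "?E * ?E \<le> (?E + 1)\<^sup>2"
      by (auto simp: power2_eq_square)
    show "1 \<le> ?N" "B \<le> ?N" "B * B \<le> ?N" "?E * B \<le> ?N" "?E \<le> ?N"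
      using mult_le_mono[OF E(1) B(1)] mult_le_mono[OF E(1) B(2)] mult_le_mono[OF E(2) B(2)]
        mult_le_mono[OF E(2) B(1)] mult_le_mono[OF E(1) order_refl[of "B\<^sup>2"]]
      by (simp_all add: power2_eq_square)
    show "?E * (B * ?E) \<le> ?N"
      using mult_le_mono[OF E(3) B(2)] by (simp add: ac_simps)
  qed
  note bounds = this
  have "length es * (1 + 2 * (4900 * B)) \<le> ?E * (1 + 2 * (4900 * B))"
    using length_es by (rule mult_right_mono) simp
  moreover have "length es * (30000 * B * (length es + 2)) \<le> ?E * (30000 * B * (?E + 2))"
    using length_es by (intro mult_mono) auto
  moreover have "(5 * bits (int M) + 5) * T \<le> (5 * B + 5) * B"
    using B T by (intro mult_mono) auto
  ultimately have "(length es * (1 + 2 * (4900 * B)) + 1) + ((5 * bits (int M) + 5) * T +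
    ((length es * (30000 * B * (length es + 2)) + 1) + (1 + 2 * (4900 * B))))
    \<le> (?E * (1 + 2 * (4900 * B)) + 1) + ((5 * B + 5) * B +
    ((?E * (30000 * B * (?E + 2)) + 1) + (1 + 2 * (4900 * B))))"
    by linarith
  also have "\<dots> = ?E + 9800 * (?E * B) + 3 + 5 * (B * B) + 5 * B + 30000 * (?E * (B * ?E))
      + 60000 * (?E * B) + 9800 * B"
    by (simp add: algebra_simps)
  also have "\<dots> \<le> 200000 * ?N"
  proof -
    have "?E + 9800 * (?E * B) + 3 + 5 * (B * B) + 5 * B + 30000 * (?E * (B * ?E))
      + 60000 * (?E * B) + 9800 * B \<le> ?N + 9800 * ?N + 3 * ?N + 5 * ?N + 5 * ?N + 30000 * ?N
      + 60000 * ?N + 9800 * ?N"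
      using bounds by linarith
    then show ?thesis by linarith
  qed
  finally show ?thesis by (simp add: ac_simps)
qed

lemma run_sample:
  assumes j: "j < M" and inv: "inv j s"
  shows "\<exists>t. run s scan_sample (200000 * (n\<^sup>2 + 1)\<^sup>2 * B\<^sup>2) t \<and> inv (Suc j) t"
proof -
  have s: "s 0 = init 0" "s 3 0 = int j" "\<And>a z. bits (s a z) \<le> B"
    "\<And>a z. int j \<le> z mod int M \<Longrightarrow> s (slot a) z = init (slot a) z"
    "s 2 0 \<noteq> 0 \<longleftrightarrow> (\<exists>i<j. accepts i)"
    using inv by (auto simp: inv_def)
  let ?s1 = "copied j s es"
  have 1: "run s (seqs (map copy es)) (length es * (1 + 2 * (4900 * B)) + 1) ?s1"
    by (rule run_copy[OF s(1,2) j s(3)])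
  have s1: "?s1 0 = init 0" "?s1 3 0 = int j" "?s1 2 = s 2"
    using s(1,2) by (simp_all add: copied_def)
  have s1_bits: "bits (?s1 a z) \<le> B" for a z
    by (rule copied_bits[OF s(3)])
  have s1_other: "?s1 a z = s a z" if "z mod int M \<noteq> int j" for a z
    using that j by (auto simp: copied_def)
  have view1: "view (int M) (int j) ?s1 = init_mem (edge_addr n) (thin w (sample j)) (coin j)"
    by (rule view_copied[OF j s(4)])
  have "coin j k \<Longrightarrow> k < r" for k
  proof -
    assume "coin j k"
    then have "k * M + j < r * M" using \<omega> by (simp add: coin_def)
    then show "k < r" by (metis add_lessD1 mult_less_cancel2)
  qed
  then obtain k v where v: "exec c (view (int M) (int j) ?s1) k v" "k \<le> T"
    "out_matrix n v (X (thin w (sample j)) (coin j))"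
    using prog[of "thin w (sample j)" "coin j"] thin_edges unfolding view1 by blast
  have "bits (int j) \<le> bits (int M)" using j by (intro bits_mono) simp
  from exec_strided[OF v(1) refl s1(2) this] M_pos obtain k2 s2 where
    k2: "exec (strided_com (int M) c) ?s1 k2 s2" "v = view (int M) (int j) s2"
    "unaffected (int M) (int j) ?s1 s2" "k2 \<le> (5 * bits (int M) + 5) * k"
    by auto
  have "k2 \<le> (5 * bits (int M) + 5) * T" using k2(4) v(2) by (meson le_trans mult_le_mono2)
  then have 2: "run ?s1 (strided_com (int M) c) ((5 * bits (int M) + 5) * T) s2"
    using k2(1) by (auto simp: run_def)
  have s2: "s2 0 = init 0" "s2 3 0 = int j" "s2 2 = s 2"
    using k2(3) s1 by (auto simp: unaffected_def)
  have s2_other: "s2 a z = s a z" if "z mod int M \<noteq> int j" for a z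
    using that j k2(3) s1_other[OF that] by (auto simp: unaffected_def)
  \<comment> \<open>A cell in the residue class of j is bounded by its old length or by the time of
    the simulated run, and both are at most B. The bound therefore does not deteriorate from sample
    to sample.\<close>
  have s2_bits: "bits (s2 a z) \<le> B" for a z
  proof -
    consider "a \<in> {0, 2, 3, 4, 6}" | "z mod int M \<noteq> int j"
      | b where "a = slot b" "z mod int M = int j"
      using slot_cases by blast
    then show ?thesis
    proof cases
      case 1
      then show ?thesis using k2(3) s1_bits by (auto simp: unaffected_def)
    next
      case 2
      then show ?thesis using s2_other s(3) by simp
    next
      case 3
      have "s2 a z = v b (z div int M)"
        using 3 unfolding k2(2) view_def by (metis div_mult_mod_eq)
      moreover have "bits (v b (z div int M)) \<le> max (bits (view (int M) (int j) ?s1 b (z div int M))) k"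
        by (rule exec_bits[OF v(1)])
      moreover have "bits (view (int M) (int j) ?s1 b (z div int M)) \<le> B"
        unfolding view_def by (rule s1_bits)
      ultimately show ?thesis using v(2) T by auto
    qed
  qed
  from run_scan_levels[OF s2(1,2) j s2_bits v(3)[unfolded k2(2)]]
  obtain x b where 3: "run s2 (seqs (map scan_level es))
      (length es * (30000 * B * (length es + 2)) + 1) (with_score s2 x b)"
    "bits x \<le> B" "bits b \<le> B" "b \<noteq> 0 \<longleftrightarrow> s2 2 0 \<noteq> 0 \<or> accepts j"
    by blast
  let ?s3 = "with_score s2 x b"
  let ?t = "?s3(3 := (?s3 3)(0 := int (Suc j)))"
  have b3: "bits (?s3 a z) \<le> B" for a z by (rule with_score_bits[OF s2_bits 3(2,3)])
  have "?s3(3 := (?s3 3)(aval (Lit 0) ?s3 := aval (Add (Cell 3 (Lit 0)) (Lit 1)) ?s3)) = ?t"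
    using s2(2) by (simp add: with_score_def add.commute)
  moreover have "atime (Lit 0) ?s3 \<le> 4900 * B" using B by simp
  moreover have "atime (Add (Cell 3 (Lit 0)) (Lit 1)) ?s3 \<le> 4900 * B"
    using B by (intro atime_le b3) auto
  ultimately have 4: "run ?s3 (Store 3 (Lit 0) (Add (Cell 3 (Lit 0)) (Lit 1))) (1 + 2 * (4900 * B)) ?t"
    using run_Store by metis
  have "run s scan_sample (200000 * (n\<^sup>2 + 1)\<^sup>2 * B\<^sup>2) ?t"
    unfolding scan_sample_def
    by (rule run_mono[OF run_Seq[OF 1 run_Seq[OF 2 run_Seq[OF 3(1) 4]]]]) (use sample_time in linarith)
  moreover have "inv (Suc j) ?t"
  proof -
    have "bits (int (Suc j)) \<le> B"
      using j B(2) bits_mono[of "int (Suc j)" "int M"] by simp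
    then have "bits (?t a z) \<le> B" for a z using b3 by simp
    moreover have "?t (slot a) z = init (slot a) z" if "int (Suc j) \<le> z mod int M" for a z
      using that s2_other[of z "slot a"] s(4)[of z a] by (simp add: with_score_def)
    moreover have "?t 0 = init 0" "?t 3 0 = int (Suc j)" using s2 by (auto simp: with_score_def)
    moreover have "?t 2 0 \<noteq> 0 \<longleftrightarrow> (\<exists>i<Suc j. accepts i)"
      using 3(4) s2(3) s(5) by (auto simp: with_score_def less_Suc_eq)
    ultimately show ?thesis unfolding inv_def by blast
  qed
  ultimately show ?thesis by blast
qed

lemma run_scan_all:
  "\<exists>t. run init scan_all (1000000 * M * (n\<^sup>2 + 1)\<^sup>2 * B\<^sup>2) t \<and> out_bit t (\<exists>j<M. accepts j)"
proof -
  let ?K = "200000 * (n\<^sup>2 + 1)\<^sup>2 * B\<^sup>2"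
  have "\<exists>t. run init scan_all ((M - 0) * (1 + 4900 * B + ?K) + (1 + 4900 * B)) t \<and> inv M t"
    unfolding scan_all_def
  proof (rule run_Loop[where I = inv])
    fix j s
    assume "j < M" "inv j s"
    then show "0 < aval (Sub (Lit (int M)) (Cell 3 (Lit 0))) s \<and> (\<exists>t. run s scan_sample ?K t \<and> inv (Suc j) t)"
      using run_sample[of j s] by (simp add: inv_def)
  next
    fix s
    assume "inv M s"
    then show "aval (Sub (Lit (int M)) (Cell 3 (Lit 0))) s \<le> 0" by (simp add: inv_def)
  next
    fix j s
    assume "inv j s"
    then show "atime (Sub (Lit (int M)) (Cell 3 (Lit 0))) s \<le> 4900 * B"
      using B by (intro atime_le) (auto simp: inv_def)
  qed (use inv_init in auto)
  then obtain t where t: "run init scan_all (M * (1 + 4900 * B + ?K) + (1 + 4900 * B)) t" "inv M t"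
    by auto
  have "1 + 4900 * B \<le> ?K"
  proof -
    have "1 * B \<le> (n\<^sup>2 + 1)\<^sup>2 * B\<^sup>2"
      by (intro mult_mono) (auto simp: power2_eq_square)
    then have "200000 * B \<le> ?K" by simp
    then show ?thesis using B(1) by linarith
  qed
  then have "M * (1 + 4900 * B + ?K) + (1 + 4900 * B) \<le> M * (2 * ?K) + M * ?K"
    using M_pos by (intro add_mono mult_le_mono) (auto intro: order_trans[of _ ?K])
  also have "\<dots> \<le> 1000000 * M * (n\<^sup>2 + 1)\<^sup>2 * B\<^sup>2" by (simp add: ac_simps)
  finally show ?thesis using t run_mono unfolding inv_def out_bit_def by blast
qed

end

end



end

context scan_program
begin

text \<open>Program length counts as time. The unrolled code has a block for every pair of a
  threshold and an edge, hence a length of order n^4 B, which the time bound of the loop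
  absorbs.\<close>

lemma csize_scan_all:
  assumes "csize c \<le> B"
  shows "csize scan_all \<le> 1000000 * M * (n\<^sup>2 + 1)\<^sup>2 * B\<^sup>2"
proof -
  let ?E = "n\<^sup>2" and ?N = "(n\<^sup>2 + 1)\<^sup>2 * B\<^sup>2"
  have E: "1 \<le> (?E + 1)\<^sup>2" "?E \<le> (?E + 1)\<^sup>2" "?E * ?E \<le> (?E + 1)\<^sup>2"
    by (auto simp: power2_eq_square)
  have B2: "B \<le> B\<^sup>2" using B(1) by (auto simp: power2_eq_square)
  have N: "B \<le> ?N" "B * B \<le> ?N" "?E * B \<le> ?N" "?E * (?E * B) \<le> ?N"
    using mult_le_mono[OF E(1) B2] mult_le_mono[OF E(2) B2]
      mult_le_mono[OF E(3) B2] mult_le_mono[OF E(1) order_refl[of "B\<^sup>2"]]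
    by (simp_all add: power2_eq_square)
  have copy: "csize (copy e) \<le> 200 * B" if "e \<in> edges n" for e
  proof -
    show ?thesis
      using B(1) asize_le[OF exp_lits(6)[OF that] exp_nodes(5)]
        asize_le[OF exp_lits(2)[OF that] exp_nodes(2)]
      by (simp add: copy_def)
  qed
  have edge: "csize (add_edge f e) \<le> 400 * B" if "e \<in> edges n" "f \<in> edges n" for e f
  proof -
    have "lits_le B (Sub (Lit 1) (thinned e))"
      "lits_le B (Add (Cell 4 (Lit 0)) (Sub (Mul (Lit Q) (input e)) (Lit P)))"
      using exp_lits(1,2)[OF that(1)] bits_small(3,4) B(4,5) by simp_all
    note lits = this
    show ?thesis
      using B(1) asize_le[OF exp_lits(5)[OF that(1)] exp_nodes(3)]
        asize_le[OF above_entry_lits[OF that] exp_nodes(4)]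
        asize_le[OF lits(1) exp_nodes(6)] asize_le[OF lits(2) exp_nodes(7)]
      unfolding add_edge_def csize.simps by simp
  qed
  have "csize (scan_level f) \<le> 500 * B * (?E + 1)" if f: "f \<in> edges n" for f
  proof -
    have "csize (seqs (map (add_edge f) es)) \<le> length (map (add_edge f) es) * (400 * B + 1) + 1"
      by (rule csize_seqs) (use edge[OF _ f] es(1) in auto)
    also have "\<dots> \<le> ?E * (400 * B + 1) + 1"
      using length_es by (intro add_mono mult_right_mono) auto
    also have "\<dots> \<le> ?E * (500 * B) + 1" using B(1) by (intro add_mono mult_left_mono) auto
    finally show ?thesis using B(1,6) by (simp add: scan_level_def algebra_simps)
  qed
  then have "csize (seqs (map scan_level es)) \<le> length (map scan_level es) * (500 * B * (?E + 1) + 1) + 1"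
    by (intro csize_seqs) (use es(1) in auto)
  also have "\<dots> \<le> ?E * (500 * B * (?E + 1) + B) + 1"
    using length_es B(1) by (intro add_mono mult_mono) auto
  also have "\<dots> = 500 * (?E * (?E * B)) + 501 * (?E * B) + 1"
    by (simp add: algebra_simps)
  finally have 1: "csize (seqs (map scan_level es)) \<le> 1001 * ?N + 1" using N by linarith
  have "csize (seqs (map copy es)) \<le> length (map copy es) * (200 * B + 1) + 1"
    by (rule csize_seqs) (use copy es(1) in auto)
  also have "\<dots> \<le> ?E * (200 * B + B) + 1"
    using length_es B(1) by (intro add_mono mult_mono) auto
  also have "\<dots> \<le> 201 * ?N + 1" using N(3) by (simp add: algebra_simps)
  finally have 2: "csize (seqs (map copy es)) \<le> 201 * ?N + 1" .
  have "csize (strided_com (int M) c) \<le> (bits (int M) + 6) * csize c" by (rule csize_strided_com)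
  also have "\<dots> \<le> (B + 6) * B" using B(2) assms by (intro mult_mono) auto
  also have "\<dots> \<le> 7 * ?N" using N by (simp add: algebra_simps)
  finally have "csize scan_all \<le> 1210 * ?N + 30 + B"
    using 1 2 B(2) by (simp add: scan_all_def scan_sample_def)
  also have "\<dots> \<le> 2000 * ?N" using N(1) B(1) by linarith
  also have "\<dots> \<le> M * 1000000 * ?N" using M_pos by (intro mult_right_mono) auto
  finally show ?thesis by (simp add: ac_simps)
qed

end

text \<open>A single B bounds all bit lengths as well as the time of the estimator. The slowdown of
  the simulation then makes the total quadratic in B; the square only affects the constant in the
  exponent of the final bound.\<close>

lemma hidden_scan_computes_in_time:
  fixes M n r B :: nat and P Q S :: int
  assumes alg: "computes_in_time (edge_addr n) (edges n) r (out_matrix n) X \<tau>"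
    and "0 < M" "\<And>e. snd (w e) \<Longrightarrow> e \<in> edges n" "\<tau> \<le> B" "4 \<le> B"
    and "bits (int M) \<le> B" "bits (int (n\<^sup>2)) \<le> B" "bits P \<le> B" "bits Q \<le> B" "bits S \<le> B"
      "bits (int (n\<^sup>2) * (\<bar>P\<bar> + \<bar>Q\<bar>)) \<le> B"
  shows "computes_in_time (hidden_edge_addr n) ({..<M} \<times> edges n) (r * M) out_bit
    (\<lambda>y \<omega>. \<exists>j<M. scan_accepts n P Q S
       (entry d (X (thin w (\<lambda>e. y (j, e))) (\<lambda>z. \<omega> (z * M + j))))
       (thin w (\<lambda>e. y (j, e))) (\<lambda>e. y (j, e)))
    (real (1000000 * M * (n\<^sup>2 + 1)\<^sup>2 * B\<^sup>2))"
proof -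
  obtain c where c: "real (csize c) \<le> \<tau>"
    "\<forall>y \<omega>. (\<forall>e. y e \<longrightarrow> e \<in> edges n) \<longrightarrow> (\<forall>k. \<omega> k \<longrightarrow> k < r) \<longrightarrow>
      (\<exists>k s. exec c (init_mem (edge_addr n) y \<omega>) k s \<and> real k \<le> \<tau> \<and> out_matrix n s (X y \<omega>))"
    using alg unfolding computes_in_time_def by (elim exE conjE)
  obtain es where es: "set es = edges n" "distinct es"
    using finite_distinct_list[OF finite_edges] by blast
  interpret scan_program n M B w d P Q S c es
    by unfold_locales (fact assms es)+
  have c': "\<exists>k s. exec c (init_mem (edge_addr n) y \<omega>) k s \<and> k \<le> B \<and> out_matrix n s (X y \<omega>)"
    if "\<And>e. y e \<Longrightarrow> e \<in> edges n" "\<And>k. \<omega> k \<Longrightarrow> k < r" for y \<omega>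
  proof -
    from c(2)[rule_format, OF that] obtain k s where "exec c (init_mem (edge_addr n) y \<omega>) k s" "real k \<le> \<tau>"
      "out_matrix n s (X y \<omega>)" by blast
    then show ?thesis using assms(4) by (intro exI[of _ k] exI[of _ s]) simp
  qed
  have "csize c \<le> B" using c(1) assms(4) by linarith
  then have "real (csize scan_all) \<le> real (1000000 * M * (n\<^sup>2 + 1)\<^sup>2 * B\<^sup>2)"
    by (intro of_nat_mono csize_scan_all)
  moreover have "\<exists>k s. exec scan_all (init_mem (hidden_edge_addr n) y \<omega>) k s \<and>
      real k \<le> real (1000000 * M * (n\<^sup>2 + 1)\<^sup>2 * B\<^sup>2) \<and>
      out_bit s (\<exists>j<M. scan_accepts n P Q S
       (entry d (X (thin w (\<lambda>e. y (j, e))) (\<lambda>z. \<omega> (z * M + j))))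
       (thin w (\<lambda>e. y (j, e))) (\<lambda>e. y (j, e)))"
    if y: "\<And>i. y i \<Longrightarrow> i \<in> {..<M} \<times> edges n" and \<omega>: "\<And>k. \<omega> k \<Longrightarrow> k < r * M" for y \<omega>
  proof -
    have ex: "\<exists>t. run (init y \<omega>) scan_all (1000000 * M * (n\<^sup>2 + 1)\<^sup>2 * B\<^sup>2) t \<and>
      out_bit t (\<exists>j<M. scan_accepts n P Q S
       (entry d (X (thin w (\<lambda>e. y (j, e))) (coin \<omega> j)))
       (thin w (\<lambda>e. y (j, e))) (\<lambda>e. y (j, e)))"
      by (rule run_scan_all[where r = r and T = B]) (use y \<omega> c' in blast)+
    then obtain s where s: "run (init y \<omega>) scan_all (1000000 * M * (n\<^sup>2 + 1)\<^sup>2 * B\<^sup>2) s"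
      "out_bit s (\<exists>j<M. scan_accepts n P Q S
       (entry d (X (thin w (\<lambda>e. y (j, e))) (coin \<omega> j)))
       (thin w (\<lambda>e. y (j, e))) (\<lambda>e. y (j, e)))"
      by (elim exE conjE)
    from s(1) obtain k where k: "k \<le> 1000000 * M * (n\<^sup>2 + 1)\<^sup>2 * B\<^sup>2"
      "exec scan_all (init y \<omega>) k s"
      unfolding run_def by (elim exE conjE)
    show ?thesis
      by (rule exI[of _ k], rule exI[of _ s])
        (use k s(2) in \<open>simp only: init_def[OF y] coin_def[OF y] of_nat_le_iff simp_thms\<close>)
  qed
  ultimately show ?thesis
    unfolding computes_in_time_def
    by (intro exI[of _ scan_all]) blast
qed

section \<open>Thinning an edge and testing the held-out edges\<close>

lemma prob_bind_pmf:
  "measure_pmf.prob (bind_pmf p f) A = measure_pmf.expectation p (\<lambda>x. measure_pmf.prob (f x) A)"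
proof -
  have int: "integrable (measure_pmf p) (\<lambda>x. measure_pmf.prob (f x) A)"
    by (rule measure_pmf.integrable_const_bound[where B = 1]) auto
  have "ennreal (measure_pmf.prob (bind_pmf p f) A) = emeasure (bind_pmf p f) A"
    by (simp only: measure_pmf.emeasure_eq_measure)
  also have "\<dots> = (\<integral>\<^sup>+x. emeasure (f x) A \<partial>measure_pmf p)"
    by (rule emeasure_bind_pmf)
  also have "\<dots> = (\<integral>\<^sup>+x. ennreal (measure_pmf.prob (f x) A) \<partial>measure_pmf p)"
    by (simp add: measure_pmf.emeasure_eq_measure)
  also have "\<dots> = ennreal (measure_pmf.expectation p (\<lambda>x. measure_pmf.prob (f x) A))"
    by (rule nn_integral_eq_integral[OF int]) simp
  finally show ?thesis by (simp add: integral_nonneg_AE)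
qed

lemma prob_bind_le:
  assumes "\<And>x. x \<in> set_pmf p \<Longrightarrow> measure_pmf.prob (f x) A \<le> \<delta>"
  shows "measure_pmf.prob (bind_pmf p f) A \<le> \<delta>"
proof -
  have "measure_pmf.expectation p (\<lambda>x. measure_pmf.prob (f x) A) \<le> measure_pmf.expectation p (\<lambda>_. \<delta>)"
    by (rule integral_mono_AE)
      (auto intro!: measure_pmf.integrable_const_bound[where B = 1] AE_pmfI assms)
  then show ?thesis by (simp add: prob_bind_pmf)
qed

lemma prob_bind_ge:
  assumes "\<And>x. x \<in> set_pmf p \<Longrightarrow> x \<in> G \<Longrightarrow> c \<le> measure_pmf.prob (f x) A"
  shows "c * measure_pmf.prob p G \<le> measure_pmf.prob (bind_pmf p f) A"
proof -
  have "c * measure_pmf.prob p G = measure_pmf.expectation p (\<lambda>x. c * indicator G x)" by simp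
  also have "\<dots> \<le> measure_pmf.expectation p (\<lambda>x. measure_pmf.prob (f x) A)"
  proof (rule integral_mono_AE)
    show "integrable (measure_pmf p) (\<lambda>x. c * indicator G x)"
      by (rule measure_pmf.integrable_const_bound[where B = "\<bar>c\<bar>"]) (auto simp: indicator_def)
    show "AE x in measure_pmf p. c * indicator G x \<le> measure_pmf.prob (f x) A"
      using assms by (intro AE_pmfI) (auto simp: indicator_def)
  qed (auto intro!: measure_pmf.integrable_const_bound[where B = 1])
  finally show ?thesis by (simp add: prob_bind_pmf)
qed

lemma pair_pmf_bind: "pair_pmf p q = bind_pmf p (\<lambda>a. map_pmf (Pair a) q)"
  by (simp add: pair_pmf_def map_pmf_def)

lemma prob_pair_le:
  assumes "\<And>a. a \<in> set_pmf p \<Longrightarrow> measure_pmf.prob q {b. (a, b) \<in> S} \<le> \<delta>"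
  shows "measure_pmf.prob (pair_pmf p q) S \<le> \<delta>"
  unfolding pair_pmf_bind by (rule prob_bind_le) (use assms in \<open>simp add: vimage_def\<close>)

lemma prob_pair_ge:
  assumes "\<And>a. a \<in> set_pmf p \<Longrightarrow> a \<in> G \<Longrightarrow> c \<le> measure_pmf.prob q {b. (a, b) \<in> S}"
  shows "c * measure_pmf.prob p G \<le> measure_pmf.prob (pair_pmf p q) S"
  unfolding pair_pmf_bind by (rule prob_bind_ge) (use assms in \<open>simp add: vimage_def\<close>)

section \<open>Thinning channels on product measures\<close>

lemma pair_Pi_pmf:
  assumes A: "finite A"
  shows "pair_pmf (Pi_pmf A a f) (Pi_pmf A b g) =
    map_pmf (\<lambda>h. (fst \<circ> h, snd \<circ> h)) (Pi_pmf A (a, b) (\<lambda>x. pair_pmf (f x) (g x)))"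
proof (rule pmf_eqI)
  fix uv :: "('a \<Rightarrow> 'b) \<times> ('a \<Rightarrow> 'c)"
  obtain u v where uv: "uv = (u, v)" by (cases uv)
  let ?\<phi> = "\<lambda>h :: 'a \<Rightarrow> 'b \<times> 'c. (fst \<circ> h, snd \<circ> h)" and ?h = "\<lambda>x. (u x, v x)"
  have inj: "inj ?\<phi>" by (auto simp: inj_on_def fun_eq_iff prod_eq_iff)
  have *: "uv = ?\<phi> ?h" by (simp add: uv fun_eq_iff)
  have "pmf (map_pmf ?\<phi> (Pi_pmf A (a, b) (\<lambda>x. pair_pmf (f x) (g x)))) uv
      = pmf (Pi_pmf A (a, b) (\<lambda>x. pair_pmf (f x) (g x))) ?h"
    unfolding * by (rule pmf_map_inj'[OF inj])
  also have "\<dots> = pmf (Pi_pmf A a f) u * pmf (Pi_pmf A b g) v"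
    using A by (auto simp: pmf_Pi pmf_pair prod.distrib)
  finally show "pmf (pair_pmf (Pi_pmf A a f) (Pi_pmf A b g)) uv =
      pmf (map_pmf ?\<phi> (Pi_pmf A (a, b) (\<lambda>x. pair_pmf (f x) (g x)))) uv"
    by (simp add: uv pmf_pair)
qed

lemma finite_set_Pi_pmf:
  assumes "finite A" "\<And>x. x \<in> A \<Longrightarrow> finite (set_pmf (p x))"
  shows "finite (set_pmf (Pi_pmf A d p))"
  using assms by (auto simp: set_Pi_pmf)

lemma finite_set_Pi_bool [simp]: "finite A \<Longrightarrow> finite (set_pmf (Pi_pmf A d (p :: _ \<Rightarrow> bool pmf)))"
  by (rule finite_set_Pi_pmf) auto

text \<open>
  The channel flips a bit \<open>y\<close> to \<open>y'\<close>; where \<open>y'\<close> vanishes, \<open>y\<close> is distributed like a fresh bit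
  independent of \<open>y'\<close>.
\<close>

lemma bernoulli_channel:
  fixes a b p p' q :: real
  assumes "p \<in> {0..1}" "a \<in> {0..1}" "b \<in> {0..1}" "q \<in> {0..1}"
    and p': "p' = a * p + b * (1 - p)" and q: "q * (1 - p') = (1 - a) * p"
  shows "map_pmf (\<lambda>(y, u, v). (if y then u else v, y \<and> \<not> (if y then u else v)))
      (pair_pmf (bernoulli_pmf p) (pair_pmf (bernoulli_pmf a) (bernoulli_pmf b)))
    = map_pmf (\<lambda>(y', z). (y', z \<and> \<not> y')) (pair_pmf (bernoulli_pmf p') (bernoulli_pmf q))"
    (is "?L = ?R")
proof (rule pmf_eqI)
  fix x :: "bool \<times> bool"
  have p'01: "0 \<le> p'" "p' \<le> 1"
  proof -
    show "0 \<le> p'" using assms by simp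
    have "p' \<le> 1 * p + 1 * (1 - p)" unfolding p' using assms by (intro add_mono mult_right_mono) auto
    then show "p' \<le> 1" by simp
  qed
  have "p' * q = q - q * (1 - p')" by (simp add: algebra_simps)
  then have h1: "p' * q = q - (1 - a) * p" unfolding q .
  have h: "p' * q = q - p + a * p" unfolding h1 by (simp add: algebra_simps)
  have h2: "b * p = b + a * p - p'" unfolding p' by (simp add: algebra_simps)
  obtain s t where x: "x = (s, t)" by (cases x)
  show "pmf ?L x = pmf ?R x"
    using assms(1-4) p'01
    by (cases s; cases t)
      (simp_all add: x pair_pmf_def map_bind_pmf bind_return_pmf bind_assoc_pmf pmf_bind
        integral_bernoulli_pmf algebra_simps h h2)
qed

text \<open>Zipping the independent vectors makes every edge a separate experiment, to which the
  channel for one bit applies. Both sides forget the second graph where the first has an edge, since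
  independence holds only elsewhere.\<close>

lemma product_channel:
  fixes p p' q :: "'e \<Rightarrow> real"
  assumes E: "finite E" and ab: "a \<in> {0..1}" "b \<in> {0..1}"
    and p: "\<And>e. e \<in> E \<Longrightarrow> p e \<in> {0..1}" and q: "\<And>e. e \<in> E \<Longrightarrow> q e \<in> {0..1}"
    and p': "\<And>e. e \<in> E \<Longrightarrow> p' e = a * p e + b * (1 - p e)"
    and qp: "\<And>e. e \<in> E \<Longrightarrow> q e * (1 - p' e) = (1 - a) * p e"
  shows "map_pmf (\<lambda>(y, w). (thin w y, \<lambda>e. y e \<and> \<not> thin w y e))
      (pair_pmf (Pi_pmf E False (\<lambda>e. bernoulli_pmf (p e)))
        (Pi_pmf E (False, False) (\<lambda>_. pair_pmf (bernoulli_pmf a) (bernoulli_pmf b))))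
    = map_pmf (\<lambda>(y', z). (y', \<lambda>e. z e \<and> \<not> y' e))
      (pair_pmf (Pi_pmf E False (\<lambda>e. bernoulli_pmf (p' e))) (Pi_pmf E False (\<lambda>e. bernoulli_pmf (q e))))"
    (is "map_pmf ?f ?P = map_pmf ?g ?R")
proof -
  let ?cf = "\<lambda>(y, u, v). (if y then u else v, y \<and> \<not> (if y then u else v))"
  let ?cg = "\<lambda>(y', z). (y', z \<and> \<not> y')"
  let ?split = "\<lambda>h :: 'e \<Rightarrow> bool \<times> bool. (fst \<circ> h, snd \<circ> h)"
  let ?P1 = "\<lambda>e. pair_pmf (bernoulli_pmf (p e)) (pair_pmf (bernoulli_pmf a) (bernoulli_pmf b))"
  let ?R1 = "\<lambda>e. pair_pmf (bernoulli_pmf (p' e)) (bernoulli_pmf (q e))"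
  have "map_pmf ?f ?P = map_pmf ?split (map_pmf (\<lambda>h. ?cf \<circ> h) (Pi_pmf E (False, (False, False)) ?P1))"
    unfolding pair_Pi_pmf[OF E] map_pmf_comp
    by (intro map_pmf_cong refl) (auto simp: thin_def fun_eq_iff split: prod.splits)
  also have "map_pmf (\<lambda>h. ?cf \<circ> h) (Pi_pmf E (False, (False, False)) ?P1)
      = Pi_pmf E (False, False) (\<lambda>e. map_pmf ?cf (?P1 e))"
    by (rule Pi_pmf_map[symmetric, OF E]) simp
  also have "\<dots> = Pi_pmf E (False, False) (\<lambda>e. map_pmf ?cg (?R1 e))"
    by (intro Pi_pmf_cong refl bernoulli_channel) (use assms in auto)
  also have "\<dots> = map_pmf (\<lambda>h. ?cg \<circ> h) (Pi_pmf E (False, False) ?R1)"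
    by (rule Pi_pmf_map[OF E]) simp
  also have "map_pmf ?split \<dots> = map_pmf ?g ?R"
    unfolding pair_Pi_pmf[OF E] map_pmf_comp
    by (intro map_pmf_cong refl) (auto simp: fun_eq_iff split: prod.splits)
  finally show ?thesis .
qed

section \<open>Chernoff bounds\<close>

lemma expectation_exp_sum_bernoulli:
  fixes q :: "'e \<Rightarrow> real"
  assumes E: "finite E" and A: "A \<subseteq> E" and q: "\<And>e. e \<in> E \<Longrightarrow> q e \<in> {0..1}"
  shows "measure_pmf.expectation (Pi_pmf E False (\<lambda>e. bernoulli_pmf (q e)))
      (\<lambda>z. exp (t * (\<Sum>e\<in>A. of_bool (z e)))) = (\<Prod>e\<in>A. 1 + q e * (exp t - 1))"
proof -
  let ?f = "\<lambda>e b. if e \<in> A then exp (t * of_bool b) else 1 :: real"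
  have "exp (t * (\<Sum>e\<in>A. of_bool (z e))) = (\<Prod>e\<in>E. ?f e (z e))" for z :: "'e \<Rightarrow> bool"
  proof -
    have "exp (t * (\<Sum>e\<in>A. of_bool (z e))) = (\<Prod>e\<in>A. exp (t * of_bool (z e)))"
      by (simp only: sum_distrib_left exp_sum[OF finite_subset[OF A E]])
    also have "\<dots> = (\<Prod>e\<in>E. ?f e (z e))"
      using E A by (intro prod.mono_neutral_cong_left) auto
    finally show ?thesis .
  qed
  then have "measure_pmf.expectation (Pi_pmf E False (\<lambda>e. bernoulli_pmf (q e)))
      (\<lambda>z. exp (t * (\<Sum>e\<in>A. of_bool (z e)))) =
    measure_pmf.expectation (Pi_pmf E False (\<lambda>e. bernoulli_pmf (q e))) (\<lambda>z. \<Prod>e\<in>E. ?f e (z e))"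
    by presburger
  also have "\<dots> = (\<Prod>e\<in>E. measure_pmf.expectation (bernoulli_pmf (q e)) (?f e))"
    by (rule expectation_prod_Pi_pmf[OF E]) (auto intro: integrable_measure_pmf_finite)
  also have "\<dots> = (\<Prod>e\<in>E. if e \<in> A then 1 + q e * (exp t - 1) else 1)"
    using q by (intro prod.cong refl) (auto simp: algebra_simps)
  also have "\<dots> = (\<Prod>e\<in>A. 1 + q e * (exp t - 1))"
    using E A by (intro prod.mono_neutral_cong_right) auto
  finally show ?thesis .
qed

lemma expectation_exp_sum_bernoulli_le:
  fixes q :: "'e \<Rightarrow> real"
  assumes E: "finite E" and A: "A \<subseteq> E" and q: "\<And>e. e \<in> E \<Longrightarrow> q e \<in> {0..1}"
  shows "measure_pmf.expectation (Pi_pmf E False (\<lambda>e. bernoulli_pmf (q e)))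
      (\<lambda>z. exp (t * (\<Sum>e\<in>A. of_bool (z e)))) \<le> exp ((exp t - 1) * (\<Sum>e\<in>A. q e))"
proof -
  have "(\<Prod>e\<in>A. 1 + q e * (exp t - 1)) \<le> (\<Prod>e\<in>A. exp (q e * (exp t - 1)))"
  proof (rule prod_mono)
    fix e assume "e \<in> A"
    then have q': "q e \<in> {0..1}" using A q by auto
    have "1 + q e * (exp t - 1) = (1 - q e) + q e * exp t" by (simp add: algebra_simps)
    also have "\<dots> \<ge> 0" using q' by (intro add_nonneg_nonneg mult_nonneg_nonneg) auto
    finally show "0 \<le> 1 + q e * (exp t - 1) \<and> 1 + q e * (exp t - 1) \<le> exp (q e * (exp t - 1))"
      by (simp add: exp_ge_add_one_self)
  qed
  also have "\<dots> = exp (\<Sum>e\<in>A. q e * (exp t - 1))"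
    by (rule exp_sum[symmetric, OF finite_subset[OF A E]])
  also have "(\<Sum>e\<in>A. q e * (exp t - 1)) = (exp t - 1) * (\<Sum>e\<in>A. q e)"
    by (simp add: sum_distrib_right[symmetric] mult.commute)
  finally show ?thesis using expectation_exp_sum_bernoulli[OF assms] by simp
qed

lemma prob_le_expectation:
  fixes p :: "'a pmf"
  assumes "finite (set_pmf p)" "\<And>x. 0 \<le> f x" "\<And>x. x \<in> A \<Longrightarrow> 1 \<le> f x"
  shows "measure_pmf.prob p A \<le> measure_pmf.expectation p f"
proof -
  have "measure_pmf.prob p A = measure_pmf.expectation p (indicator A)" by simp
  also have "\<dots> \<le> measure_pmf.expectation p f"
    using assms by (intro integral_mono integrable_measure_pmf_finite) (auto simp: indicator_def)
  finally show ?thesis .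
qed

lemma score_eq: "finite A \<Longrightarrow> real_of_int (score P Q A z) =
    real_of_int Q * (\<Sum>e\<in>A. of_bool (z e)) - real_of_int P * real (card A)"
  by (simp add: score_def sum_subtractf sum_distrib_left)

text \<open>The slope q (1 + t) matches the bound exp t - 1 <= t + t^2: the terms proportional to
  the size of A cancel and only -t s remains. One threshold therefore serves candidate sets of every
  size.\<close>

lemma score_upper_tail:
  fixes q t s :: real
  assumes E: "finite E" and A: "A \<subseteq> E" and q: "q \<in> {0..1}" and t: "0 \<le> t" "t \<le> 1" and Q: "0 < Q"
    and P: "q * (1 + t) * of_int Q \<le> of_int P" and S: "s * of_int Q \<le> of_int S"
  shows "measure_pmf.prob (Pi_pmf E False (\<lambda>_. bernoulli_pmf q)) {z. S < score P Q A z} \<le> exp (- t * s)"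
proof -
  let ?p = "Pi_pmf E False (\<lambda>_. bernoulli_pmf q)"
  let ?N = "\<lambda>z. \<Sum>e\<in>A. of_bool (z e) :: real"
  let ?c = "q * (1 + t) * card A + s"
  have fin: "finite A" using finite_subset[OF A E] .
  have big: "?c \<le> ?N z" if "S < score P Q A z" for z
  proof -
    have "s * of_int Q \<le> real_of_int Q * ?N z - real_of_int P * real (card A)"
      using that S score_eq[OF fin, of P Q z] by linarith
    moreover have "(q * (1 + t) * of_int Q) * card A \<le> real_of_int P * real (card A)"
      using P by (rule mult_right_mono) simp
    ultimately have "of_int Q * ?c \<le> of_int Q * ?N z" by (simp add: algebra_simps)
    then show ?thesis using Q by (simp add: mult_le_cancel_left)
  qed
  have "measure_pmf.prob ?p {z. S < score P Q A z} \<le>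
      measure_pmf.expectation ?p (\<lambda>z. exp (- t * ?c) * exp (t * ?N z))"
  proof (rule prob_le_expectation)
    fix z assume "z \<in> {z. S < score P Q A z}"
    then have "t * ?c \<le> t * ?N z" using big t by (intro mult_left_mono) auto
    then show "1 \<le> exp (- t * ?c) * exp (t * ?N z)" by (simp flip: exp_add)
  qed (use E in auto)
  also have "\<dots> = exp (- t * ?c) * measure_pmf.expectation ?p (\<lambda>z. exp (t * ?N z))" by simp
  also have "\<dots> \<le> exp (- t * ?c) * exp ((exp t - 1) * (\<Sum>e\<in>A. q))"
    using expectation_exp_sum_bernoulli_le[OF E A, of "\<lambda>_. q" t] q by (intro mult_left_mono) auto
  also have "\<dots> \<le> exp (- t * ?c) * exp ((t + t\<^sup>2) * (\<Sum>e\<in>A. q))"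
    using exp_bound[OF t] q by (intro mult_left_mono) (auto intro!: mult_right_mono)
  also have "\<dots> = exp (- t * s)"
    by (simp add: power2_eq_square algebra_simps flip: exp_add)
  finally show ?thesis .
qed

lemma exp_minus_le: "0 \<le> u \<Longrightarrow> exp (- u) \<le> 1 - u + u\<^sup>2" for u :: real
proof -
  assume u: "0 \<le> u"
  have "exp (- u) = 1 / exp u" by (simp add: exp_minus inverse_eq_divide)
  also have "\<dots> \<le> 1 / (1 + u)"
    using u exp_ge_add_one_self[of u] by (intro divide_left_mono) auto
  also have "\<dots> \<le> 1 - u + u\<^sup>2"
  proof -
    have "(1 - u + u\<^sup>2) * (1 + u) = 1 + u ^ 3"
      by (simp add: algebra_simps power2_eq_square power3_eq_cube)
    then show ?thesis using u by (subst pos_divide_le_eq) auto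
  qed
  finally show ?thesis .
qed

lemma bernoulli_sum_lower_tail:
  fixes q :: "'e \<Rightarrow> real"
  assumes E: "finite E" and A: "A \<subseteq> E" and q: "\<And>e. e \<in> E \<Longrightarrow> q e \<in> {0..1}"
    and \<mu>: "\<mu> = (\<Sum>e\<in>A. q e)" "0 < \<mu>" and c: "c \<le> \<mu>"
  shows "measure_pmf.prob (Pi_pmf E False (\<lambda>e. bernoulli_pmf (q e))) {z. (\<Sum>e\<in>A. of_bool (z e)) \<le> c}
    \<le> exp (- (\<mu> - c)\<^sup>2 / (4 * \<mu>))"
proof -
  let ?p = "Pi_pmf E False (\<lambda>e. bernoulli_pmf (q e))"
  let ?N = "\<lambda>z. \<Sum>e\<in>A. of_bool (z e) :: real"
  \<comment> \<open>The minimiser of the exponent u c + (u^2 - u) \<mu>.\<close>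
  define u where "u = (\<mu> - c) / (2 * \<mu>)"
  have u: "0 \<le> u" using \<mu> c by (simp add: u_def)
  have "measure_pmf.prob ?p {z. ?N z \<le> c} \<le>
      measure_pmf.expectation ?p (\<lambda>z. exp (u * c) * exp (- u * ?N z))"
  proof (rule prob_le_expectation)
    fix z assume "z \<in> {z. ?N z \<le> c}"
    then have "u * ?N z \<le> u * c" using u by (intro mult_left_mono) auto
    then show "1 \<le> exp (u * c) * exp (- u * ?N z)" by (simp flip: exp_add)
  qed (use E in auto)
  also have "\<dots> = exp (u * c) * measure_pmf.expectation ?p (\<lambda>z. exp (- u * ?N z))" by simp
  also have "\<dots> \<le> exp (u * c) * exp ((exp (- u) - 1) * \<mu>)"
    using expectation_exp_sum_bernoulli_le[where t = "- u", OF E A q] \<mu>(1) by (intro mult_left_mono) auto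
  also have "\<dots> \<le> exp (u * c) * exp ((u\<^sup>2 - u) * \<mu>)"
    using exp_minus_le[OF u] \<mu>(2) by (intro mult_left_mono) (auto intro!: mult_right_mono)
  also have "\<dots> = exp (- (\<mu> - c)\<^sup>2 / (4 * \<mu>))"
  proof -
    have "u * c + (u\<^sup>2 - u) * \<mu> = - u * (\<mu> - c) + u\<^sup>2 * \<mu>" by (simp add: algebra_simps)
    also have "\<dots> = - (\<mu> - c)\<^sup>2 / (4 * \<mu>)"
      using \<mu>(2) unfolding u_def by (simp add: field_simps power2_eq_square)
    finally show ?thesis by (simp flip: exp_add)
  qed
  finally show ?thesis .
qed

section \<open>Masked graphs and false alarms\<close>

text \<open>Candidate sets avoid y', so the score never reads y there. Hence the full graph may be
  replaced by its held-out part, which is all that the channel describes.\<close>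

lemma scan_accepts_masked:
  "scan_accepts n P Q S Z y' (\<lambda>e. y e \<and> \<not> y' e) \<longleftrightarrow> scan_accepts n P Q S Z y' y"
proof -
  have "score P Q (superlevel n Z f - {e. y' e}) (\<lambda>e. y e \<and> \<not> y' e) =
      score P Q (superlevel n Z f - {e. y' e}) y" for f
    unfolding score_def by (rule sum.cong) auto
  then show ?thesis by (simp add: scan_accepts_def)
qed

definition mask_pmf :: "nat \<Rightarrow> real \<Rightarrow> real \<Rightarrow> (nat \<times> nat \<Rightarrow> bool \<times> bool) pmf" where
  "mask_pmf n a b =
     Pi_pmf (edges n) (False, False) (\<lambda>_. pair_pmf (bernoulli_pmf a) (bernoulli_pmf b))"

lemma finite_mask_pmf [simp]: "finite (set_pmf (mask_pmf n a b))"
  unfolding mask_pmf_def by (rule finite_set_Pi_pmf) auto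

lemma mask_pmf_support: "w \<in> set_pmf (mask_pmf n a b) \<Longrightarrow> snd (w e) \<Longrightarrow> e \<in> edges n"
  unfolding mask_pmf_def using set_Pi_pmf_subset[OF finite_edges[of n]] by fastforce

lemma pair_pmf_rotate:
  "pair_pmf (pair_pmf A B) C = map_pmf (\<lambda>((a, c), b). ((a, b), c)) (pair_pmf (pair_pmf A C) B)"
  by (simp add: pair_pmf_def map_bind_pmf bind_assoc_pmf bind_return_pmf)
    (subst bind_commute_pmf, rule refl)

text \<open>Observing a graph together with its thinning amounts to observing the thinned graph and
  a fresh graph on the remaining edges. The estimate depends on the former alone, so the candidate
  sets are fixed while the latter is tested.\<close>

lemma prob_channel:
  fixes p p' q :: "nat \<times> nat \<Rightarrow> real"
  assumes "a \<in> {0..1}" "b \<in> {0..1}"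
    "\<And>e. e \<in> edges n \<Longrightarrow> p e \<in> {0..1}" "\<And>e. e \<in> edges n \<Longrightarrow> q e \<in> {0..1}"
    "\<And>e. e \<in> edges n \<Longrightarrow> p' e = a * p e + b * (1 - p e)"
    "\<And>e. e \<in> edges n \<Longrightarrow> q e * (1 - p' e) = (1 - a) * p e"
  shows "measure_pmf.prob
      (pair_pmf (pair_pmf (Pi_pmf (edges n) False (\<lambda>e. bernoulli_pmf (p e))) (mask_pmf n a b)) C)
      {((y, w), \<omega>). scan_accepts n P Q S (Z (thin w y) \<omega>) (thin w y) y}
    = measure_pmf.prob
      (pair_pmf (pair_pmf (Pi_pmf (edges n) False (\<lambda>e. bernoulli_pmf (p' e))) C)
        (Pi_pmf (edges n) False (\<lambda>e. bernoulli_pmf (q e))))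
      {((y', \<omega>), z). scan_accepts n P Q S (Z y' \<omega>) y' z}"
    (is "measure_pmf.prob (pair_pmf (pair_pmf ?A ?W) C) _ = measure_pmf.prob (pair_pmf (pair_pmf ?B C) ?R) _")
proof -
  let ?S = "{((y', z), \<omega>). scan_accepts n P Q S (Z y' \<omega>) y' z}"
  let ?f = "\<lambda>(y, w). (thin w y, \<lambda>e. y e \<and> \<not> thin w y e)"
  let ?g = "\<lambda>(y', z). (y', \<lambda>e. z e \<and> \<not> y' e)"
  have "measure_pmf.prob (pair_pmf (pair_pmf ?A ?W) C)
      {((y, w), \<omega>). scan_accepts n P Q S (Z (thin w y) \<omega>) (thin w y) y}
    = measure_pmf.prob (pair_pmf (map_pmf ?f (pair_pmf ?A ?W)) C) ?S"
    unfolding pair_map_pmf1 measure_map_pmf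
    by (rule arg_cong[where f = "measure_pmf.prob _"]) (auto simp: scan_accepts_masked)
  also have "map_pmf ?f (pair_pmf ?A ?W) = map_pmf ?g (pair_pmf ?B ?R)"
    unfolding mask_pmf_def by (rule product_channel) (use assms in auto)
  also have "measure_pmf.prob (pair_pmf (map_pmf ?g (pair_pmf ?B ?R)) C) ?S
    = measure_pmf.prob (pair_pmf (pair_pmf ?B ?R) C) ?S"
    unfolding pair_map_pmf1 measure_map_pmf
    by (rule arg_cong[where f = "measure_pmf.prob _"]) (auto simp: scan_accepts_masked)
  also have "\<dots> = measure_pmf.prob (pair_pmf (pair_pmf ?B C) ?R)
      {((y', \<omega>), z). scan_accepts n P Q S (Z y' \<omega>) y' z}"
    by (subst pair_pmf_rotate, unfold measure_map_pmf)
      (rule arg_cong[where f = "measure_pmf.prob _"], auto)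
  finally show ?thesis .
qed

text \<open>With y' and Z fixed the candidate sets are deterministic, and a union bound over the
  thresholds costs the factor n^2.\<close>

lemma scan_accepts_null_le:
  fixes q t s :: real
  assumes q: "q \<in> {0..1}" and t: "0 \<le> t" "t \<le> 1" and Q: "0 < Q"
    and P: "q * (1 + t) * of_int Q \<le> of_int P" and S: "s * of_int Q \<le> of_int S"
  shows "measure_pmf.prob (Pi_pmf (edges n) False (\<lambda>_. bernoulli_pmf q)) {z. scan_accepts n P Q S Z y' z}
    \<le> (real n)\<^sup>2 * exp (- t * s)"
proof -
  let ?p = "Pi_pmf (edges n) False (\<lambda>_. bernoulli_pmf q)"
  let ?L = "\<lambda>f. superlevel n Z f - {e. y' e}"
  have "{z. scan_accepts n P Q S Z y' z} = (\<Union>f\<in>edges n. {z. S < score P Q (?L f) z})"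
    by (auto simp: scan_accepts_def)
  then have "measure_pmf.prob ?p {z. scan_accepts n P Q S Z y' z}
      \<le> (\<Sum>f\<in>edges n. measure_pmf.prob ?p {z. S < score P Q (?L f) z})"
    by (simp add: measure_UNION_le)
  also have "\<dots> \<le> (\<Sum>f\<in>edges n. exp (- t * s))"
    by (intro sum_mono score_upper_tail[OF finite_edges _ q t Q P S]) (auto simp: superlevel_def)
  also have "\<dots> = real (card (edges n)) * exp (- t * s)" by simp
  also have "\<dots> \<le> (real n)\<^sup>2 * exp (- t * s)"
    using card_edges_le[of n] by (intro mult_right_mono) (auto simp flip: of_nat_power)
  finally show ?thesis .
qed

section \<open>Averaging over masks and scanning the samples\<close>

lemma exists_le_expectation:
  fixes \<phi> :: "'a \<Rightarrow> real"
  assumes fin: "finite (set_pmf W)"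
  shows "\<exists>w\<in>set_pmf W. \<phi> w \<le> measure_pmf.expectation W \<phi>"
proof (rule ccontr)
  assume "\<not> ?thesis"
  then have gt: "measure_pmf.expectation W \<phi> < \<phi> w" if "w \<in> set_pmf W" for w using that by force
  have "measure_pmf.expectation W \<phi> = (\<Sum>w\<in>set_pmf W. \<phi> w * pmf W w)"
    using fin by (intro integral_measure_pmf_real) auto
  also have "\<dots> > (\<Sum>w\<in>set_pmf W. measure_pmf.expectation W \<phi> * pmf W w)"
    using fin gt by (intro sum_strict_mono mult_strict_right_mono) (auto simp: set_pmf_not_empty pmf_positive)
  also have "(\<Sum>w\<in>set_pmf W. measure_pmf.expectation W \<phi> * pmf W w) = measure_pmf.expectation W \<phi>"
    using fin by (simp add: sum_distrib_left[symmetric] sum_pmf_eq_1)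
  finally show False by simp
qed

text \<open>Since j < M, the position z M + j lies below r M exactly if z < r, so the residue class
  of j contains exactly r fair coins, as many as one run of the estimator expects.\<close>

lemma coins_stride:
  assumes "j < M"
  shows "map_pmf (\<lambda>\<omega> z. \<omega> (z * M + j)) (coins (r * M)) = coins r"
proof -
  let ?h = "\<lambda>z. z * M + j" and ?b = "bernoulli_pmf (1 / 2)"
  have M: "0 < M" using assms by simp
  let ?B = "?h ` {..<r}"
  have sub: "?B \<subseteq> {..<r * M}"
  proof safe
    fix z assume "z < r"
    then have "Suc z * M \<le> r * M" by (intro mult_right_mono) auto
    then show "z * M + j < r * M" using assms by simp
  qed
  have inj: "inj ?h" using M by (auto simp: inj_on_def)
  have "coins r = map_pmf (\<lambda>g. g \<circ> ?h) (Pi_pmf ?B False (\<lambda>_. ?b))"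
    unfolding coins_def using inj
    by (intro Pi_pmf_bij_betw) (auto simp: bij_betw_def inj_on_def)
  also have "Pi_pmf ?B False (\<lambda>_. ?b)
      = map_pmf (\<lambda>f x. if x \<in> ?B then f x else False) (coins (r * M))"
    unfolding coins_def by (rule Pi_pmf_subset[OF finite_lessThan sub])
  also have "map_pmf (\<lambda>g. g \<circ> ?h) \<dots> = map_pmf (\<lambda>\<omega> z. \<omega> (z * M + j)) (coins (r * M))"
    unfolding map_pmf_comp
  proof (rule map_pmf_cong[OF refl])
    fix \<omega> assume \<omega>: "\<omega> \<in> set_pmf (coins (r * M))"
    have supp: "\<omega> k \<Longrightarrow> k < r * M" for k
    proof -
      have "\<omega> \<in> {f. \<forall>x. x \<notin> {..<r * M} \<longrightarrow> f x = False}"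
        using set_Pi_pmf_subset[of "{..<r * M}" False "\<lambda>_. ?b"] \<omega> unfolding coins_def by blast
      then show "\<omega> k \<Longrightarrow> k < r * M" by auto
    qed
    have "\<not> \<omega> (z * M + j)" if "\<not> z < r" for z
    proof
      assume "\<omega> (z * M + j)"
      then have "z * M + j < r * M" by (rule supp)
      moreover have "r * M \<le> z * M" using that by simp
      ultimately show False by simp
    qed
    moreover have "?h z \<in> ?B \<longleftrightarrow> z < r" for z
      using inj_image_mem_iff[OF inj, of z "{..<r}"] by simp
    ultimately show "(\<lambda>x. if x \<in> ?B then \<omega> x else False) \<circ> ?h = (\<lambda>z. \<omega> (z * M + j))"
      by (auto simp only: fun_eq_iff o_apply if_False split: if_splits)
  qed
  finally show ?thesis ..
qed

lemma map_sample_Pi: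
  fixes j M :: nat
  assumes "j < M"
  shows "map_pmf (\<lambda>y e. y (j, e)) (map_pmf case_prod (Pi_pmf {..<M} (\<lambda>_. False) f)) = f j"
proof -
  have "map_pmf (\<lambda>y e. y (j, e)) (map_pmf case_prod (Pi_pmf {..<M} (\<lambda>_. False) f))
      = map_pmf (\<lambda>h. h j) (Pi_pmf {..<M} (\<lambda>_. False) f)"
    unfolding map_pmf_comp by simp
  also have "\<dots> = f j"
    using Pi_pmf_component[OF finite_lessThan, of j M "\<lambda>_. False" f] assms by simp
  finally show ?thesis .
qed

text \<open>Only laws of single samples enter. Under the null law the alarms are added up over the
  samples; under the planted law the informative sample alone must raise an alarm, and alarms on the
  others can only help.\<close>

lemma hidden_error_le:
  fixes M :: nat and base :: "('i \<Rightarrow> bool) \<Rightarrow> (nat \<Rightarrow> bool) \<Rightarrow> bool"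
  assumes M: "0 < M"
  shows "error_sum (hidden_planted M P Q) (hidden_null M Q) (r * M)
      (\<lambda>y \<omega>. \<exists>j<M. base (\<lambda>e. y (j, e)) (\<lambda>z. \<omega> (z * M + j)))
    \<le> M * measure_pmf.prob (pair_pmf Q (coins r)) {(y, \<omega>). base y \<omega>}
      + (1 - measure_pmf.prob (pair_pmf P (coins r)) {(y, \<omega>). base y \<omega>})"
proof -
  let ?sample = "\<lambda>j (y, \<omega>). (\<lambda>e. y (j, e), \<lambda>z. \<omega> (z * M + j))"
  let ?B = "{(y, \<omega>). base y \<omega>}"
  let ?acc = "\<lambda>y \<omega>. \<exists>j<M. base (\<lambda>e. y (j, e)) (\<lambda>z. \<omega> (z * M + j))"
  have marginal: "map_pmf (?sample j) (pair_pmf (map_pmf case_prod (Pi_pmf {..<M} (\<lambda>_. False) f)) (coins (r * M)))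
      = pair_pmf (f j) (coins r)" if "j < M" for j f
    unfolding map_pair map_sample_Pi[OF that] coins_stride[OF that] ..
  have marg_prob: "measure_pmf.prob (pair_pmf (map_pmf case_prod (Pi_pmf {..<M} (\<lambda>_. False) f)) (coins (r * M)))
      {(y, \<omega>). base (\<lambda>e. y (j, e)) (\<lambda>z. \<omega> (z * M + j))}
      = measure_pmf.prob (pair_pmf (f j) (coins r)) ?B" if "j < M" for j f
    unfolding marginal[OF that, symmetric] measure_map_pmf
    by (rule arg_cong[where f = "measure_pmf.prob _"]) auto
  have "measure_pmf.prob (pair_pmf (hidden_null M Q) (coins (r * M))) {(y, \<omega>). ?acc y \<omega>}
      \<le> (\<Sum>j<M. measure_pmf.prob (pair_pmf (hidden_null M Q) (coins (r * M)))
          {(y, \<omega>). base (\<lambda>e. y (j, e)) (\<lambda>z. \<omega> (z * M + j))})"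
  proof -
    have "{(y, \<omega>). ?acc y \<omega>} = (\<Union>j<M. {(y, \<omega>). base (\<lambda>e. y (j, e)) (\<lambda>z. \<omega> (z * M + j))})" by auto
    then show ?thesis by (simp add: measure_UNION_le)
  qed
  also have "\<dots> = M * measure_pmf.prob (pair_pmf Q (coins r)) ?B"
    unfolding hidden_null_def by (simp add: marg_prob)
  finally have null: "measure_pmf.prob (pair_pmf (hidden_null M Q) (coins (r * M))) {(y, \<omega>). ?acc y \<omega>}
      \<le> M * measure_pmf.prob (pair_pmf Q (coins r)) ?B" .
  have "pair_pmf (hidden_planted M P Q) (coins (r * M)) = bind_pmf (pmf_of_set {..<M})
     (\<lambda>\<kappa>. pair_pmf (map_pmf case_prod (Pi_pmf {..<M} (\<lambda>_. False) (\<lambda>j. if j = \<kappa> then P else Q))) (coins (r * M)))"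
    by (simp add: hidden_planted_def pair_pmf_def bind_assoc_pmf)
  moreover have "measure_pmf.prob (bind_pmf (pmf_of_set {..<M})
     (\<lambda>\<kappa>. pair_pmf (map_pmf case_prod (Pi_pmf {..<M} (\<lambda>_. False) (\<lambda>j. if j = \<kappa> then P else Q))) (coins (r * M))))
     {(y, \<omega>). \<not> ?acc y \<omega>} \<le> 1 - measure_pmf.prob (pair_pmf P (coins r)) ?B"
  proof (rule prob_bind_le)
    fix \<kappa> assume "\<kappa> \<in> set_pmf (pmf_of_set {..<M})"
    moreover have "{..<M} \<noteq> {}" using M by auto
    ultimately have \<kappa>: "\<kappa> < M" by simp
    let ?p = "pair_pmf (map_pmf case_prod (Pi_pmf {..<M} (\<lambda>_. False) (\<lambda>j. if j = \<kappa> then P else Q))) (coins (r * M))"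
    let ?G = "{(y, \<omega>). base (\<lambda>e. y (\<kappa>, e)) (\<lambda>z. \<omega> (z * M + \<kappa>))}"
    have "measure_pmf.prob ?p {(y, \<omega>). \<not> ?acc y \<omega>} \<le> measure_pmf.prob ?p (- ?G)"
      using \<kappa> by (intro measure_pmf.finite_measure_mono) auto
    also have "\<dots> = 1 - measure_pmf.prob ?p ?G"
      using measure_pmf.prob_compl[of ?G ?p] by (simp add: Compl_eq_Diff_UNIV)
    also have "measure_pmf.prob ?p ?G = measure_pmf.prob (pair_pmf P (coins r)) ?B"
      using marg_prob[OF \<kappa>, of "\<lambda>j. if j = \<kappa> then P else Q"] by simp
    finally show "measure_pmf.prob ?p {(y, \<omega>). \<not> ?acc y \<omega>} \<le> 1 - measure_pmf.prob (pair_pmf P (coins r)) ?B" .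
  qed
  ultimately have "measure_pmf.prob (pair_pmf (hidden_planted M P Q) (coins (r * M))) {(y, \<omega>). \<not> ?acc y \<omega>}
     \<le> 1 - measure_pmf.prob (pair_pmf P (coins r)) ?B" by simp
  with null show ?thesis unfolding error_sum_def by linarith
qed

lemma pair_pmf_mask_average:
  "measure_pmf.prob (pair_pmf (pair_pmf A W) C) {((y, w), \<omega>). R y w \<omega>}
   = measure_pmf.expectation W (\<lambda>w. measure_pmf.prob (pair_pmf A C) {(y, \<omega>). R y w \<omega>})"
proof -
  have "pair_pmf (pair_pmf A W) C = map_pmf (\<lambda>(w, (y, \<omega>)). ((y, w), \<omega>)) (pair_pmf W (pair_pmf A C))"
    by (simp add: pair_pmf_def map_bind_pmf bind_assoc_pmf bind_return_pmf)
      (subst bind_commute_pmf, rule refl)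
  then have "measure_pmf.prob (pair_pmf (pair_pmf A W) C) {((y, w), \<omega>). R y w \<omega>}
      = measure_pmf.prob (pair_pmf W (pair_pmf A C)) {(w, (y, \<omega>)). R y w \<omega>}"
    by (simp add: vimage_def case_prod_beta')
  also have "\<dots> = measure_pmf.expectation W (\<lambda>w. measure_pmf.prob (pair_pmf A C) {(y, \<omega>). R y w \<omega>})"
    unfolding pair_pmf_bind[of W] prob_bind_pmf by (simp add: vimage_def case_prod_beta')
  finally show ?thesis .
qed


section \<open>The planted model given the community\<close>

definition edge_prob :: "real \<Rightarrow> real \<Rightarrow> (nat \<Rightarrow> bool) \<Rightarrow> nat \<times> nat \<Rightarrow> real" where
  "edge_prob a b \<theta> e = (if \<theta> (fst e) \<and> \<theta> (snd e) then b else a)"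

lemma edge_prob_eq: "a + (b - a) * of_bool (\<theta> i) * of_bool (\<theta> j) = edge_prob a b \<theta> (i, j)"
  by (simp add: edge_prob_def)

lemma pds_joint_bind: "pds_joint n p0 p1 \<rho> =
  bind_pmf (Pi_pmf {..<n} False (\<lambda>_. bernoulli_pmf \<rho>)) (\<lambda>\<theta>.
    map_pmf (Pair \<theta>) (Pi_pmf (edges n) False (\<lambda>e. bernoulli_pmf (edge_prob p0 p1 \<theta> e))))"
  unfolding pds_joint_def edge_prob_eq by (simp add: map_pmf_def case_prod_unfold)

lemma pds_bind: "pds n p0 p1 \<rho> =
  bind_pmf (Pi_pmf {..<n} False (\<lambda>_. bernoulli_pmf \<rho>)) (\<lambda>\<theta>.
    Pi_pmf (edges n) False (\<lambda>e. bernoulli_pmf (edge_prob p0 p1 \<theta> e)))"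
  unfolding pds_def pds_joint_bind map_bind_pmf by (simp add: map_pmf_comp)

lemma bind_pair_pmf_left: "pair_pmf (bind_pmf p f) q = bind_pmf p (\<lambda>x. pair_pmf (f x) q)"
  by (simp only: pair_pmf_def bind_assoc_pmf)

text \<open>A present edge is kept with probability a and an absent one switched on with probability
  b, which turns the densities h0, h1 into p0, p1. By Bayes, q0 and q1 are the densities of the
  original graph among the edges missing from the thinned one.\<close>

locale channel =
  fixes a b p0 p1 h0 h1 q0 q1 :: real
  assumes ab: "a \<in> {0..1}" "b \<in> {0..1}"
    and h: "h0 \<in> {0..1}" "h1 \<in> {0..1}"
    and p: "p0 = a * h0 + b * (1 - h0)" "p1 = a * h1 + b * (1 - h1)"
    and q: "q0 \<in> {0..1}" "q1 \<in> {0..1}"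
    and qp: "q0 * (1 - p0) = (1 - a) * h0" "q1 * (1 - p1) = (1 - a) * h1"
begin

text \<open>Community and thinned graph together follow \<open>pds_joint n p0 p1 \<rho>\<close>, the
  law under which the estimator is known to succeed, so the good event may be stated there. Given
  both, the held-out edges are still independent and supply the factor 1 / 2.\<close>

lemma prob_planted_accepts:
  assumes good: "\<And>\<theta> y \<omega>. ((\<theta>, y), \<omega>) \<in> G \<Longrightarrow>
      1 / 2 \<le> measure_pmf.prob (Pi_pmf (edges n) False (\<lambda>e. bernoulli_pmf (edge_prob q0 q1 \<theta> e)))
        {z. scan_accepts n P Q S (Z y \<omega>) y z}"
  shows "1 / 2 * measure_pmf.prob (pair_pmf (pds_joint n p0 p1 \<rho>) C) G \<le>
    measure_pmf.prob (pair_pmf (pair_pmf (pds n h0 h1 \<rho>) (mask_pmf n a b)) C)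
      {((y, w), \<omega>). scan_accepts n P Q S (Z (thin w y) \<omega>) (thin w y) y}"
    (is "_ \<le> measure_pmf.prob _ ?S")
proof -
  let ?T = "Pi_pmf {..<n} False (\<lambda>_. bernoulli_pmf \<rho>)"
  let ?Y = "\<lambda>a b \<theta>. Pi_pmf (edges n) False (\<lambda>e. bernoulli_pmf (edge_prob a b \<theta> e))"
  let ?G = "\<lambda>\<theta>. {(y, \<omega>). ((\<theta>, y), \<omega>) \<in> G}"
  have "measure_pmf.prob (pair_pmf (pds_joint n p0 p1 \<rho>) C) G
      = measure_pmf.expectation ?T (\<lambda>\<theta>. measure_pmf.prob (pair_pmf (?Y p0 p1 \<theta>) C) (?G \<theta>))"
    unfolding pds_joint_bind bind_pair_pmf_left prob_bind_pmf pair_map_pmf1 measure_map_pmf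
    by (simp add: vimage_def apfst_def map_prod_def case_prod_unfold)
  moreover have "measure_pmf.prob (pair_pmf (pair_pmf (pds n h0 h1 \<rho>) (mask_pmf n a b)) C) ?S
      = measure_pmf.expectation ?T (\<lambda>\<theta>. measure_pmf.prob (pair_pmf (pair_pmf (?Y h0 h1 \<theta>) (mask_pmf n a b)) C) ?S)"
    unfolding pds_bind bind_pair_pmf_left prob_bind_pmf ..
  moreover have "1 / 2 * measure_pmf.prob (pair_pmf (?Y p0 p1 \<theta>) C) (?G \<theta>) \<le>
      measure_pmf.prob (pair_pmf (pair_pmf (?Y h0 h1 \<theta>) (mask_pmf n a b)) C) ?S" for \<theta>
  proof -
    have "measure_pmf.prob (pair_pmf (pair_pmf (?Y h0 h1 \<theta>) (mask_pmf n a b)) C) ?S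
        = measure_pmf.prob (pair_pmf (pair_pmf (?Y p0 p1 \<theta>) C) (?Y q0 q1 \<theta>))
            {((y', \<omega>), z). scan_accepts n P Q S (Z y' \<omega>) y' z}"
      by (rule prob_channel) (use ab h p q qp in \<open>auto simp: edge_prob_def\<close>)
    moreover have "1 / 2 * measure_pmf.prob (pair_pmf (?Y p0 p1 \<theta>) C) (?G \<theta>) \<le> \<dots>"
      by (rule prob_pair_ge) (use good in auto)
    ultimately show ?thesis by simp
  qed
  ultimately show ?thesis
    by (simp only: integral_mult_right_zero[symmetric])
      (intro integral_mono integrable_measure_pmf_finite, auto)
qed

lemma prob_null_accepts:
  fixes t s :: real
  assumes t: "0 \<le> t" "t \<le> 1" and Q: "0 < Q"
    and P: "q0 * (1 + t) * of_int Q \<le> of_int P" and S: "s * of_int Q \<le> of_int S"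
  shows "measure_pmf.prob (pair_pmf (pair_pmf (erdos_renyi n h0) (mask_pmf n a b)) C)
      {((y, w), \<omega>). scan_accepts n P Q S (Z (thin w y) \<omega>) (thin w y) y}
    \<le> (real n)\<^sup>2 * exp (- t * s)"
proof -
  have "measure_pmf.prob (pair_pmf (pair_pmf (erdos_renyi n h0) (mask_pmf n a b)) C)
      {((y, w), \<omega>). scan_accepts n P Q S (Z (thin w y) \<omega>) (thin w y) y}
    = measure_pmf.prob
      (pair_pmf (pair_pmf (Pi_pmf (edges n) False (\<lambda>e. bernoulli_pmf p0)) C)
        (Pi_pmf (edges n) False (\<lambda>e. bernoulli_pmf q0)))
      {((y', \<omega>), z). scan_accepts n P Q S (Z y' \<omega>) y' z}"
    unfolding erdos_renyi_def by (rule prob_channel) (use ab h p q qp in auto)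
  also have "\<dots> \<le> (real n)\<^sup>2 * exp (- t * s)"
  proof -
    have "measure_pmf.prob (Pi_pmf (edges n) False (\<lambda>e. bernoulli_pmf q0))
       {z. (x, z) \<in> {((y', \<omega>), z). scan_accepts n P Q S (Z y' \<omega>) y' z}} \<le> (real n)\<^sup>2 * exp (- t * s)" for x
      using scan_accepts_null_le[OF q(1) t Q P S, of n "Z (fst x) (snd x)" "fst x"]
      by (simp add: case_prod_unfold)
    then show ?thesis by (rule prob_pair_le)
  qed
  finally show ?thesis .
qed

text \<open>
  The error is averaged over the masks; some mask is at least as good as the average, and it can be
  built into the program.
\<close>

lemma exists_mask:
  fixes t s :: real and M :: nat
  assumes M: "0 < M"
    and t: "0 \<le> t" "t \<le> 1" and Q: "0 < Q"
    and P: "q0 * (1 + t) * of_int Q \<le> of_int P" and S: "s * of_int Q \<le> of_int S"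
    and good: "\<And>\<theta> y \<omega>. ((\<theta>, y), \<omega>) \<in> G \<Longrightarrow>
      1 / 2 \<le> measure_pmf.prob (Pi_pmf (edges n) False (\<lambda>e. bernoulli_pmf (edge_prob q0 q1 \<theta> e)))
        {z. scan_accepts n P Q S (Z y \<omega>) y z}"
  shows "\<exists>w. (\<forall>e. snd (w e) \<longrightarrow> e \<in> edges n) \<and>
    error_sum (hidden_planted M (pds n h0 h1 \<rho>) (erdos_renyi n h0)) (hidden_null M (erdos_renyi n h0)) (r * M)
      (\<lambda>y \<omega>. \<exists>j<M. scan_accepts n P Q S (Z (thin w (\<lambda>e. y (j, e))) (\<lambda>z. \<omega> (z * M + j)))
        (thin w (\<lambda>e. y (j, e))) (\<lambda>e. y (j, e)))
    \<le> M * ((real n)\<^sup>2 * exp (- t * s)) +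
      (1 - 1 / 2 * measure_pmf.prob (pair_pmf (pds_joint n p0 p1 \<rho>) (coins r)) G)"
proof -
  let ?W = "mask_pmf n a b" and ?base = "\<lambda>w y \<omega>. scan_accepts n P Q S (Z (thin w y) \<omega>) (thin w y) y"
  define N where "N w = measure_pmf.prob (pair_pmf (erdos_renyi n h0) (coins r)) {(y, \<omega>). ?base w y \<omega>}" for w
  define H where "H w = measure_pmf.prob (pair_pmf (pds n h0 h1 \<rho>) (coins r)) {(y, \<omega>). ?base w y \<omega>}" for w
  define err where "err w = M * N w + (1 - H w)" for w
  have int: "integrable (measure_pmf ?W) f" for f :: "_ \<Rightarrow> real"
    by (intro integrable_measure_pmf_finite) simp
  obtain w where w: "w \<in> set_pmf ?W" "err w \<le> measure_pmf.expectation ?W err"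
    using exists_le_expectation[OF finite_mask_pmf, of n a b err] by blast
  have avg: "measure_pmf.expectation ?W err
      = M * measure_pmf.expectation ?W N + (1 - measure_pmf.expectation ?W H)"
    unfolding err_def using int by simp
  have N: "measure_pmf.expectation ?W N \<le> (real n)\<^sup>2 * exp (- t * s)"
    using prob_null_accepts[OF t Q P S, of n "coins r" Z] unfolding pair_pmf_mask_average N_def .
  have H: "1 / 2 * measure_pmf.prob (pair_pmf (pds_joint n p0 p1 \<rho>) (coins r)) G \<le> measure_pmf.expectation ?W H"
  proof -
    have "1 / 2 * measure_pmf.prob (pair_pmf (pds_joint n p0 p1 \<rho>) (coins r)) G \<le>
      measure_pmf.prob (pair_pmf (pair_pmf (pds n h0 h1 \<rho>) ?W) (coins r)) {((y, w), \<omega>). ?base w y \<omega>}"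
      by (rule prob_planted_accepts[where Z = Z and G = G]) (rule good)
    then show ?thesis unfolding pair_pmf_mask_average H_def .
  qed
  have "error_sum (hidden_planted M (pds n h0 h1 \<rho>) (erdos_renyi n h0)) (hidden_null M (erdos_renyi n h0)) (r * M)
      (\<lambda>y \<omega>. \<exists>j<M. ?base w (\<lambda>e. y (j, e)) (\<lambda>z. \<omega> (z * M + j))) \<le> err w"
    unfolding err_def N_def H_def by (rule hidden_error_le[OF M, where base = "?base w"])
  also have "err w \<le> M * measure_pmf.expectation ?W N + (1 - measure_pmf.expectation ?W H)"
    using w(2) unfolding avg .
  also have "M * measure_pmf.expectation ?W N + (1 - measure_pmf.expectation ?W H)
      \<le> M * ((real n)\<^sup>2 * exp (- t * s)) +
      (1 - 1 / 2 * measure_pmf.prob (pair_pmf (pds_joint n p0 p1 \<rho>) (coins r)) G)"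
    using N H by (intro add_mono mult_left_mono diff_left_mono) simp_all
  finally have "error_sum (hidden_planted M (pds n h0 h1 \<rho>) (erdos_renyi n h0)) (hidden_null M (erdos_renyi n h0)) (r * M)
      (\<lambda>y \<omega>. \<exists>j<M. ?base w (\<lambda>e. y (j, e)) (\<lambda>z. \<omega> (z * M + j)))
    \<le> M * ((real n)\<^sup>2 * exp (- t * s)) +
      (1 - 1 / 2 * measure_pmf.prob (pair_pmf (pds_joint n p0 p1 \<rho>) (coins r)) G)" .
  then show ?thesis
    using mask_pmf_support[OF w(1)] by (intro exI[of _ w] conjI allI impI)
qed

end

section \<open>Correlation and superlevel sets\<close>

text \<open>Entries up to \<tau> = \<kappa> F / (2 k) account for at most k^2 \<tau>, half of the
  correlation. The other half lies above \<tau>, where Cauchy-Schwarz forces a large overlap with W,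
  while the set of all entries above \<tau> has size at most F^2 / \<tau>^2 by Chebyshev.\<close>

lemma exists_superlevel:
  fixes Z :: "nat \<times> nat \<Rightarrow> real" and W :: "(nat \<times> nat) set"
  assumes W: "W \<subseteq> edges n" "real (card W) \<le> k\<^sup>2" and pos: "0 < F" "0 < k" "0 < \<kappa>"
    and corr: "\<kappa> * F * k \<le> (\<Sum>e\<in>W. Z e)" and norm: "(\<Sum>e\<in>edges n. (Z e)\<^sup>2) \<le> F\<^sup>2"
  shows "\<exists>f\<in>edges n. \<kappa>\<^sup>2 * k\<^sup>2 / 4 \<le> real (card (superlevel n Z f \<inter> W)) \<and>
    real (card (superlevel n Z f)) \<le> 4 * k\<^sup>2 / \<kappa>\<^sup>2"
proof -
  define \<tau> where "\<tau> = \<kappa> * F / (2 * k)"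
  have \<tau>: "0 < \<tau>" using pos by (simp add: \<tau>_def)
  define U where "U = {e \<in> edges n. \<tau> < Z e}"
  have finW: "finite W" using W(1) finite_edges finite_subset by blast
  have finU: "finite U" by (simp add: U_def)
  have "(\<Sum>e\<in>W - U. Z e) \<le> (\<Sum>e\<in>W - U. \<tau>)"
    by (rule sum_mono) (use W(1) in \<open>auto simp: U_def\<close>)
  also have "\<dots> = real (card (W - U)) * \<tau>" by simp
  also have "\<dots> \<le> k\<^sup>2 * \<tau>"
  proof -
    have "real (card (W - U)) \<le> real (card W)" using finW by (simp add: card_mono)
    then show ?thesis using W(2) \<tau> by (intro mult_right_mono) auto
  qed
  also have "\<dots> = \<kappa> * F * k / 2" using pos by (simp add: \<tau>_def power2_eq_square)
  finally have "(\<Sum>e\<in>W - U. Z e) \<le> \<kappa> * F * k / 2" .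
  moreover have "(\<Sum>e\<in>W. Z e) = (\<Sum>e\<in>W \<inter> U. Z e) + (\<Sum>e\<in>W - U. Z e)"
    using finW by (metis sum.Int_Diff)
  ultimately have half: "\<kappa> * F * k / 2 \<le> (\<Sum>e\<in>W \<inter> U. Z e)" using corr by linarith
  have "(\<kappa> * F * k / 2)\<^sup>2 \<le> (\<Sum>e\<in>W \<inter> U. Z e)\<^sup>2"
    using half pos by (intro power_mono) auto
  also have "\<dots> \<le> (\<Sum>e\<in>W \<inter> U. (Z e)\<^sup>2) * real (card (W \<inter> U))"
    by (rule sum_squared_le_sum_of_squares)
  also have "\<dots> \<le> F\<^sup>2 * real (card (W \<inter> U))"
  proof (rule mult_right_mono)
    have "(\<Sum>e\<in>W \<inter> U. (Z e)\<^sup>2) \<le> (\<Sum>e\<in>edges n. (Z e)\<^sup>2)"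
      using W(1) by (intro sum_mono2) auto
    then show "(\<Sum>e\<in>W \<inter> U. (Z e)\<^sup>2) \<le> F\<^sup>2" using norm by linarith
  qed simp
  finally have "F\<^sup>2 * (\<kappa>\<^sup>2 * k\<^sup>2 / 4) \<le> F\<^sup>2 * real (card (W \<inter> U))"
    by (simp add: power2_eq_square algebra_simps)
  then have big: "\<kappa>\<^sup>2 * k\<^sup>2 / 4 \<le> real (card (W \<inter> U))"
    using pos by (simp add: mult_le_cancel_left)
  have "0 < \<kappa>\<^sup>2 * k\<^sup>2 / 4" using pos by simp
  with big have "U \<noteq> {}" by auto
  \<comment> \<open>The least entry above \<tau> serves as threshold, so the set is among the
    candidates that the program tries.\<close>
  then obtain f where f: "f \<in> U" "\<And>e. e \<in> U \<Longrightarrow> Z f \<le> Z e"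
    using arg_min_if_finite[OF finU, of Z] by (metis leI)
  have eq: "superlevel n Z f = U"
  proof (intro set_eqI iffI)
    fix e assume "e \<in> superlevel n Z f"
    then show "e \<in> U" using f(1) by (auto simp: superlevel_def U_def)
  next
    fix e assume e: "e \<in> U"
    then show "e \<in> superlevel n Z f" using f(2)[OF e] \<tau> by (auto simp: superlevel_def U_def)
  qed
  have "real (card U) * \<tau>\<^sup>2 = (\<Sum>e\<in>U. \<tau>\<^sup>2)" by simp
  also have "\<dots> \<le> (\<Sum>e\<in>U. (Z e)\<^sup>2)"
    using \<tau> by (intro sum_mono power_mono) (auto simp: U_def)
  also have "\<dots> \<le> (\<Sum>e\<in>edges n. (Z e)\<^sup>2)"
    by (intro sum_mono2) (auto simp: U_def)
  also have "\<dots> \<le> F\<^sup>2" by (rule norm)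
  finally have "real (card U) \<le> F\<^sup>2 / \<tau>\<^sup>2" using \<tau> by (simp add: pos_le_divide_eq)
  also have "\<dots> = 4 * k\<^sup>2 / \<kappa>\<^sup>2" using pos by (simp add: \<tau>_def power_divide power_mult_distrib)
  finally have "real (card U) \<le> 4 * k\<^sup>2 / \<kappa>\<^sup>2" .
  moreover have "f \<in> edges n" using f(1) by (simp add: U_def)
  ultimately show ?thesis using big unfolding eq[symmetric] by (intro bexI[of _ f]) (simp_all only: Int_commute simp_thms)
qed

definition planted_edges :: "nat \<Rightarrow> (nat \<Rightarrow> bool) \<Rightarrow> (nat \<times> nat) set" where
  "planted_edges n \<theta> = {e \<in> edges n. \<theta> (fst e) \<and> \<theta> (snd e)}"

definition planted_card :: "nat \<Rightarrow> (nat \<Rightarrow> bool) \<Rightarrow> nat" where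
  "planted_card n \<theta> = card {i. i < n \<and> \<theta> i}"

lemma planted_edges_subset: "planted_edges n \<theta> \<subseteq> edges n"
  by (auto simp: planted_edges_def)

lemma card_planted_edges_le: "real (card (planted_edges n \<theta>)) \<le> (real (planted_card n \<theta>))\<^sup>2"
proof -
  let ?T = "{i. i < n \<and> \<theta> i}"
  have "card (planted_edges n \<theta>) \<le> card (?T \<times> ?T)"
    by (intro card_mono) (auto simp: planted_edges_def edges_def)
  then have "card (planted_edges n \<theta>) \<le> (planted_card n \<theta>)\<^sup>2"
    by (simp add: planted_card_def power2_eq_square)
  then show ?thesis by (metis of_nat_le_iff of_nat_power)
qed

lemma sum_square_split:
  fixes f :: "nat \<Rightarrow> nat \<Rightarrow> real"
  shows "(\<Sum>i<n. \<Sum>j<n. f i j) =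
    (\<Sum>i<n. f i i) + (\<Sum>e\<in>edges n. entry False f e) + (\<Sum>e\<in>edges n. entry True f e)"
proof -
  let ?D = "(\<lambda>i. (i, i)) ` {..<n}" and ?L = "prod.swap ` edges n"
  have "(\<Sum>i<n. \<Sum>j<n. f i j) = (\<Sum>(i, j)\<in>{..<n} \<times> {..<n}. f i j)"
    by (simp add: sum.cartesian_product)
  also have "{..<n} \<times> {..<n} = (?D \<union> edges n) \<union> ?L"
    by (auto simp: edges_def image_iff)
  also have "(\<Sum>(i, j)\<in>(?D \<union> edges n) \<union> ?L. f i j)
      = (\<Sum>(i, j)\<in>?D. f i j) + (\<Sum>(i, j)\<in>edges n. f i j) + (\<Sum>(i, j)\<in>?L. f i j)"
  proof -
    have "?D \<inter> edges n = {}" "(?D \<union> edges n) \<inter> ?L = {}" by (auto simp: edges_def)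
    then show ?thesis by (simp add: sum.union_disjoint)
  qed
  also have "(\<Sum>(i, j)\<in>?D. f i j) = (\<Sum>i<n. f i i)"
    by (subst sum.reindex) (auto simp: inj_on_def)
  also have "(\<Sum>(i, j)\<in>?L. f i j) = (\<Sum>e\<in>edges n. entry True f e)"
    by (subst sum.reindex) (auto simp: inj_on_def entry_def case_prod_unfold)
  finally show ?thesis by (simp add: entry_def case_prod_unfold)
qed

lemma sum_entry_squares_le: "(\<Sum>e\<in>edges n. (entry d A e)\<^sup>2) \<le> (frob_norm n A)\<^sup>2"
proof -
  let ?f = "\<lambda>i j. (A i j)\<^sup>2"
  have e: "(entry d A e)\<^sup>2 = entry d ?f e" for d e by (simp add: entry_def case_prod_unfold)
  have nn: "0 \<le> entry d ?f e" for d e by (simp add: entry_def case_prod_unfold)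
  have "(frob_norm n A)\<^sup>2 = (\<Sum>i<n. \<Sum>j<n. ?f i j)"
    unfolding frob_norm_def frob_inner_def
    by (subst real_sqrt_pow2) (auto intro!: sum_nonneg simp: power2_eq_square)
  also have "\<dots> = (\<Sum>i<n. ?f i i) + (\<Sum>e\<in>edges n. entry False ?f e) + (\<Sum>e\<in>edges n. entry True ?f e)"
    by (rule sum_square_split)
  finally show ?thesis
    using sum_nonneg[of "edges n" "entry False ?f"] sum_nonneg[of "edges n" "entry True ?f"] nn
      sum_nonneg[of "{..<n}" "\<lambda>i. ?f i i"]
    unfolding e by (cases d) auto
qed

lemma frob_inner_signal:
  "frob_inner n A (signal p0 p1 \<theta>) = (p1 - p0) * (\<Sum>i<n. \<Sum>j<n. A i j * of_bool (\<theta> i \<and> \<theta> j))"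
  unfolding frob_inner_def signal_def sum_distrib_left
  by (intro sum.cong refl) (auto simp: of_bool_def)

lemma frob_norm_signal:
  assumes "p0 \<le> p1"
  shows "frob_norm n (signal p0 p1 \<theta>) = (p1 - p0) * planted_card n \<theta>"
proof -
  have "frob_inner n (signal p0 p1 \<theta>) (signal p0 p1 \<theta>)
      = (p1 - p0)\<^sup>2 * (\<Sum>i<n. \<Sum>j<n. of_bool (\<theta> i) * of_bool (\<theta> j))"
    unfolding frob_inner_def signal_def sum_distrib_left
    by (intro sum.cong refl) (auto simp: of_bool_def power2_eq_square)
  also have "(\<Sum>i<n. \<Sum>j<n. of_bool (\<theta> i) * of_bool (\<theta> j) :: real) = (real (planted_card n \<theta>))\<^sup>2"
    unfolding sum_product[symmetric] power2_eq_square
  proof -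
    have "(\<Sum>i<n. of_bool (\<theta> i) :: real) = planted_card n \<theta>"
      by (simp add: planted_card_def lessThan_def Int_def conj_commute)
    then show "(\<Sum>i<n. of_bool (\<theta> i)) * (\<Sum>j<n. of_bool (\<theta> j))
        = real (planted_card n \<theta>) * real (planted_card n \<theta>)" by (simp only:)
  qed
  finally show ?thesis using assms by (simp add: frob_norm_def real_sqrt_mult)
qed

lemma frob_inner_le: "frob_inner n A B \<le> frob_norm n A * frob_norm n B"
proof -
  let ?I = "{..<n} \<times> {..<n}"
  have i: "frob_inner n A B = (\<Sum>x\<in>?I. A (fst x) (snd x) * B (fst x) (snd x))" for A B
    unfolding frob_inner_def by (simp add: sum.cartesian_product case_prod_unfold)
  have "(frob_inner n A B)\<^sup>2 \<le> frob_inner n A A * frob_inner n B B"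
    unfolding i using Cauchy_Schwarz_ineq_sum[of "\<lambda>x. A (fst x) (snd x)" "\<lambda>x. B (fst x) (snd x)" ?I]
    by (simp add: power2_eq_square)
  then have "sqrt ((frob_inner n A B)\<^sup>2) \<le> sqrt (frob_inner n A A * frob_inner n B B)"
    by (rule real_sqrt_le_mono)
  then show ?thesis by (simp add: frob_norm_def real_sqrt_mult)
qed

lemma frob_norm_nonneg: "0 \<le> frob_norm n A"
  unfolding frob_norm_def frob_inner_def by (auto intro!: sum_nonneg)

lemma correlation_le_1:
  "frob_inner n A B / (frob_norm n A * frob_norm n B) \<le> 1"
proof -
  have "0 \<le> frob_norm n A * frob_norm n B" by (simp add: frob_norm_nonneg)
  then show ?thesis using frob_inner_le[of n A B]
    by (cases "frob_norm n A * frob_norm n B = 0") (auto simp: divide_le_eq_1 less_le)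
qed

text \<open>The diagonal corresponds to no edge. By Cauchy-Schwarz it contributes at most F times
  the root of k, which is at most half of c F k once k >= 4 / c^2. The remaining half is shared by
  the two triangles, so one of them keeps a quarter.\<close>

lemma correlated_direction:
  fixes A :: "nat \<Rightarrow> nat \<Rightarrow> real"
  assumes p: "p0 \<le> p1" and c: "0 < c"
    and corr: "c \<le> frob_inner n A (signal p0 p1 \<theta>) / (frob_norm n A * frob_norm n (signal p0 p1 \<theta>))"
    and k: "4 / c\<^sup>2 \<le> planted_card n \<theta>"
  shows "0 < frob_norm n A \<and>
    (\<exists>d. c / 4 * frob_norm n A * planted_card n \<theta> \<le> (\<Sum>e\<in>planted_edges n \<theta>. entry d A e))"
proof -
  let ?F = "frob_norm n A" and ?k = "real (planted_card n \<theta>)"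
  let ?I = "\<Sum>i<n. \<Sum>j<n. A i j * of_bool (\<theta> i \<and> \<theta> j)"
  \<comment> \<open>A vanishing denominator makes the ratio 0, contrary to 0 < c.\<close>
  have F: "0 < ?F"
  proof (rule ccontr)
    assume "\<not> 0 < ?F"
    then have "?F = 0" using frob_norm_nonneg[of n A] by linarith
    then show False using corr c by simp
  qed
  have "(p1 - p0) * ?k \<noteq> 0"
  proof
    assume "(p1 - p0) * ?k = 0"
    then have "frob_norm n (signal p0 p1 \<theta>) = 0" unfolding frob_norm_signal[OF p] .
    then show False using corr c by simp
  qed
  then have kp: "0 < ?k" and pp: "0 < p1 - p0" using p by simp_all
  define I where "I = ?I"
  have "frob_inner n A (signal p0 p1 \<theta>) / (?F * frob_norm n (signal p0 p1 \<theta>))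
      = ((p1 - p0) * I) / ((p1 - p0) * (?F * ?k))"
    unfolding frob_inner_signal frob_norm_signal[OF p] I_def by (simp only: mult.left_commute)
  also have "\<dots> = I / (?F * ?k)"
    using pp by (intro mult_divide_mult_cancel_left) simp
  finally have "c \<le> I / (?F * ?k)" using corr by (simp only:)
  moreover have "0 < ?F * ?k" using F kp by (rule mult_pos_pos)
  ultimately have I: "c * (?F * ?k) \<le> I" by (simp only: pos_le_divide_eq)
  have plant: "(\<Sum>e\<in>edges n. entry d (\<lambda>i j. A i j * of_bool (\<theta> i \<and> \<theta> j)) e)
      = (\<Sum>e\<in>planted_edges n \<theta>. entry d A e)" for d
    unfolding planted_edges_def
    by (intro sum.mono_neutral_cong_right) (auto simp: entry_def split: if_splits)
  have diag: "(\<Sum>i<n. A i i * of_bool (\<theta> i \<and> \<theta> i)) \<le> c / 2 * ?F * ?k"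
  proof -
    let ?T = "{i. i < n \<and> \<theta> i}"
    have T: "(\<Sum>i<n. A i i * of_bool (\<theta> i \<and> \<theta> i)) = (\<Sum>i\<in>?T. A i i)"
      by (intro sum.mono_neutral_cong_right) auto
    have cs: "(\<Sum>i\<in>?T. A i i)\<^sup>2 \<le> (\<Sum>i\<in>?T. (A i i)\<^sup>2) * real (card ?T)"
      by (rule sum_squared_le_sum_of_squares)
    have le: "(\<Sum>i\<in>?T. (A i i)\<^sup>2) \<le> ?F\<^sup>2"
    proof -
      have "(\<Sum>i\<in>?T. (A i i)\<^sup>2) \<le> (\<Sum>i<n. (A i i)\<^sup>2)" by (intro sum_mono2) auto
      also have "\<dots> \<le> (\<Sum>i<n. \<Sum>j<n. (A i j)\<^sup>2)"
      proof (rule sum_mono)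
        fix i assume "i \<in> {..<n}"
        then show "(A i i)\<^sup>2 \<le> (\<Sum>j<n. (A i j)\<^sup>2)"
          using member_le_sum[of i "{..<n}" "\<lambda>j. (A i j)\<^sup>2"] by simp
      qed
      also have "\<dots> = ?F\<^sup>2"
        unfolding frob_norm_def frob_inner_def
        by (subst real_sqrt_pow2) (auto intro!: sum_nonneg simp: power2_eq_square)
      finally show ?thesis .
    qed
    have "(\<Sum>i<n. A i i * of_bool (\<theta> i \<and> \<theta> i))\<^sup>2 \<le> (\<Sum>i\<in>?T. (A i i)\<^sup>2) * ?k"
      unfolding T planted_card_def by (rule cs)
    also have "\<dots> \<le> ?F\<^sup>2 * ?k" using le by (rule mult_right_mono) simp
    also have "\<dots> \<le> (c / 2 * ?F * ?k)\<^sup>2"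
    proof -
      have "4 \<le> ?k * c\<^sup>2" using k c by (subst (asm) pos_divide_le_eq) auto
      then have "1 \<le> c\<^sup>2 / 4 * ?k" by (simp add: field_simps)
      then have "?F\<^sup>2 * ?k * 1 \<le> ?F\<^sup>2 * ?k * (c\<^sup>2 / 4 * ?k)" by (intro mult_left_mono) auto
      then show ?thesis by (simp add: power2_eq_square algebra_simps)
    qed
    finally show ?thesis by (rule power2_le_imp_le) (use c F kp in simp)
  qed
  have "I = (\<Sum>i<n. A i i * of_bool (\<theta> i \<and> \<theta> i)) + (\<Sum>e\<in>planted_edges n \<theta>. entry False A e)
      + (\<Sum>e\<in>planted_edges n \<theta>. entry True A e)"
    using sum_square_split[of "\<lambda>i j. A i j * of_bool (\<theta> i \<and> \<theta> j)" n] unfolding I_def by (simp only: plant)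
  with I diag have "c / 2 * ?F * ?k \<le>
      (\<Sum>e\<in>planted_edges n \<theta>. entry False A e) + (\<Sum>e\<in>planted_edges n \<theta>. entry True A e)"
    by (simp add: algebra_simps)
  then have "c / 4 * ?F * ?k \<le> (\<Sum>e\<in>planted_edges n \<theta>. entry False A e) \<or>
      c / 4 * ?F * ?k \<le> (\<Sum>e\<in>planted_edges n \<theta>. entry True A e)"
    by linarith
  then show ?thesis using F by blast
qed

section \<open>Acceptance on the good event\<close>

text \<open>The expected excess is g o'. The surplus slope t and the offset s use up at most a
  quarter of it each, and rounding at most 1, so the mean \<mu> still exceeds the threshold by g o'
  / 4. The two assumptions \<open>big\<close> bound each of the two parts of 4 \<mu> by (g o')^2 /
  32, so the exponent of the lower tail is at least 1.\<close>

lemma level_accepts: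
  fixes q0 q1 g R \<kappa> k t s ov aa :: real
  assumes q: "q0 \<in> {0..1}" "q1 \<in> {0..1}" and g: "g = q1 - q0" "0 \<le> g"
    and f: "f \<in> edges n" and W: "W = planted_edges n \<theta>"
    and A: "A = superlevel n Z f - {e. y' e}"
    and ov: "ov \<le> card (A \<inter> W)" and aa: "card A \<le> aa"
    and big: "128 \<le> g * ov" "128 * (q0 * aa) \<le> (g * ov)\<^sup>2"
    and t: "0 \<le> t" "t * q0 * aa \<le> g * ov / 4" and s: "s = g * ov / 4"
    and Q: "(real n)\<^sup>2 + 1 \<le> of_int Q" and P: "of_int P \<le> q0 * (1 + t) * of_int Q + 1"
    and S: "of_int S \<le> s * of_int Q + 1"
  shows "1 / 2 \<le> measure_pmf.prob (Pi_pmf (edges n) False (\<lambda>e. bernoulli_pmf (edge_prob q0 q1 \<theta> e)))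
    {z. scan_accepts n P Q S Z y' z}"
proof -
  let ?p = "Pi_pmf (edges n) False (\<lambda>e. bernoulli_pmf (edge_prob q0 q1 \<theta> e))"
  define a o' where "a = real (card A)" and "o' = real (card (A \<inter> W))"
  define \<mu> c where "\<mu> = q0 * a + g * o'" and "c = q0 * (1 + t) * a + s + 1"
  have sub: "A \<subseteq> edges n" using A by (auto simp: superlevel_def)
  then have fin: "finite A" using finite_edges finite_subset by blast
  have "a \<le> (real n)\<^sup>2"
  proof -
    have "card A \<le> n\<^sup>2" using card_mono[OF finite_edges sub] card_edges_le[of n] by linarith
    then show ?thesis unfolding a_def by (metis of_nat_le_iff of_nat_power)
  qed
  have a: "0 \<le> a" "a \<le> aa" using aa by (simp_all add: a_def)
  have Q0: "0 < real_of_int Q" using Q zero_le_power2[of "real n"] by linarith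
  have go: "g * ov \<le> g * o'" using ov g(2) unfolding o'_def by (rule mult_left_mono)
  have q0a: "q0 * a \<le> q0 * aa" using a q by (intro mult_left_mono) auto
  have tq: "t * q0 * a \<le> g * ov / 4"
  proof -
    have "t * q0 * a \<le> t * q0 * aa" using a q t(1) by (intro mult_left_mono) auto
    then show ?thesis using t(2) by linarith
  qed
  have gap: "g * o' / 4 \<le> \<mu> - c"
    using tq go big(1) unfolding \<mu>_def c_def s by (simp add: algebra_simps)
  have mu_sum: "\<mu> = (\<Sum>e\<in>A. edge_prob q0 q1 \<theta> e)"
  proof -
    have "(\<Sum>e\<in>A. edge_prob q0 q1 \<theta> e) = (\<Sum>e\<in>A. q0 + g * of_bool (e \<in> W))"
      using sub g(1) W by (intro sum.cong) (auto simp: edge_prob_def planted_edges_def)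
    also have "\<dots> = q0 * a + g * (\<Sum>e\<in>A. of_bool (e \<in> W))"
      by (simp add: sum.distrib sum_distrib_left[symmetric] a_def)
    also have "(\<Sum>e\<in>A. of_bool (e \<in> W)) = o'" using fin by (simp add: o'_def Int_def)
    finally show ?thesis by (simp add: \<mu>_def)
  qed
  have mu: "0 < \<mu>" "0 < g * o'" using big(1) go q a unfolding \<mu>_def
    by (auto intro!: add_nonneg_pos mult_nonneg_nonneg)
  have "4 * \<mu> \<le> (\<mu> - c)\<^sup>2"
  proof -
    have "(g * ov)\<^sup>2 \<le> (g * o')\<^sup>2" using go big(1) by (intro power_mono) auto
    then have 1: "128 * (q0 * a) \<le> (g * o')\<^sup>2" using big(2) q0a by linarith
    have "128 * (g * o') \<le> (g * o') * (g * o')" using go big(1) by (intro mult_right_mono) auto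
    then have 2: "128 * (g * o') \<le> (g * o')\<^sup>2" by (simp add: power2_eq_square)
    have "(g * o' / 4)\<^sup>2 \<le> (\<mu> - c)\<^sup>2" using gap mu(2) by (intro power_mono) auto
    moreover have "(g * o' / 4)\<^sup>2 = (g * o')\<^sup>2 / 16" by (simp add: power_divide)
    moreover have "4 * \<mu> = 4 * (q0 * a) + 4 * (g * o')" by (simp add: \<mu>_def)
    ultimately show ?thesis using 1 2 by linarith
  qed
  then have ratio: "1 \<le> (\<mu> - c)\<^sup>2 / (4 * \<mu>)" using mu by (subst pos_le_divide_eq) auto
  have "- {z. scan_accepts n P Q S Z y' z} \<subseteq> {z. (\<Sum>e\<in>A. of_bool (z e)) \<le> c}"
  proof
    fix z :: "nat \<times> nat \<Rightarrow> bool"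
    let ?N = "\<Sum>e\<in>A. of_bool (z e) :: real"
    assume "z \<in> - {z. scan_accepts n P Q S Z y' z}"
    then have "score P Q A z \<le> S" using f A by (force simp: scan_accepts_def not_less)
    then have "real_of_int Q * ?N - real_of_int P * a \<le> real_of_int S"
      using score_eq[OF fin, of P Q z] unfolding a_def by linarith
    moreover have "real_of_int P * a \<le> (q0 * (1 + t) * of_int Q + 1) * a"
      using P a(1) by (rule mult_right_mono)
    \<comment> \<open>Rounding P up costs at most 1 per element of A, and rounding S up at most 1 in
      all. After division by Q this is at most 1, the last summand of c.\<close>
    moreover have "a + 1 \<le> real_of_int Q" using \<open>a \<le> (real n)\<^sup>2\<close> Q by linarith
    ultimately have "real_of_int Q * ?N \<le> real_of_int Q * c"
      using S by (simp add: c_def algebra_simps)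
    then show "z \<in> {z. (\<Sum>e\<in>A. of_bool (z e)) \<le> c}"
      using Q0 by (simp add: mult_le_cancel_left_pos)
  qed
  then have "measure_pmf.prob ?p (- {z. scan_accepts n P Q S Z y' z})
      \<le> measure_pmf.prob ?p {z. (\<Sum>e\<in>A. of_bool (z e)) \<le> c}"
    by (intro measure_pmf.finite_measure_mono) auto
  also have "\<dots> \<le> exp (- (\<mu> - c)\<^sup>2 / (4 * \<mu>))"
  proof (rule bernoulli_sum_lower_tail[OF finite_edges sub _ mu_sum mu(1)])
    show "c \<le> \<mu>" using gap mu(2) by linarith
  qed (use q in \<open>auto simp: edge_prob_def\<close>)
  also have "\<dots> \<le> exp (- 1)" using ratio by simp
  also have "\<dots> \<le> 1 / 2"
    using exp_ge_add_one_self[of 1] by (simp add: exp_minus inverse_eq_divide divide_le_eq)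
  finally show ?thesis
    using measure_pmf.prob_compl[of "{z. scan_accepts n P Q S Z y' z}" ?p]
    by (simp add: Compl_eq_Diff_UNIV)
qed

lemma measure_subadditive_pmf:
  "measure_pmf.prob p (A \<union> B) \<le> measure_pmf.prob p A + measure_pmf.prob p B"
  by (rule measure_Un_le) auto

text \<open>Observed edges are removed from the candidate sets. The bound on observed planted edges
  limits this loss to half of the overlap \<kappa>^2 k^2 / 4 that a superlevel set provides.\<close>

definition good_event ::
  "nat \<Rightarrow> real \<Rightarrow> real \<Rightarrow> bool \<Rightarrow> ((nat \<times> nat \<Rightarrow> bool) \<Rightarrow> (nat \<Rightarrow> bool) \<Rightarrow> nat \<Rightarrow> nat \<Rightarrow> real) \<Rightarrow>
    (((nat \<Rightarrow> bool) \<times> (nat \<times> nat \<Rightarrow> bool)) \<times> (nat \<Rightarrow> bool)) set" where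
  "good_event n \<rho> \<kappa> d X = {((\<theta>, y), \<omega>).
     \<rho> * real n / 2 \<le> real (planted_card n \<theta>) \<and> real (planted_card n \<theta>) \<le> 2 * (\<rho> * real n) \<and>
     real (card (planted_edges n \<theta> \<inter> {e. y e})) \<le> \<kappa>\<^sup>2 * (real (planted_card n \<theta>))\<^sup>2 / 8 \<and>
     0 < frob_norm n (X y \<omega>) \<and>
     \<kappa> * frob_norm n (X y \<omega>) * real (planted_card n \<theta>) \<le> (\<Sum>e\<in>planted_edges n \<theta>. entry d (X y \<omega>) e)}"

lemma good_event_accepts:
  fixes q0 q1 g R \<kappa> \<rho> t s ov aa :: real
  assumes q: "q0 \<in> {0..1}" "q1 \<in> {0..1}" and g: "g = q1 - q0" "0 \<le> g"
    and pos: "0 < \<kappa>" "0 < \<rho> * n"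
    and ov: "ov = \<kappa>\<^sup>2 * (\<rho> * n)\<^sup>2 / 32" and aa: "aa = 16 * (\<rho> * n)\<^sup>2 / \<kappa>\<^sup>2"
    and big: "128 \<le> g * ov" "128 * (q0 * aa) \<le> (g * ov)\<^sup>2"
    and t: "0 \<le> t" "t * q0 * aa \<le> g * ov / 4" and s: "s = g * ov / 4"
    and Q: "(real n)\<^sup>2 + 1 \<le> of_int Q" and P: "of_int P \<le> q0 * (1 + t) * of_int Q + 1"
    and S: "of_int S \<le> s * of_int Q + 1"
    and good: "((\<theta>, y), \<omega>) \<in> good_event n \<rho> \<kappa> d X"
  shows "1 / 2 \<le> measure_pmf.prob (Pi_pmf (edges n) False (\<lambda>e. bernoulli_pmf (edge_prob q0 q1 \<theta> e)))
    {z. scan_accepts n P Q S (entry d (X y \<omega>)) y z}"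
proof -
  let ?Z = "entry d (X y \<omega>)" and ?W = "planted_edges n \<theta>" and ?k = "real (planted_card n \<theta>)"
  have k: "\<rho> * n / 2 \<le> ?k" "?k \<le> 2 * (\<rho> * n)" and Y: "card (?W \<inter> {e. y e}) \<le> \<kappa>\<^sup>2 * ?k\<^sup>2 / 8"
    and F: "0 < frob_norm n (X y \<omega>)"
    and corr: "\<kappa> * frob_norm n (X y \<omega>) * ?k \<le> (\<Sum>e\<in>?W. ?Z e)"
    using good by (auto simp: good_event_def)
  have kp: "0 < ?k" using k(1) pos(2) by linarith
  obtain f where f: "f \<in> edges n" "\<kappa>\<^sup>2 * ?k\<^sup>2 / 4 \<le> real (card (superlevel n ?Z f \<inter> ?W))"
    "real (card (superlevel n ?Z f)) \<le> 4 * ?k\<^sup>2 / \<kappa>\<^sup>2"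
    using exists_superlevel[OF planted_edges_subset card_planted_edges_le F kp pos(1) corr sum_entry_squares_le]
    by blast
  define A where "A = superlevel n ?Z f - {e. y e}"
  have fin: "finite (superlevel n ?Z f)" by (simp add: superlevel_def)
  have k_low: "(\<rho> * n)\<^sup>2 / 4 \<le> ?k\<^sup>2"
    using power_mono[OF k(1), of 2] pos(2) by (simp add: power_divide)
  have k_up: "?k\<^sup>2 \<le> 4 * (\<rho> * n)\<^sup>2"
    using power_mono[OF k(2), of 2] by (simp add: power_mult_distrib)
  have "superlevel n ?Z f \<inter> ?W \<subseteq> (A \<inter> ?W) \<union> (?W \<inter> {e. y e})" by (auto simp: A_def)
  then have "card (superlevel n ?Z f \<inter> ?W) \<le> card (A \<inter> ?W) + card (?W \<inter> {e. y e})"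
    using fin finite_subset[OF planted_edges_subset finite_edges, of n \<theta>]
    by (intro order_trans[OF card_mono card_Un_le]) (auto simp: A_def)
  then have "\<kappa>\<^sup>2 * ?k\<^sup>2 / 4 \<le> real (card (A \<inter> ?W)) + \<kappa>\<^sup>2 * ?k\<^sup>2 / 8" using f(2) Y by linarith
  moreover have "\<kappa>\<^sup>2 * ((\<rho> * n)\<^sup>2 / 4) \<le> \<kappa>\<^sup>2 * ?k\<^sup>2" using k_low by (intro mult_left_mono) auto
  ultimately have o1: "ov \<le> card (A \<inter> ?W)" unfolding ov by linarith
  have "card A \<le> card (superlevel n ?Z f)" using fin by (intro card_mono) (auto simp: A_def)
  then have "real (card A) \<le> 4 * ?k\<^sup>2 / \<kappa>\<^sup>2" using f(3) by linarith
  also have "\<dots> \<le> aa"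
    unfolding aa using k_up pos(1) by (intro divide_right_mono) auto
  finally have a1: "card A \<le> aa" .
  show ?thesis
    by (rule level_accepts[OF q g f(1) refl A_def o1 a1 big t s Q P S])
qed

section \<open>Probability of the good event\<close>

text \<open>Reverse Markov inequality: by Cauchy-Schwarz the ratio never exceeds 1.\<close>

lemma prob_correlated_ge:
  assumes c: "c \<le> expected_correlation n p0 p1 \<rho> r X" "0 < c"
  shows "c / 2 \<le> measure_pmf.prob (pair_pmf (pds_joint n p0 p1 \<rho>) (coins r))
    {((\<theta>, Y), \<omega>). c / 2 \<le> frob_inner n (X Y \<omega>) (signal p0 p1 \<theta>) /
          (frob_norm n (X Y \<omega>) * frob_norm n (signal p0 p1 \<theta>))}"
    (is "_ \<le> measure_pmf.prob ?p ?B")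
proof -
  let ?f = "\<lambda>((\<theta>, Y), \<omega>). frob_inner n (X Y \<omega>) (signal p0 p1 \<theta>) /
          (frob_norm n (X Y \<omega>) * frob_norm n (signal p0 p1 \<theta>))"
  have E: "c \<le> measure_pmf.expectation ?p ?f" using c(1) by (simp add: expected_correlation_def)
  \<comment> \<open>The integral of a function that is not integrable is 0 by convention, so a
    positive expectation implies integrability.\<close>
  have int: "integrable (measure_pmf ?p) ?f"
    using E c(2) not_integrable_integral_eq[of "measure_pmf ?p" ?f] by force
  have "measure_pmf.expectation ?p ?f \<le> measure_pmf.expectation ?p (\<lambda>x. indicator ?B x + c / 2)"
  proof (rule integral_mono[OF int])
    show "integrable (measure_pmf ?p) (\<lambda>x. indicator ?B x + c / 2)"
      by (rule measure_pmf.integrable_const_bound[where B = "1 + \<bar>c\<bar> / 2"]) (auto simp: indicator_def)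
    fix x
    have "?f x \<le> 1" by (auto simp: case_prod_unfold correlation_le_1)
    moreover have "x \<notin> ?B \<Longrightarrow> ?f x < c / 2" by (auto simp: case_prod_unfold)
    ultimately show "?f x \<le> indicator ?B x + c / 2"
      using c(2) by (cases "x \<in> ?B") (simp_all only: indicator_simps, simp_all)
  qed
  also have "\<dots> = measure_pmf.prob ?p ?B + c / 2"
    by (subst Bochner_Integration.integral_add) (auto intro: measure_pmf.integrable_const_bound[where B = 1])
  finally show ?thesis using E by linarith
qed

lemma prob_planted_card_low:
  fixes \<rho> :: real
  assumes "\<rho> \<in> {0..1}" "0 < \<rho> * n"
  shows "measure_pmf.prob (Pi_pmf {..<n} False (\<lambda>_. bernoulli_pmf \<rho>))
      {\<theta>. real (planted_card n \<theta>) < \<rho> * real n / 2} \<le> exp (- (\<rho> * n) / 16)"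
proof -
  let ?p = "Pi_pmf {..<n} False (\<lambda>_. bernoulli_pmf \<rho>)"
  have card: "real (planted_card n \<theta>) = (\<Sum>i<n. of_bool (\<theta> i))" for \<theta>
    by (simp add: planted_card_def lessThan_def Int_def conj_commute)
  have "measure_pmf.prob ?p {\<theta>. real (planted_card n \<theta>) < \<rho> * real n / 2}
      \<le> measure_pmf.prob ?p {\<theta>. (\<Sum>i<n. of_bool (\<theta> i)) \<le> \<rho> * n / 2}"
    unfolding card by (intro measure_pmf.finite_measure_mono) auto
  also have "\<dots> \<le> exp (- (\<rho> * n - \<rho> * n / 2)\<^sup>2 / (4 * (\<rho> * n)))"
    using assms by (intro bernoulli_sum_lower_tail[where q = "\<lambda>_. \<rho>"]) (auto simp: mult.commute)
  also have "- (\<rho> * n - \<rho> * n / 2)\<^sup>2 / (4 * (\<rho> * n)) = - (\<rho> * n) / 16"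
    using assms by (simp add: power2_eq_square field_simps)
  finally show ?thesis .
qed

text \<open>Chernoff with tilt 1 / 2: the threshold contributes -\<rho> n to the exponent and the
  mean at most (exp (1/2) - 1) \<rho> n <= 3/4 \<rho> n.\<close>

lemma prob_planted_card_high:
  fixes \<rho> :: real
  assumes "\<rho> \<in> {0..1}"
  shows "measure_pmf.prob (Pi_pmf {..<n} False (\<lambda>_. bernoulli_pmf \<rho>))
      {\<theta>. 2 * (\<rho> * real n) < real (planted_card n \<theta>)} \<le> exp (- (\<rho> * n) / 4)"
proof -
  let ?p = "Pi_pmf {..<n} False (\<lambda>_. bernoulli_pmf \<rho>)"
  let ?N = "\<lambda>\<theta>. \<Sum>i<n. of_bool (\<theta> i) :: real"
  have card: "real (planted_card n \<theta>) = ?N \<theta>" for \<theta>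
    by (simp add: planted_card_def lessThan_def Int_def conj_commute)
  have "measure_pmf.prob ?p {\<theta>. 2 * (\<rho> * real n) < real (planted_card n \<theta>)}
      \<le> measure_pmf.expectation ?p (\<lambda>\<theta>. exp (- (\<rho> * n)) * exp (1 / 2 * ?N \<theta>))"
    unfolding card by (rule prob_le_expectation) (auto simp flip: exp_add)
  also have "\<dots> = exp (- (\<rho> * n)) * measure_pmf.expectation ?p (\<lambda>\<theta>. exp (1 / 2 * ?N \<theta>))" by simp
  also have "\<dots> \<le> exp (- (\<rho> * n)) * exp ((exp (1 / 2) - 1) * (\<Sum>i<n. \<rho>))"
    using expectation_exp_sum_bernoulli_le[of "{..<n}" "{..<n}" "\<lambda>_. \<rho>" "1 / 2"] assms
    by (intro mult_left_mono) auto
  also have "\<dots> \<le> exp (- (\<rho> * n)) * exp (3 / 4 * (\<Sum>i<n. \<rho>))"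
  proof -
    have "exp (1 / 2 :: real) \<le> 1 + 1 / 2 + (1 / 2)\<^sup>2" by (rule exp_bound) auto
    then have "exp (1 / 2 :: real) - 1 \<le> 3 / 4" by (simp add: power2_eq_square)
    then have "(exp (1 / 2) - 1) * (\<Sum>i<n. \<rho>) \<le> 3 / 4 * (\<Sum>i<n. \<rho>)"
      using assms by (intro mult_right_mono) auto
    then show ?thesis by simp
  qed
  also have "\<dots> = exp (- (\<rho> * n) / 4)" by (simp flip: exp_add add: algebra_simps)
  finally show ?thesis .
qed

text \<open>Markov's inequality is enough: the expected number of planted edges that are present is
  at most k^2 p1, and p1 tends to 0 in the regime.\<close>

lemma prob_dense_planted_edges:
  fixes \<kappa> :: real
  assumes p: "p0 \<in> {0..1}" "p1 \<in> {0..1}" and pos: "0 < \<kappa>" "0 < planted_card n \<theta>"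
  shows "measure_pmf.prob (Pi_pmf (edges n) False (\<lambda>e. bernoulli_pmf (edge_prob p0 p1 \<theta> e)))
    {y. \<kappa>\<^sup>2 * (real (planted_card n \<theta>))\<^sup>2 / 8 < real (card (planted_edges n \<theta> \<inter> {e. y e}))} \<le> 8 * p1 / \<kappa>\<^sup>2"
proof -
  let ?p = "Pi_pmf (edges n) False (\<lambda>e. bernoulli_pmf (edge_prob p0 p1 \<theta> e))"
  let ?W = "planted_edges n \<theta>" and ?v = "\<kappa>\<^sup>2 * (real (planted_card n \<theta>))\<^sup>2 / 8"
  let ?N = "\<lambda>y. \<Sum>e\<in>?W. of_bool (y e) :: real"
  have fin: "finite ?W" by (rule finite_subset[OF planted_edges_subset finite_edges])
  have N: "real (card (?W \<inter> {e. y e})) = ?N y" for y using fin by (simp add: Int_def)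
  have v: "0 < ?v" using pos by simp
  have int: "integrable (measure_pmf ?p) f" for f :: "_ \<Rightarrow> real"
    by (intro integrable_measure_pmf_finite) simp
  have single: "measure_pmf.expectation ?p (\<lambda>y. of_bool (y e)) = p1" if "e \<in> ?W" for e
  proof -
    have e: "e \<in> edges n" "edge_prob p0 p1 \<theta> e = p1"
      using that by (auto simp: planted_edges_def edge_prob_def)
    have "measure_pmf.expectation ?p (\<lambda>y. of_bool (y e) :: real)
        = measure_pmf.expectation (map_pmf (\<lambda>y. y e) ?p) of_bool"
      by (rule integral_map_pmf[symmetric])
    also have "map_pmf (\<lambda>y. y e) ?p = bernoulli_pmf p1"
      using Pi_pmf_component[OF finite_edges, of e n False "\<lambda>e. bernoulli_pmf (edge_prob p0 p1 \<theta> e)"] e by simp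
    finally show ?thesis using p by simp
  qed
  have "measure_pmf.prob ?p {y. ?v < real (card (?W \<inter> {e. y e}))} \<le> measure_pmf.expectation ?p (\<lambda>y. ?N y / ?v)"
    unfolding N using v by (intro prob_le_expectation) (auto intro!: sum_nonneg divide_nonneg_pos)
  also have "\<dots> = (\<Sum>e\<in>?W. measure_pmf.expectation ?p (\<lambda>y. of_bool (y e))) / ?v"
    using int by (simp add: Bochner_Integration.integral_sum)
  also have "\<dots> = card ?W * p1 / ?v" using single by simp
  also have "\<dots> \<le> (real (planted_card n \<theta>))\<^sup>2 * p1 / ?v"
    using card_planted_edges_le[of n \<theta>] p v by (intro divide_right_mono mult_right_mono) auto
  also have "\<dots> = 8 * p1 / \<kappa>\<^sup>2" using pos by simp
  finally show ?thesis .
qed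


text \<open>Off three rare events, correlation at least c / 2 leads to the good event for one of the
  two triangles, with \<kappa> = (c / 2) / 4. The likelier triangle depends on the model and the
  estimator but not on the data, so it can be built into the program.\<close>

lemma prob_good_event:
  fixes \<rho> c :: real
  assumes c: "c \<le> expected_correlation n p0 p1 \<rho> r X" "0 < c"
    and p: "0 \<le> p0" "p0 \<le> p1" "p1 \<le> 1" and \<rho>: "\<rho> \<in> {0..1}"
    and n: "16 / c\<^sup>2 \<le> \<rho> * real n / 2" and \<kappa>: "\<kappa> = c / 8"
  shows "\<exists>d. (c / 2 - exp (- (\<rho> * n) / 16) - exp (- (\<rho> * n) / 4) - 8 * p1 / \<kappa>\<^sup>2) / 2
    \<le> measure_pmf.prob (pair_pmf (pds_joint n p0 p1 \<rho>) (coins r)) (good_event n \<rho> \<kappa> d X)"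
proof -
  let ?p = "pair_pmf (pds_joint n p0 p1 \<rho>) (coins r)"
  let ?T = "Pi_pmf {..<n} False (\<lambda>_. bernoulli_pmf \<rho>)"
  let ?k = "\<lambda>\<theta>. real (planted_card n \<theta>)"
  let ?B = "{((\<theta>, Y), \<omega>). c / 2 \<le> frob_inner n (X Y \<omega>) (signal p0 p1 \<theta>) /
          (frob_norm n (X Y \<omega>) * frob_norm n (signal p0 p1 \<theta>))}"
  let ?low = "{\<theta>. ?k \<theta> < \<rho> * real n / 2}" and ?high = "{\<theta>. 2 * (\<rho> * real n) < ?k \<theta>}"
  let ?dense = "{(\<theta>, y). 0 < planted_card n \<theta> \<and>
    \<kappa>\<^sup>2 * (?k \<theta>)\<^sup>2 / 8 < real (card (planted_edges n \<theta> \<inter> {e. y e}))}"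
  have \<kappa>0: "0 < \<kappa>" using \<kappa> c(2) by simp
  have n0: "0 < \<rho> * n"
  proof -
    have "0 < 16 / c\<^sup>2" using c(2) by simp
    then show ?thesis using n by linarith
  qed
  have fst: "measure_pmf.prob ?p {(x, \<omega>). x \<in> A} = measure_pmf.prob (pds_joint n p0 p1 \<rho>) A" for A
  proof -
    have "measure_pmf.prob (map_pmf fst ?p) A = measure_pmf.prob ?p {(x, \<omega>). x \<in> A}"
      by (simp add: vimage_def case_prod_unfold)
    then show ?thesis by (simp add: map_fst_pair_pmf)
  qed
  have theta: "measure_pmf.prob (pds_joint n p0 p1 \<rho>) {(\<theta>, y). \<theta> \<in> A} = measure_pmf.prob ?T A" for A
  proof -
    have "map_pmf fst (pds_joint n p0 p1 \<rho>) = ?T"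
      unfolding pds_joint_bind map_bind_pmf map_pmf_comp by (simp add: map_pmf_const bind_return_pmf')
    then have "measure_pmf.prob ?T A = measure_pmf.prob (map_pmf fst (pds_joint n p0 p1 \<rho>)) A" by simp
    then show ?thesis by (simp add: vimage_def case_prod_unfold)
  qed
  have low: "measure_pmf.prob ?p {((\<theta>, y), \<omega>). \<theta> \<in> ?low} \<le> exp (- (\<rho> * n) / 16)"
    using fst[of "{(\<theta>, y). \<theta> \<in> ?low}"] theta[of ?low] prob_planted_card_low[OF \<rho> n0]
    by (simp add: case_prod_unfold)
  have high: "measure_pmf.prob ?p {((\<theta>, y), \<omega>). \<theta> \<in> ?high} \<le> exp (- (\<rho> * n) / 4)"
    using fst[of "{(\<theta>, y). \<theta> \<in> ?high}"] theta[of ?high] prob_planted_card_high[OF \<rho>, of n]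
    by (simp add: case_prod_unfold)
  have "measure_pmf.prob (pds_joint n p0 p1 \<rho>) ?dense \<le> 8 * p1 / \<kappa>\<^sup>2"
    unfolding pds_joint_bind
  proof (rule prob_bind_le)
    fix \<theta>
    show "measure_pmf.prob (map_pmf (Pair \<theta>)
        (Pi_pmf (edges n) False (\<lambda>e. bernoulli_pmf (edge_prob p0 p1 \<theta> e)))) ?dense \<le> 8 * p1 / \<kappa>\<^sup>2"
    proof (cases "0 < planted_card n \<theta>")
      case True
      then show ?thesis
        using prob_dense_planted_edges[of p0 p1 \<kappa> n \<theta>] p \<kappa>0 by (simp add: vimage_def)
    next
      case False
      then show ?thesis using p by (simp add: vimage_def)
    qed
  qed
  then have dense: "measure_pmf.prob ?p {(x, \<omega>). x \<in> ?dense} \<le> 8 * p1 / \<kappa>\<^sup>2" by (simp only: fst)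
  let ?G = "\<lambda>d. good_event n \<rho> \<kappa> d X"
  let ?bad1 = "{((\<theta>, y), \<omega>). \<theta> \<in> ?low}" and ?bad2 = "{((\<theta>, y), \<omega>). \<theta> \<in> ?high}"
    and ?bad3 = "{(x, \<omega>). x \<in> ?dense}"
  have "?B \<subseteq> ?G False \<union> (?G True \<union> (?bad1 \<union> (?bad2 \<union> ?bad3)))"
  proof
    fix x assume "x \<in> ?B"
    moreover obtain \<theta> y \<omega> where x: "x = ((\<theta>, y), \<omega>)" by (metis prod.collapse)
    ultimately have corr: "c / 2 \<le> frob_inner n (X y \<omega>) (signal p0 p1 \<theta>) /
        (frob_norm n (X y \<omega>) * frob_norm n (signal p0 p1 \<theta>))" by simp
    show "x \<in> ?G False \<union> (?G True \<union> (?bad1 \<union> (?bad2 \<union> ?bad3)))"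
    proof (cases "x \<in> ?bad1 \<union> (?bad2 \<union> ?bad3)")
      case False
      then have k: "\<rho> * real n / 2 \<le> ?k \<theta>" "?k \<theta> \<le> 2 * (\<rho> * real n)"
        by (auto simp: x)
      have kp: "0 < planted_card n \<theta>" using k(1) n0 by (metis half_gt_zero less_le_trans of_nat_0_less_iff)
      with False have d: "real (card (planted_edges n \<theta> \<inter> {e. y e})) \<le> \<kappa>\<^sup>2 * (?k \<theta>)\<^sup>2 / 8"
        by (auto simp: x)
      have "4 / (c / 2)\<^sup>2 \<le> ?k \<theta>" using n k(1) by (simp add: power_divide)
      from correlated_direction[OF p(2) _ corr this] c(2) obtain b where
        "0 < frob_norm n (X y \<omega>)"
        "c / 2 / 4 * frob_norm n (X y \<omega>) * ?k \<theta> \<le> (\<Sum>e\<in>planted_edges n \<theta>. entry b (X y \<omega>) e)"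
        by auto
      then have "x \<in> ?G b" using k d by (simp add: good_event_def x \<kappa>)
      then show ?thesis by (cases b) auto
    qed auto
  qed
  then have "measure_pmf.prob ?p ?B \<le> measure_pmf.prob ?p (?G False \<union> (?G True \<union> (?bad1 \<union> (?bad2 \<union> ?bad3))))"
    by (intro measure_pmf.finite_measure_mono) auto
  also have "\<dots> \<le> measure_pmf.prob ?p (?G False) + (measure_pmf.prob ?p (?G True) +
      (measure_pmf.prob ?p ?bad1 + (measure_pmf.prob ?p ?bad2 + measure_pmf.prob ?p ?bad3)))"
    by (rule order_trans[OF measure_subadditive_pmf], intro add_left_mono)+ (rule order_refl)
  finally have "c / 2 \<le> measure_pmf.prob ?p (?G False) + measure_pmf.prob ?p (?G True)
      + exp (- (\<rho> * n) / 16) + exp (- (\<rho> * n) / 4) + 8 * p1 / \<kappa>\<^sup>2"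
    using prob_correlated_ge[OF c] low high dense by linarith
  then have "(c / 2 - exp (- (\<rho> * n) / 16) - exp (- (\<rho> * n) / 4) - 8 * p1 / \<kappa>\<^sup>2) / 2 \<le> measure_pmf.prob ?p (?G False) \<or>
    (c / 2 - exp (- (\<rho> * n) / 16) - exp (- (\<rho> * n) / 4) - 8 * p1 / \<kappa>\<^sup>2) / 2 \<le> measure_pmf.prob ?p (?G True)"
    by argo
  then show ?thesis by blast
qed

section \<open>Low-degree advantage\<close>

lemma expectation_pair_mult:
  fixes f :: "'a \<Rightarrow> real" and g :: "'b \<Rightarrow> real"
  assumes "finite (set_pmf p)" "finite (set_pmf q)"
  shows "measure_pmf.expectation (pair_pmf p q) (\<lambda>(a, b). f a * g b)
    = measure_pmf.expectation p f * measure_pmf.expectation q g"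
proof -
  have "measure_pmf.expectation (pair_pmf p q) (\<lambda>(a, b). f a * g b)
      = (\<Sum>x\<in>set_pmf p \<times> set_pmf q. (case x of (a, b) \<Rightarrow> f a * g b) * pmf (pair_pmf p q) x)"
    using assms by (intro integral_measure_pmf_real) auto
  also have "\<dots> = (\<Sum>a\<in>set_pmf p. \<Sum>b\<in>set_pmf q. (f a * pmf p a) * (g b * pmf q b))"
    unfolding sum.cartesian_product by (intro sum.cong refl) (auto simp: pmf_pair)
  also have "\<dots> = (\<Sum>a\<in>set_pmf p. f a * pmf p a) * (\<Sum>b\<in>set_pmf q. g b * pmf q b)"
    by (rule sum_product[symmetric])
  also have "(\<Sum>a\<in>set_pmf p. f a * pmf p a) = measure_pmf.expectation p f"
    using assms by (intro integral_measure_pmf_real[symmetric]) auto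
  also have "(\<Sum>b\<in>set_pmf q. g b * pmf q b) = measure_pmf.expectation q g"
    using assms by (intro integral_measure_pmf_real[symmetric]) auto
  finally show ?thesis .
qed

text \<open>Unlike the library version, the factors may be negative.\<close>

lemma expectation_prod_Pi_pmf_finite:
  fixes f :: "'a \<Rightarrow> 'b \<Rightarrow> real"
  assumes "finite A" "\<And>x. x \<in> A \<Longrightarrow> finite (set_pmf (p x))"
  shows "measure_pmf.expectation (Pi_pmf A d p) (\<lambda>y. \<Prod>x\<in>A. f x (y x))
    = (\<Prod>x\<in>A. measure_pmf.expectation (p x) (f x))"
  using assms
proof (induction A rule: finite_induct)
  case (insert x A)
  have "measure_pmf.expectation (Pi_pmf (insert x A) d p) (\<lambda>y. \<Prod>z\<in>insert x A. f z (y z))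
      = measure_pmf.expectation (pair_pmf (p x) (Pi_pmf A d p))
          (\<lambda>(a, y). f x a * (\<Prod>z\<in>A. f z (y z)))"
    unfolding Pi_pmf_insert[OF insert.hyps] integral_map_pmf
  proof (intro Bochner_Integration.integral_cong refl, clarify)
    fix a y
    have "(\<Prod>z\<in>A. f z ((y(x := a)) z)) = (\<Prod>z\<in>A. f z (y z))"
      using insert.hyps by (intro prod.cong) auto
    then show "(\<Prod>z\<in>insert x A. f z ((y(x := a)) z)) = f x a * (\<Prod>z\<in>A. f z (y z))"
      using insert.hyps by simp
  qed
  also have "\<dots> = measure_pmf.expectation (p x) (f x)
      * measure_pmf.expectation (Pi_pmf A d p) (\<lambda>y. \<Prod>z\<in>A. f z (y z))"
    using insert by (intro expectation_pair_mult finite_set_Pi_pmf) auto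
  finally show ?case using insert by simp
qed simp

text \<open>The Walsh characters for bits of bias p, an orthonormal system under the null
  law.\<close>

definition chi :: "real \<Rightarrow> 'i set \<Rightarrow> ('i \<Rightarrow> bool) \<Rightarrow> real" where
  "chi p S y = (\<Prod>e\<in>S. (of_bool (y e) - p) / sqrt (p * (1 - p)))"

lemma expectation_prod_subset:
  fixes f :: "'i \<Rightarrow> 'b \<Rightarrow> real"
  assumes I: "finite I" and S: "S \<subseteq> I" and p: "\<And>x. x \<in> I \<Longrightarrow> finite (set_pmf (p x))"
  shows "measure_pmf.expectation (Pi_pmf I d p) (\<lambda>y. \<Prod>e\<in>S. f e (y e))
    = (\<Prod>e\<in>S. measure_pmf.expectation (p e) (f e))"
proof -
  have "(\<Prod>e\<in>S. f e (y e)) = (\<Prod>e\<in>I. (if e \<in> S then f e else (\<lambda>_. 1)) (y e))" for y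
    using I S by (intro prod.mono_neutral_cong_left) auto
  then have "measure_pmf.expectation (Pi_pmf I d p) (\<lambda>y. \<Prod>e\<in>S. f e (y e)) =
      measure_pmf.expectation (Pi_pmf I d p) (\<lambda>y. \<Prod>e\<in>I. (if e \<in> S then f e else (\<lambda>_. 1)) (y e))"
    by presburger
  also have "\<dots> = (\<Prod>e\<in>I. measure_pmf.expectation (p e) (if e \<in> S then f e else (\<lambda>_. 1)))"
    by (rule expectation_prod_Pi_pmf_finite[OF I p])
  also have "\<dots> = (\<Prod>e\<in>S. measure_pmf.expectation (p e) (f e))"
    using I S by (intro prod.mono_neutral_cong_right) auto
  finally show ?thesis .
qed

lemma expectation_chi:
  fixes q :: "'i \<Rightarrow> real"
  assumes I: "finite I" "S \<subseteq> I" and q: "\<And>e. e \<in> I \<Longrightarrow> q e \<in> {0..1}"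
  shows "measure_pmf.expectation (Pi_pmf I False (\<lambda>e. bernoulli_pmf (q e))) (chi p S)
    = (\<Prod>e\<in>S. (q e - p) / sqrt (p * (1 - p)))"
proof -
  have "measure_pmf.expectation (Pi_pmf I False (\<lambda>e. bernoulli_pmf (q e))) (chi p S)
     = (\<Prod>e\<in>S. measure_pmf.expectation (bernoulli_pmf (q e)) (\<lambda>b. (of_bool b - p) / sqrt (p * (1 - p))))"
    unfolding chi_def using I by (intro expectation_prod_subset) auto
  also have "\<dots> = (\<Prod>e\<in>S. (q e - p) / sqrt (p * (1 - p)))"
  proof (rule prod.cong[OF refl])
    fix e assume "e \<in> S"
    then have "q e \<in> {0..1}" using I q by auto
    then show "measure_pmf.expectation (bernoulli_pmf (q e)) (\<lambda>b. (of_bool b - p) / sqrt (p * (1 - p)))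
        = (q e - p) / sqrt (p * (1 - p))"
      by (simp add: add_divide_distrib[symmetric] algebra_simps)
  qed
  finally show ?thesis .
qed

lemma chi_orthonormal:
  assumes I: "finite I" "S \<subseteq> I" "T \<subseteq> I" and p: "0 < p" "p < 1"
  shows "measure_pmf.expectation (Pi_pmf I False (\<lambda>_. bernoulli_pmf p)) (\<lambda>y. chi p S y * chi p T y)
    = of_bool (S = T)"
proof -
  let ?s = "sqrt (p * (1 - p))"
  let ?\<phi> = "\<lambda>b. (of_bool b - p) / ?s"
  let ?f = "\<lambda>e b. (if e \<in> S then ?\<phi> b else 1) * (if e \<in> T then ?\<phi> b else 1)"
  have s: "?s * ?s = p * (1 - p)" "?s \<noteq> 0" using p by auto
  have "chi p S y * chi p T y = (\<Prod>e\<in>I. ?f e (y e))" for y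
  proof -
    have "chi p S y = (\<Prod>e\<in>I. if e \<in> S then ?\<phi> (y e) else 1)" if "S \<subseteq> I" for S
      unfolding chi_def using I(1) that by (intro prod.mono_neutral_cong_left) auto
    then show ?thesis using I by (simp add: prod.distrib)
  qed
  then have "measure_pmf.expectation (Pi_pmf I False (\<lambda>_. bernoulli_pmf p)) (\<lambda>y. chi p S y * chi p T y)
      = (\<Prod>e\<in>I. measure_pmf.expectation (bernoulli_pmf p) (?f e))"
    using expectation_prod_Pi_pmf_finite[OF I(1), of "\<lambda>_. bernoulli_pmf p" False ?f] by simp
  also have "\<dots> = (\<Prod>e\<in>I. of_bool (e \<in> S \<longleftrightarrow> e \<in> T))"
  proof (rule prod.cong[OF refl])
    fix e
    have 1: "(1 - p) / ?s * p + (0 - p) / ?s * (1 - p) = 0" by (simp add: field_simps)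
    have 2: "((1 - p) / ?s) * ((1 - p) / ?s) * p + ((0 - p) / ?s) * ((0 - p) / ?s) * (1 - p) = 1"
    proof -
      have "((1 - p) / ?s) * ((1 - p) / ?s) * p + ((0 - p) / ?s) * ((0 - p) / ?s) * (1 - p)
        = (p * (1 - p)) / (?s * ?s)" by (simp add: add_divide_distrib[symmetric] algebra_simps)
      then show ?thesis using p unfolding s by simp
    qed
    show "measure_pmf.expectation (bernoulli_pmf p) (?f e) = of_bool (e \<in> S \<longleftrightarrow> e \<in> T)"
      using p 1 2 by (cases "e \<in> S"; cases "e \<in> T") (simp_all, simp_all add: algebra_simps)
  qed
  also have "\<dots> = of_bool (S = T)"
  proof (cases "S = T")
    case False
    then obtain e where "e \<in> I" "\<not> (e \<in> S \<longleftrightarrow> e \<in> T)" using I by auto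
    then have "\<exists>e\<in>I. of_bool (e \<in> S \<longleftrightarrow> e \<in> T) = (0 :: real)" by auto
    then show ?thesis using I(1) False by (simp only: prod_zero of_bool_eq)
  qed simp
  finally show ?thesis .
qed

definition small_sets :: "'i set \<Rightarrow> nat \<Rightarrow> 'i set set" where
  "small_sets I D = {S. S \<subseteq> I \<and> card S \<le> D}"

lemma finite_small_sets [simp]: "finite I \<Longrightarrow> finite (small_sets I D)"
  by (auto simp: small_sets_def)

text \<open>Powers of a bit collapse, so only the support of the monomial matters. Writing each bit
  as its normalised version times the standard deviation plus p and multiplying out yields
  characters of subsets of the support, so the degree does not grow.\<close>

lemma monomial_expansion:
  assumes I: "finite I" and \<mu>: "set_mset \<mu> \<subseteq> I" "size \<mu> \<le> D" and p: "0 < p" "p < 1"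
  shows "\<exists>c. \<forall>y. (\<Prod>i\<in>#\<mu>. of_bool (y i)) = (\<Sum>S\<in>small_sets I D. c S * chi p S y)"
proof -
  let ?s = "sqrt (p * (1 - p))" and ?U = "set_mset \<mu>"
  define c where "c S = (if S \<subseteq> ?U then ?s ^ card S * p ^ card (?U - S) else 0)" for S
  have s: "?s \<noteq> 0" using p by auto
  have "card ?U \<le> size \<mu>" by (induction \<mu>) (auto simp: card_insert_if)
  then have card: "card ?U \<le> D" using \<mu>(2) by linarith
  have "(\<Prod>i\<in>#\<mu>. of_bool (y i)) = (\<Sum>S\<in>small_sets I D. c S * chi p S y)" for y
  proof -
    have "(\<Prod>i\<in>#\<mu>. of_bool (y i)) = (\<Prod>i\<in>?U. of_bool (y i) :: real)"
    proof (induction \<mu>)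
      case (add i \<mu>)
      show ?case
      proof (cases "i \<in># \<mu>")
        case True
        then have "(\<Prod>i\<in>set_mset \<mu>. of_bool (y i) :: real) = of_bool (y i) * (\<Prod>i\<in>set_mset \<mu> - {i}. of_bool (y i))"
          by (intro prod.remove) auto
        then show ?thesis using True add by (simp add: insert_absorb)
      qed (use add in simp)
    qed simp
    also have "\<dots> = (\<Prod>i\<in>?U. ?s * ((of_bool (y i) - p) / ?s) + p)"
      using s by (intro prod.cong) auto
    also have "\<dots> = (\<Sum>S\<in>Pow ?U. (\<Prod>i\<in>S. ?s * ((of_bool (y i) - p) / ?s)) * (\<Prod>i\<in>?U - S. p))"
      by (rule prod_add) simp
    also have "\<dots> = (\<Sum>S\<in>Pow ?U. c S * chi p S y)"
      by (intro sum.cong refl)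
        (simp only: c_def chi_def prod.distrib prod_constant Pow_iff if_True ac_simps)
    also have "\<dots> = (\<Sum>S\<in>small_sets I D. c S * chi p S y)"
    proof (rule sum.mono_neutral_left)
      show "Pow ?U \<subseteq> small_sets I D"
      proof
        fix S assume "S \<in> Pow ?U"
        then have "S \<subseteq> ?U" by simp
        then have "card S \<le> card ?U" by (intro card_mono) simp
        then show "S \<in> small_sets I D" using \<open>S \<subseteq> ?U\<close> \<mu>(1) card by (auto simp: small_sets_def)
      qed
      show "\<forall>S\<in>small_sets I D - Pow ?U. c S * chi p S y = 0" by (auto simp: c_def)
    qed (use I in simp)
    finally show ?thesis .
  qed
  then show ?thesis by blast
qed

lemma poly_expansion:
  assumes I: "finite I" and p: "0 < p" "p < 1" and f: "f \<in> poly_funs I D"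
  shows "\<exists>c. \<forall>y. f (\<lambda>i. of_bool (y i)) = (\<Sum>S\<in>small_sets I D. c S * chi p S y)"
proof -
  obtain A c where A: "finite A" "\<And>\<mu>. \<mu> \<in> A \<Longrightarrow> set_mset \<mu> \<subseteq> I \<and> size \<mu> \<le> D"
    "f = (\<lambda>x. \<Sum>\<mu>\<in>A. c \<mu> * (\<Prod>i\<in>#\<mu>. x i))"
    using f unfolding poly_funs_def by blast
  have "\<forall>\<mu>\<in>A. \<exists>c. \<forall>y. (\<Prod>i\<in>#\<mu>. of_bool (y i)) = (\<Sum>S\<in>small_sets I D. c S * chi p S y)"
    using A(2) monomial_expansion[OF I _ _ p] by blast
  then obtain b where b: "\<And>\<mu> y. \<mu> \<in> A \<Longrightarrow>
      (\<Prod>i\<in>#\<mu>. of_bool (y i)) = (\<Sum>S\<in>small_sets I D. b \<mu> S * chi p S y)"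
    by metis
  have "f (\<lambda>i. of_bool (y i)) = (\<Sum>S\<in>small_sets I D. (\<Sum>\<mu>\<in>A. c \<mu> * b \<mu> S) * chi p S y)" for y
  proof -
    have "f (\<lambda>i. of_bool (y i)) = (\<Sum>\<mu>\<in>A. \<Sum>S\<in>small_sets I D. c \<mu> * b \<mu> S * chi p S y)"
      unfolding A(3) by (intro sum.cong refl) (simp add: b sum_distrib_left mult.assoc)
    also have "\<dots> = (\<Sum>S\<in>small_sets I D. \<Sum>\<mu>\<in>A. c \<mu> * b \<mu> S * chi p S y)" by (rule sum.swap)
    finally show ?thesis by (simp add: sum_distrib_right)
  qed
  then show ?thesis by (intro exI allI)
qed

text \<open>In the orthonormal basis the numerator is an inner product of coefficient vectors and
  the denominator the norm of one of them; Cauchy-Schwarz leaves the norm of the other.\<close>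

lemma Adv_le:
  assumes I: "finite I" and p: "0 < p" "p < 1" and P: "finite (set_pmf P)"
  shows "Adv D I P (Pi_pmf I False (\<lambda>_. bernoulli_pmf p))
    \<le> ereal (sqrt (\<Sum>S\<in>small_sets I D. (measure_pmf.expectation P (chi p S))\<^sup>2))"
  unfolding Adv_def
proof (rule SUP_least)
  fix f assume "f \<in> poly_funs I D"
  let ?Q = "Pi_pmf I False (\<lambda>_. bernoulli_pmf p)" and ?\<S> = "small_sets I D"
  let ?a = "\<lambda>S. measure_pmf.expectation P (chi p S)"
  obtain c where c: "\<And>y. f (\<lambda>i. of_bool (y i)) = (\<Sum>S\<in>?\<S>. c S * chi p S y)"
    using poly_expansion[OF I p \<open>f \<in> poly_funs I D\<close>] by blast
  have intP: "integrable (measure_pmf P) g" for g :: "_ \<Rightarrow> real"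
    by (rule integrable_measure_pmf_finite[OF P])
  have intQ: "integrable (measure_pmf ?Q) g" for g :: "_ \<Rightarrow> real"
    using I by (intro integrable_measure_pmf_finite) simp
  have EP: "measure_pmf.expectation P (\<lambda>y. f (\<lambda>i. of_bool (y i))) = (\<Sum>S\<in>?\<S>. c S * ?a S)"
    unfolding c using intP by (simp add: Bochner_Integration.integral_sum)
  have EQ: "measure_pmf.expectation ?Q (\<lambda>y. (f (\<lambda>i. of_bool (y i)))\<^sup>2) = (\<Sum>S\<in>?\<S>. (c S)\<^sup>2)"
  proof -
    have "measure_pmf.expectation ?Q (\<lambda>y. (f (\<lambda>i. of_bool (y i)))\<^sup>2)
        = measure_pmf.expectation ?Q (\<lambda>y. \<Sum>S\<in>?\<S>. \<Sum>T\<in>?\<S>. c S * c T * (chi p S y * chi p T y))"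
      unfolding c power2_eq_square sum_product by (simp add: ac_simps)
    also have "\<dots> = (\<Sum>S\<in>?\<S>. \<Sum>T\<in>?\<S>. c S * c T * measure_pmf.expectation ?Q (\<lambda>y. chi p S y * chi p T y))"
      using intQ by (simp add: Bochner_Integration.integral_sum)
    also have "\<dots> = (\<Sum>S\<in>?\<S>. \<Sum>T\<in>?\<S>. c S * c T * of_bool (S = T))"
      using chi_orthonormal[OF I _ _ p] by (intro sum.cong refl) (auto simp: small_sets_def)
    also have "\<dots> = (\<Sum>S\<in>?\<S>. (c S)\<^sup>2)"
      using I by (intro sum.cong refl) (simp add: power2_eq_square of_bool_def if_distrib sum.delta cong: if_cong)
    finally show ?thesis .
  qed
  define A B where "A = (\<Sum>S\<in>?\<S>. (?a S)\<^sup>2)" and "B = (\<Sum>S\<in>?\<S>. (c S)\<^sup>2)"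
  have nn: "0 \<le> A" "0 \<le> B" by (auto simp: A_def B_def intro: sum_nonneg)
  have "(\<Sum>S\<in>?\<S>. c S * ?a S)\<^sup>2 \<le> B * A"
    unfolding A_def B_def by (rule Cauchy_Schwarz_ineq_sum)
  then have cs: "(\<Sum>S\<in>?\<S>. c S * ?a S) \<le> sqrt B * sqrt A"
    by (metis real_le_rsqrt real_sqrt_mult)
  have "ereal (\<Sum>S\<in>?\<S>. c S * ?a S) / ereal (sqrt B) \<le> ereal (sqrt A)"
  proof (cases "B = 0")
    case True
    \<comment> \<open>The polynomial vanishes almost surely under the null law. Then its numerator
      vanishes as well, and 0 / 0 = 0.\<close>
    then have "\<forall>S\<in>?\<S>. c S = 0"
      unfolding B_def using I by (subst (asm) sum_nonneg_eq_0_iff) auto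
    then have "(\<Sum>S\<in>?\<S>. c S * ?a S) = 0" by simp
    then show ?thesis using nn by (simp add: zero_ereal_def[symmetric])
  next
    case False
    then have "0 < sqrt B" using nn by simp
    then show ?thesis using cs by (simp add: pos_divide_le_eq mult.commute)
  qed
  then show "ereal (measure_pmf.expectation P (\<lambda>y. f (\<lambda>i. of_bool (y i)))) /
     ereal (sqrt (measure_pmf.expectation ?Q (\<lambda>y. (f (\<lambda>i. of_bool (y i)))\<^sup>2))) \<le> ereal (sqrt A)"
    unfolding EP EQ B_def .
qed

lemma Adv_ge_1: "1 \<le> Adv D I P Q"
proof -
  have "(\<lambda>_. 1) \<in> poly_funs I D"
    unfolding poly_funs_def
    by (rule CollectI, rule exI[of _ "{{#}}"], rule exI[of _ "\<lambda>_. 1"]) simp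
  then show ?thesis unfolding Adv_def by (rule SUP_upper2) (simp add: one_ereal_def)
qed


section \<open>Advantage of the hidden informative sample problem\<close>

lemma map_case_prod_Pi_pmf:
  assumes A: "finite A" and B: "finite B"
  shows "map_pmf case_prod (Pi_pmf A (\<lambda>_. d) (\<lambda>j. Pi_pmf B d (f j)))
    = Pi_pmf (A \<times> B) d (\<lambda>(j, e). f j e)"
proof (rule pmf_eqI)
  fix g :: "'a \<times> 'b \<Rightarrow> 'c"
  have inj: "inj (case_prod :: ('a \<Rightarrow> 'b \<Rightarrow> 'c) \<Rightarrow> _)"
    by (rule injI) (metis curry_case_prod)
  have g: "g = case_prod (curry g)" by simp
  have "pmf (map_pmf case_prod (Pi_pmf A (\<lambda>_. d) (\<lambda>j. Pi_pmf B d (f j)))) g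
      = pmf (Pi_pmf A (\<lambda>_. d) (\<lambda>j. Pi_pmf B d (f j))) (curry g)"
    by (subst g, rule pmf_map_inj'[OF inj])
  also have "\<dots> = pmf (Pi_pmf (A \<times> B) d (\<lambda>(j, e). f j e)) g"
  proof (cases "\<forall>x. x \<notin> A \<times> B \<longrightarrow> g x = d")
    case True
    then have 1: "\<And>j. j \<notin> A \<Longrightarrow> curry g j = (\<lambda>_. d)" "\<And>j e. e \<notin> B \<Longrightarrow> curry g j e = d"
      by (auto simp: curry_def)
    have "pmf (Pi_pmf A (\<lambda>_. d) (\<lambda>j. Pi_pmf B d (f j))) (curry g) = (\<Prod>j\<in>A. pmf (Pi_pmf B d (f j)) (curry g j))"
      using A 1 by (intro pmf_Pi') auto
    also have "\<dots> = (\<Prod>j\<in>A. \<Prod>e\<in>B. pmf (f j e) (g (j, e)))"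
      using B 1 by (intro prod.cong refl) (subst pmf_Pi', auto)
    also have "\<dots> = (\<Prod>x\<in>A \<times> B. pmf (case x of (j, e) \<Rightarrow> f j e) (g x))"
      by (simp add: prod.cartesian_product case_prod_unfold)
    also have "\<dots> = pmf (Pi_pmf (A \<times> B) d (\<lambda>(j, e). f j e)) g"
      using A B True by (intro pmf_Pi'[symmetric]) auto
    finally show ?thesis .
  next
    case False
    then obtain j e where je: "(j, e) \<notin> A \<times> B" "g (j, e) \<noteq> d" by auto
    have rhs: "pmf (Pi_pmf (A \<times> B) d (\<lambda>(j, e). f j e)) g = 0"
      using je A B by (intro pmf_Pi_outside) auto
    have "pmf (Pi_pmf A (\<lambda>_. d) (\<lambda>j. Pi_pmf B d (f j))) (curry g) = 0"
    proof (cases "j \<in> A")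
      case True
      then have "e \<notin> B" using je by auto
      then have "pmf (Pi_pmf B d (f j)) (curry g j) = 0"
        using je B by (intro pmf_Pi_outside) auto
      then have "(\<Prod>j\<in>A. pmf (Pi_pmf B d (f j)) (curry g j)) = 0"
        using True A by (intro prod_zero) auto
      then show ?thesis using A by (simp add: pmf_Pi)
    next
      case False
      then have "curry g j \<noteq> (\<lambda>_. d)" using je by (auto simp: curry_def fun_eq_iff)
      then show ?thesis using A False by (intro pmf_Pi_outside) auto
    qed
    then show ?thesis using rhs by simp
  qed
  finally show "pmf (map_pmf case_prod (Pi_pmf A (\<lambda>_. d) (\<lambda>j. Pi_pmf B d (f j)))) g
      = pmf (Pi_pmf (A \<times> B) d (\<lambda>(j, e). f j e)) g" .
qed

lemma hidden_null_erdos_renyi: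
  "hidden_null M (erdos_renyi n p) = Pi_pmf ({..<M} \<times> edges n) False (\<lambda>_. bernoulli_pmf p)"
  unfolding hidden_null_def erdos_renyi_def
  by (subst map_case_prod_Pi_pmf) (auto simp: case_prod_unfold)

lemma chi_empty [simp]: "chi p {} = (\<lambda>_. 1)"
  by (simp add: chi_def fun_eq_iff)

lemma chi_section:
  fixes M :: nat
  assumes S: "S \<subseteq> {..<M} \<times> E" and E: "finite E"
  shows "chi p S (case_prod h) = (\<Prod>j<M. chi p {e. (j, e) \<in> S} (h j))"
proof -
  let ?f = "\<lambda>j e. (of_bool (h j e) - p) / sqrt (p * (1 - p))"
  have eq: "S = Sigma {..<M} (\<lambda>j. {e. (j, e) \<in> S})" using S by auto
  have fin: "finite {e. (j, e) \<in> S}" for j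
    using S by (intro finite_subset[OF _ E]) auto
  have "chi p S (case_prod h) = (\<Prod>x\<in>S. ?f (fst x) (snd x))"
    unfolding chi_def by (simp add: case_prod_unfold)
  also have "\<dots> = (\<Prod>x\<in>Sigma {..<M} (\<lambda>j. {e. (j, e) \<in> S}). ?f (fst x) (snd x))"
    using eq by simp
  also have "\<dots> = (\<Prod>j<M. \<Prod>e\<in>{e. (j, e) \<in> S}. ?f j e)"
    using fin by (subst prod.Sigma) (auto simp: case_prod_unfold)
  finally show ?thesis by (simp add: chi_def)
qed

text \<open>Characters factor over the samples, and nontrivial ones have mean 0 under the null law.
  Given \<kappa>, a character therefore survives only if all its indices lie in sample
  \<kappa>.\<close>

lemma expectation_chi_hidden_planted:
  fixes P :: "('i \<Rightarrow> bool) pmf"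
  assumes M: "0 < M" and E: "finite E" and p: "0 < p" "p < 1"
    and P: "finite (set_pmf P)" and Q: "Q = Pi_pmf E False (\<lambda>_. bernoulli_pmf p)"
    and S: "S \<subseteq> {..<M} \<times> E"
  shows "measure_pmf.expectation (hidden_planted M P Q) (chi p S) =
    (\<Sum>\<kappa><M. measure_pmf.expectation P (chi p {e. (\<kappa>, e) \<in> S}) *
       of_bool (\<forall>j<M. j \<noteq> \<kappa> \<longrightarrow> {e. (j, e) \<in> S} = {})) / M"
proof -
  let ?L = "\<lambda>\<kappa>. Pi_pmf {..<M} (\<lambda>_. False) (\<lambda>j. if j = \<kappa> then P else Q)"
  let ?s = "\<lambda>j. {e. (j, e) \<in> S}"
  have ne: "{..<M} \<noteq> {}" using M by auto
  have finQ: "finite (set_pmf Q)" using E by (simp add: Q)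
  have finL: "finite (set_pmf (?L \<kappa>))" for \<kappa>
    using P finQ by (intro finite_set_Pi_pmf) auto
  have EQ: "measure_pmf.expectation Q (chi p (?s j)) = of_bool (?s j = {})" for j
  proof -
    have "?s j \<subseteq> E" using S by auto
    then have "measure_pmf.expectation Q (\<lambda>y. chi p (?s j) y * chi p {} y) = of_bool (?s j = {})"
      unfolding Q using E p by (intro chi_orthonormal) auto
    then show ?thesis by simp
  qed
  have L: "measure_pmf.expectation (map_pmf case_prod (?L \<kappa>)) (chi p S) =
      measure_pmf.expectation P (chi p (?s \<kappa>)) * of_bool (\<forall>j<M. j \<noteq> \<kappa> \<longrightarrow> ?s j = {})"
    if \<kappa>: "\<kappa> < M" for \<kappa>
  proof -
    have "measure_pmf.expectation (map_pmf case_prod (?L \<kappa>)) (chi p S)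
        = measure_pmf.expectation (?L \<kappa>) (\<lambda>h. \<Prod>j<M. chi p (?s j) (h j))"
      unfolding integral_map_pmf chi_section[OF S E] ..
    also have "\<dots> = (\<Prod>j<M. measure_pmf.expectation (if j = \<kappa> then P else Q) (chi p (?s j)))"
      using P finQ by (intro expectation_prod_Pi_pmf_finite) auto
    also have "\<dots> = measure_pmf.expectation P (chi p (?s \<kappa>)) *
        (\<Prod>j\<in>{..<M} - {\<kappa>}. measure_pmf.expectation (if j = \<kappa> then P else Q) (chi p (?s j)))"
      using \<kappa> by (subst prod.remove[of _ \<kappa>]) auto
    also have "(\<Prod>j\<in>{..<M} - {\<kappa>}. measure_pmf.expectation (if j = \<kappa> then P else Q) (chi p (?s j)))
        = (\<Prod>j\<in>{..<M} - {\<kappa>}. of_bool (?s j = {}))"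
      by (intro prod.cong refl) (simp add: EQ)
    also have "\<dots> = of_bool (\<forall>j<M. j \<noteq> \<kappa> \<longrightarrow> ?s j = {})"
    proof (cases "\<forall>j<M. j \<noteq> \<kappa> \<longrightarrow> ?s j = {}")
      case False
      then have "\<exists>j\<in>{..<M} - {\<kappa>}. of_bool (?s j = {}) = (0 :: real)" by auto
      then show ?thesis using False by (simp only: prod_zero finite_Diff finite_lessThan of_bool_eq)
    qed auto
    finally show ?thesis .
  qed
  have "hidden_planted M P Q = bind_pmf (pmf_of_set {..<M}) (\<lambda>\<kappa>. map_pmf case_prod (?L \<kappa>))"
    by (simp add: hidden_planted_def)
  then have "measure_pmf.expectation (hidden_planted M P Q) (chi p S) =
      (\<Sum>\<kappa><M. measure_pmf.expectation (map_pmf case_prod (?L \<kappa>)) (chi p S) / real (card {..<M}))"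
    using ne finL by (simp add: pmf_expectation_bind_pmf_of_set divide_inverse mult.commute)
  also have "\<dots> = (\<Sum>\<kappa><M. measure_pmf.expectation (map_pmf case_prod (?L \<kappa>)) (chi p S)) / M"
    by (simp add: sum_divide_distrib)
  finally show ?thesis using L by simp
qed

text \<open>A nonempty set with nonzero coefficient is a copy of some S inside one sample, and
  averaging over \<kappa> scales the coefficient of S by 1 / M. The M copies together contribute M
  times the square of that, that is 1 / M times the original square. The empty set gives the
  1.\<close>

lemma Adv_hidden_le:
  fixes P :: "('i \<Rightarrow> bool) pmf"
  assumes M: "0 < M" and E: "finite E" and p: "0 < p" "p < 1"
    and P: "finite (set_pmf P)" and Q: "Q = Pi_pmf E False (\<lambda>_. bernoulli_pmf p)"
    and A: "(\<Sum>S\<in>small_sets E D. (measure_pmf.expectation P (chi p S))\<^sup>2) \<le> A"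
    and null: "hidden_null M Q = Pi_pmf ({..<M} \<times> E) False (\<lambda>_. bernoulli_pmf p)"
  shows "Adv D ({..<M} \<times> E) (hidden_planted M P Q) (hidden_null M Q) \<le> ereal (sqrt (1 + A / M))"
proof -
  let ?I = "{..<M} \<times> E"
  let ?a = "\<lambda>S. measure_pmf.expectation P (chi p S)"
  let ?b = "\<lambda>S. measure_pmf.expectation (hidden_planted M P Q) (chi p S)"
  let ?img = "(\<lambda>(\<kappa>, S). {\<kappa>} \<times> S) ` ({..<M} \<times> (small_sets E D - {{}}))"
  have finI: "finite ?I" using E by simp
  have finS: "finite (small_sets ?I D)" using finI by simp
  have b: "?b S = (\<Sum>\<kappa><M. ?a {e. (\<kappa>, e) \<in> S} * of_bool (\<forall>j<M. j \<noteq> \<kappa> \<longrightarrow> {e. (j, e) \<in> S} = {})) / M"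
    if "S \<in> small_sets ?I D" for S
    using expectation_chi_hidden_planted[OF M E p P Q, of S] that by (simp add: small_sets_def)
  have b_empty: "?b {} = 1" by simp
  have b_img: "?b ({\<kappa>} \<times> S) = ?a S / M" if "\<kappa> < M" "S \<in> small_sets E D" "S \<noteq> {}" for \<kappa> S
  proof -
    have "{\<kappa>} \<times> S \<subseteq> ?I" using that by (auto simp: small_sets_def)
    then have "?b ({\<kappa>} \<times> S) = (\<Sum>k<M. ?a {e. (k, e) \<in> {\<kappa>} \<times> S} *
        of_bool (\<forall>j<M. j \<noteq> k \<longrightarrow> {e. (j, e) \<in> {\<kappa>} \<times> S} = {})) / M"
      by (rule expectation_chi_hidden_planted[OF M E p P Q])
    also have "(\<Sum>k<M. ?a {e. (k, e) \<in> {\<kappa>} \<times> S} *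
        of_bool (\<forall>j<M. j \<noteq> k \<longrightarrow> {e. (j, e) \<in> {\<kappa>} \<times> S} = {})) = (\<Sum>k<M. if k = \<kappa> then ?a S else 0)"
      using that by (intro sum.cong) auto
    also have "\<dots> = ?a S" using that by simp
    finally show ?thesis .
  qed
  have b_zero: "?b S = 0" if S: "S \<in> small_sets ?I D - ({{}} \<union> ?img)" for S
  proof -
    have "\<not> (\<forall>j<M. j \<noteq> \<kappa> \<longrightarrow> {e. (j, e) \<in> S} = {})" if "\<kappa> < M" for \<kappa>
    proof
      assume *: "\<forall>j<M. j \<noteq> \<kappa> \<longrightarrow> {e. (j, e) \<in> S} = {}"
      have sub: "S \<subseteq> ?I" "card S \<le> D" "S \<noteq> {}" using S by (auto simp: small_sets_def)
      then have eq: "S = {\<kappa>} \<times> {e. (\<kappa>, e) \<in> S}" using * by fastforce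
      have "card S = card {e. (\<kappa>, e) \<in> S}"
        by (subst eq) (simp add: card_cartesian_product)
      then have "{e. (\<kappa>, e) \<in> S} \<in> small_sets E D - {{}}"
        using sub eq by (auto simp: small_sets_def)
      then have "S \<in> ?img" using eq \<open>\<kappa> < M\<close> by (intro image_eqI[of _ _ "(\<kappa>, {e. (\<kappa>, e) \<in> S})"]) auto
      then show False using S by blast
    qed
    then have "(\<Sum>\<kappa><M. ?a {e. (\<kappa>, e) \<in> S} * of_bool (\<forall>j<M. j \<noteq> \<kappa> \<longrightarrow> {e. (j, e) \<in> S} = {})) = 0"
      by (intro sum.neutral) auto
    moreover have "S \<in> small_sets ?I D" using S by blast
    ultimately show ?thesis using b by simp
  qed
  have inj: "inj_on (\<lambda>(\<kappa>, S). {\<kappa>} \<times> S) ({..<M} \<times> (small_sets E D - {{}}))"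
    by (auto simp: inj_on_def times_eq_iff)
  have fin_img: "finite ?img" using E by simp
  have "(\<Sum>S\<in>small_sets ?I D. (?b S)\<^sup>2) = (\<Sum>S\<in>small_sets ?I D \<inter> ({{}} \<union> ?img). (?b S)\<^sup>2)"
    using finS b_zero by (intro sum.mono_neutral_right) auto
  also have "\<dots> \<le> (\<Sum>S\<in>{{}} \<union> ?img. (?b S)\<^sup>2)"
    using fin_img by (intro sum_mono2) auto
  also have "\<dots> = (?b {})\<^sup>2 + (\<Sum>S\<in>?img. (?b S)\<^sup>2)"
    using fin_img by (subst sum.union_disjoint) (auto simp: small_sets_def)
  also have "(\<Sum>S\<in>?img. (?b S)\<^sup>2) = (\<Sum>(\<kappa>, S)\<in>{..<M} \<times> (small_sets E D - {{}}). (?a S / M)\<^sup>2)"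
  proof -
    have "(?b (case x of (\<kappa>, S) \<Rightarrow> {\<kappa>} \<times> S))\<^sup>2 = (case x of (\<kappa>, S) \<Rightarrow> (?a S / M)\<^sup>2)"
      if "x \<in> {..<M} \<times> (small_sets E D - {{}})" for x
      using that b_img[of "fst x" "snd x"] by (cases x) simp
    then show ?thesis by (subst sum.reindex[OF inj]) (simp only: o_apply cong: sum.cong)
  qed
  also have "\<dots> = M * (\<Sum>S\<in>small_sets E D - {{}}. (?a S / M)\<^sup>2)"
    by (simp add: sum.cartesian_product[symmetric])
  also have "\<dots> = (\<Sum>S\<in>small_sets E D - {{}}. (?a S)\<^sup>2) / M"
    using M by (simp add: power_divide sum_divide_distrib[symmetric] power2_eq_square)
  also have "\<dots> \<le> A / M"
  proof -
    have "(\<Sum>S\<in>small_sets E D - {{}}. (?a S)\<^sup>2) \<le> (\<Sum>S\<in>small_sets E D. (?a S)\<^sup>2)"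
      using E by (intro sum_mono2) auto
    then show ?thesis using A by (intro divide_right_mono) auto
  qed
  finally have le: "(\<Sum>S\<in>small_sets ?I D. (?b S)\<^sup>2) \<le> 1 + A / M" using b_empty by simp
  have finP: "finite (set_pmf (hidden_planted M P Q))"
  proof -
    have "finite (set_pmf Q)" using E by (simp add: Q)
    moreover have "{..<M} \<noteq> {}" using M by auto
    ultimately show ?thesis using P
      unfolding hidden_planted_def by (auto intro!: finite_set_Pi_pmf)
  qed
  have "Adv D ?I (hidden_planted M P Q) (hidden_null M Q)
      \<le> ereal (sqrt (\<Sum>S\<in>small_sets ?I D. (?b S)\<^sup>2))"
    unfolding null by (rule Adv_le[OF finI p finP])
  also have "\<dots> \<le> ereal (sqrt (1 + A / M))" using le by simp
  finally show ?thesis .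
qed


section \<open>Advantage of the planted dense subgraph\<close>

lemma bernoulli_conj:
  assumes "\<rho> \<in> {0..1}"
  shows "map_pmf (\<lambda>(a, b). a \<and> b) (pair_pmf (bernoulli_pmf \<rho>) (bernoulli_pmf \<rho>)) = bernoulli_pmf (\<rho>\<^sup>2)"
proof (rule pmf_eqI)
  fix x
  have "\<rho>\<^sup>2 \<in> {0..1}" using assms by (auto simp: power_le_one)
  then show "pmf (map_pmf (\<lambda>(a, b). a \<and> b) (pair_pmf (bernoulli_pmf \<rho>) (bernoulli_pmf \<rho>))) x
      = pmf (bernoulli_pmf (\<rho>\<^sup>2)) x"
    using assms by (cases x)
      (simp_all add: pair_pmf_def map_bind_pmf bind_return_pmf bind_assoc_pmf pmf_bind power2_eq_square
        measure_pmf_single algebra_simps)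
qed

text \<open>Given \<theta> the edges are independent, and a normalised edge has mean
  \<open>snr h0 h1\<close> if planted and 0 otherwise.\<close>

lemma pds_fourier_coefficient:
  assumes h: "0 < h0" "h0 < 1" "h0 \<le> h1" "h1 \<le> 1" and S: "S \<subseteq> edges n"
  shows "measure_pmf.expectation (pds n h0 h1 \<rho>) (chi h0 S) =
    snr h0 h1 ^ card S * measure_pmf.prob (Pi_pmf {..<n} False (\<lambda>_. bernoulli_pmf \<rho>)) {\<theta>. S \<subseteq> planted_edges n \<theta>}"
proof -
  let ?T = "Pi_pmf {..<n} False (\<lambda>_. bernoulli_pmf \<rho>)"
  have fin: "finite S" using S finite_edges finite_subset by blast
  have "measure_pmf.expectation (pds n h0 h1 \<rho>) (chi h0 S) = measure_pmf.expectation ?T (\<lambda>\<theta>.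
      measure_pmf.expectation (Pi_pmf (edges n) False (\<lambda>e. bernoulli_pmf (edge_prob h0 h1 \<theta> e))) (chi h0 S))"
  proof -
    have "measure_pmf.expectation (pds n h0 h1 \<rho>) (chi h0 S) = (\<Sum>\<theta>\<in>set_pmf ?T. pmf ?T \<theta> *\<^sub>R
      measure_pmf.expectation (Pi_pmf (edges n) False (\<lambda>e. bernoulli_pmf (edge_prob h0 h1 \<theta> e))) (chi h0 S))"
      unfolding pds_bind by (rule pmf_expectation_bind) auto
    also have "\<dots> = measure_pmf.expectation ?T (\<lambda>\<theta>.
      measure_pmf.expectation (Pi_pmf (edges n) False (\<lambda>e. bernoulli_pmf (edge_prob h0 h1 \<theta> e))) (chi h0 S))"
      by (subst integral_measure_pmf_real[of "set_pmf ?T"]) (auto simp: mult.commute)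
    finally show ?thesis .
  qed
  also have "\<dots> = measure_pmf.expectation ?T (\<lambda>\<theta>. snr h0 h1 ^ card S * indicator {\<theta>. S \<subseteq> planted_edges n \<theta>} \<theta>)"
  proof (rule Bochner_Integration.integral_cong[OF refl])
    fix \<theta>
    have "measure_pmf.expectation (Pi_pmf (edges n) False (\<lambda>e. bernoulli_pmf (edge_prob h0 h1 \<theta> e))) (chi h0 S)
        = (\<Prod>e\<in>S. (edge_prob h0 h1 \<theta> e - h0) / sqrt (h0 * (1 - h0)))"
      using h by (intro expectation_chi[OF finite_edges S]) (auto simp: edge_prob_def)
    also have "\<dots> = (\<Prod>e\<in>S. snr h0 h1 * of_bool (e \<in> planted_edges n \<theta>))"
      using S by (intro prod.cong refl) (auto simp: edge_prob_def snr_def planted_edges_def)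
    also have "\<dots> = snr h0 h1 ^ card S * (\<Prod>e\<in>S. of_bool (e \<in> planted_edges n \<theta>))"
      by (simp add: prod.distrib)
    also have "(\<Prod>e\<in>S. of_bool (e \<in> planted_edges n \<theta>)) = (indicator {\<theta>. S \<subseteq> planted_edges n \<theta>} \<theta> :: real)"
    proof (cases "S \<subseteq> planted_edges n \<theta>")
      case False
      then have "\<exists>e\<in>S. of_bool (e \<in> planted_edges n \<theta>) = (0 :: real)" by auto
      then show ?thesis using False fin by (simp add: prod_zero)
    qed (auto intro!: prod.neutral)
    finally show "measure_pmf.expectation (Pi_pmf (edges n) False (\<lambda>e. bernoulli_pmf (edge_prob h0 h1 \<theta> e))) (chi h0 S)
      = snr h0 h1 ^ card S * indicator {\<theta>. S \<subseteq> planted_edges n \<theta>} \<theta>" .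
  qed
  finally show ?thesis by simp
qed

lemma prob_planted_edges_square:
  assumes \<rho>: "\<rho> \<in> {0..1}"
  shows "(measure_pmf.prob (Pi_pmf {..<n} False (\<lambda>_. bernoulli_pmf \<rho>)) {\<theta>. S \<subseteq> planted_edges n \<theta>})\<^sup>2 =
    measure_pmf.prob (Pi_pmf {..<n} False (\<lambda>_. bernoulli_pmf (\<rho>\<^sup>2))) {\<theta>. S \<subseteq> planted_edges n \<theta>}"
proof -
  let ?T = "Pi_pmf {..<n} False (\<lambda>_. bernoulli_pmf \<rho>)" and ?A = "{\<theta>. S \<subseteq> planted_edges n \<theta>}"
  let ?P = "Pi_pmf {..<n} (False, False) (\<lambda>_. pair_pmf (bernoulli_pmf \<rho>) (bernoulli_pmf \<rho>))"
  have "(measure_pmf.prob ?T ?A)\<^sup>2 = measure_pmf.expectation (pair_pmf ?T ?T) (\<lambda>(a, b). indicator ?A a * indicator ?A b)"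
    by (subst expectation_pair_mult) (auto simp: power2_eq_square)
  also have "\<dots> = measure_pmf.expectation ?P (\<lambda>h. indicator ?A (fst \<circ> h) * indicator ?A (snd \<circ> h))"
    unfolding pair_Pi_pmf[OF finite_lessThan] integral_map_pmf by simp
  also have "\<dots> = measure_pmf.expectation ?P (\<lambda>h. indicator ?A ((\<lambda>(a, b). a \<and> b) \<circ> h))"
    by (intro Bochner_Integration.integral_cong refl)
      (auto simp: indicator_def planted_edges_def case_prod_unfold)
  also have "\<dots> = measure_pmf.expectation (map_pmf (\<lambda>h. (\<lambda>(a, b). a \<and> b) \<circ> h) ?P) (indicator ?A)"
    by (rule integral_map_pmf[symmetric])
  also have "map_pmf (\<lambda>h. (\<lambda>(a, b). a \<and> b) \<circ> h) ?P
      = Pi_pmf {..<n} False (\<lambda>_. map_pmf (\<lambda>(a, b). a \<and> b) (pair_pmf (bernoulli_pmf \<rho>) (bernoulli_pmf \<rho>)))"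
    by (rule Pi_pmf_map[symmetric]) auto
  finally show ?thesis unfolding bernoulli_conj[OF \<rho>] by simp
qed

lemma sum_choose_le_exp:
  fixes x :: real
  assumes "0 \<le> x"
  shows "(\<Sum>k\<le>D. real (N choose k) * x ^ k) \<le> exp (x * N)"
proof -
  have "(\<Sum>k\<le>D. real (N choose k) * x ^ k) \<le> (\<Sum>k\<le>max D N. real (N choose k) * x ^ k)"
    using assms by (intro sum_mono2) auto
  also have "\<dots> = (\<Sum>k\<le>N. real (N choose k) * x ^ k)"
    by (intro sum.mono_neutral_right) (auto simp: binomial_eq_0)
  also have "\<dots> = (x + 1) ^ N" by (simp add: binomial_ring)
  also have "\<dots> \<le> exp x ^ N"
    using assms exp_ge_add_one_self[of x] by (intro power_mono) (auto simp: add.commute)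
  also have "\<dots> = exp (x * N)" by (rule exp_of_nat2_mult[symmetric])
  finally show ?thesis .
qed

text \<open>The bound that exploits the truncation at degree D, for communities so large that the
  exponential bound is too weak.\<close>

lemma sum_choose_le_power: "(\<Sum>k\<le>D. N choose k) \<le> (N + 1) ^ D"
proof -
  have "(\<Sum>k\<le>D. N choose k) \<le> (\<Sum>k\<le>D. (D choose k) * N ^ k)"
  proof (rule sum_mono)
    fix k assume "k \<in> {..D}"
    then have "1 \<le> D choose k" by (simp add: Suc_leI)
    moreover have "N choose k \<le> N ^ k"
      by (cases "k \<le> N") (auto simp: binomial_le_pow binomial_eq_0)
    ultimately show "N choose k \<le> (D choose k) * N ^ k"
      by (metis le_trans mult_le_mono1 nat_mult_1)
  qed
  also have "\<dots> = (N + 1) ^ D" using binomial_ring[of N 1 D] by simp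
  finally show ?thesis .
qed

lemma double_card_planted_edges_le: "2 * card (planted_edges n \<theta>) \<le> (planted_card n \<theta>)\<^sup>2"
proof -
  let ?T = "{i. i < n \<and> \<theta> i}" and ?W = "planted_edges n \<theta>"
  have fin: "finite ?W" by (rule finite_subset[OF planted_edges_subset finite_edges])
  have "card (?W \<union> prod.swap ` ?W) \<le> card (?T \<times> ?T)"
    by (intro card_mono) (auto simp: planted_edges_def edges_def)
  moreover have "card (?W \<union> prod.swap ` ?W) = card ?W + card (prod.swap ` ?W)"
    using fin by (intro card_Un_disjoint) (auto simp: planted_edges_def edges_def)
  moreover have "card (prod.swap ` ?W) = card ?W" by (intro card_image) (auto simp: inj_on_def)
  ultimately show ?thesis by (simp add: planted_card_def power2_eq_square)
qed

text \<open>
  Writing the squared advantage with two replicas of \<open>\<theta>\<close>, only their intersection matters; it is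
  again a product of Bernoulli variables, with parameter \<open>\<rho>\<^sup>2\<close>.
\<close>

lemma pds_advantage_le:
  assumes h: "0 < h0" "h0 < 1" "h0 \<le> h1" "h1 \<le> 1" and \<rho>: "\<rho> \<in> {0..1}" and n: "2 \<le> n"
    and deg: "\<And>u::nat. u \<le> n \<Longrightarrow>
      (snr h0 h1)\<^sup>2 * real u \<le> 2 \<or> (snr h0 h1)\<^sup>2 \<le> 1 \<and> 2 * real D * ln (real n) \<le> real u"
  shows "(\<Sum>S\<in>small_sets (edges n) D. (measure_pmf.expectation (pds n h0 h1 \<rho>) (chi h0 S))\<^sup>2)
    \<le> exp (32 * (snr h0 h1)\<^sup>2 * \<rho> ^ 4 * n\<^sup>2) + 1"
proof -
  let ?x = "(snr h0 h1)\<^sup>2" and ?T = "Pi_pmf {..<n} False (\<lambda>_. bernoulli_pmf (\<rho>\<^sup>2))"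
  let ?k = "\<lambda>\<theta>. real (planted_card n \<theta>)"
  define G where "G N = (\<Sum>k\<le>D. real (N choose k) * ?x ^ k)" for N
  \<comment> \<open>Cut-off for the intersection of the replicas. Below it the quadratic bound gives
    exp (x m^2 / 2). Above it exp k <= exp (2 k - m), whose expectation is at most 1 because (exp 2
    - 1) \<rho>^2 n <= m.\<close>
  define m where "m = 8 * (\<rho>\<^sup>2 * n)"
  have fin: "finite (small_sets (edges n) D)" by simp
  have \<rho>2: "\<rho>\<^sup>2 \<in> {0..1}" using \<rho> by (auto simp: power_le_one)
  have int: "integrable (measure_pmf ?T) f" for f :: "_ \<Rightarrow> real"
    by (intro integrable_measure_pmf_finite) simp
  have "(\<Sum>S\<in>small_sets (edges n) D. (measure_pmf.expectation (pds n h0 h1 \<rho>) (chi h0 S))\<^sup>2)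
      = (\<Sum>S\<in>small_sets (edges n) D. ?x ^ card S * measure_pmf.prob ?T {\<theta>. S \<subseteq> planted_edges n \<theta>})"
  proof (rule sum.cong[OF refl])
    fix S assume "S \<in> small_sets (edges n) D"
    then have S: "S \<subseteq> edges n" by (simp add: small_sets_def)
    show "(measure_pmf.expectation (pds n h0 h1 \<rho>) (chi h0 S))\<^sup>2
        = ?x ^ card S * measure_pmf.prob ?T {\<theta>. S \<subseteq> planted_edges n \<theta>}"
      unfolding pds_fourier_coefficient[OF h S] prob_planted_edges_square[OF \<rho>, symmetric] power_mult_distrib
      by (simp only: power_even_eq[symmetric] power_mult[symmetric] mult.commute)
  qed
  also have "\<dots> = measure_pmf.expectation ?T
      (\<lambda>\<theta>. \<Sum>S\<in>small_sets (edges n) D. ?x ^ card S * indicator {\<theta>. S \<subseteq> planted_edges n \<theta>} \<theta>)"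
    using int by (subst Bochner_Integration.integral_sum) auto
  also have "\<dots> = measure_pmf.expectation ?T (\<lambda>\<theta>. G (card (planted_edges n \<theta>)))"
  proof (rule Bochner_Integration.integral_cong[OF refl])
    fix \<theta>
    let ?W = "planted_edges n \<theta>"
    have finW: "finite ?W" by (rule finite_subset[OF planted_edges_subset finite_edges])
    have "(\<Sum>S\<in>small_sets (edges n) D. ?x ^ card S * indicator {\<theta>. S \<subseteq> planted_edges n \<theta>} \<theta>)
        = (\<Sum>S\<in>small_sets ?W D. ?x ^ card S)"
      using fin planted_edges_subset[of n \<theta>]
      by (intro sum.mono_neutral_cong_right) (auto simp: small_sets_def indicator_def)
    also have "small_sets ?W D = (\<Union>k\<in>{..D}. {S. S \<subseteq> ?W \<and> card S = k})"
      by (auto simp: small_sets_def)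
    also have "(\<Sum>S\<in>\<dots>. ?x ^ card S) = (\<Sum>k\<le>D. \<Sum>S\<in>{S. S \<subseteq> ?W \<and> card S = k}. ?x ^ card S)"
      using finW by (intro sum.UNION_disjoint) auto
    also have "\<dots> = (\<Sum>k\<le>D. real (card ?W choose k) * ?x ^ k)"
    proof (rule sum.cong[OF refl])
      fix k
      have "(\<Sum>S\<in>{S. S \<subseteq> ?W \<and> card S = k}. ?x ^ card S) = (\<Sum>S\<in>{S. S \<subseteq> ?W \<and> card S = k}. ?x ^ k)"
        by (intro sum.cong) auto
      then show "(\<Sum>S\<in>{S. S \<subseteq> ?W \<and> card S = k}. ?x ^ card S) = real (card ?W choose k) * ?x ^ k"
        using n_subsets[OF finW, of k] by simp
    qed
    finally show "(\<Sum>S\<in>small_sets (edges n) D. ?x ^ card S * indicator {\<theta>. S \<subseteq> planted_edges n \<theta>} \<theta>)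
        = G (card ?W)" by (simp add: G_def)
  qed
  also have "\<dots> \<le> measure_pmf.expectation ?T (\<lambda>\<theta>. exp (?x * m\<^sup>2 / 2) + exp (- m) * exp (2 * ?k \<theta>))"
  proof (rule integral_mono[OF int int])
    fix \<theta>
    let ?N = "card (planted_edges n \<theta>)"
    have N: "2 * real ?N \<le> (?k \<theta>)\<^sup>2"
      using double_card_planted_edges_le[of n \<theta>] by (metis of_nat_le_iff of_nat_mult of_nat_numeral of_nat_power)
    have G_exp: "G ?N \<le> exp (?x * (?k \<theta>)\<^sup>2 / 2)"
    proof -
      have "G ?N \<le> exp (?x * ?N)" unfolding G_def by (rule sum_choose_le_exp) simp
      also have "?x * real ?N \<le> ?x * ((?k \<theta>)\<^sup>2 / 2)" using N by (intro mult_left_mono) auto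
      finally show ?thesis by simp
    qed
    have k_le: "planted_card n \<theta> \<le> n"
    proof -
      have "card {i. i < n \<and> \<theta> i} \<le> card {..<n}" by (intro card_mono) auto
      then show ?thesis by (simp add: planted_card_def)
    qed
    \<comment> \<open>If x k <= 2, the quadratic exponent x k^2 / 2 is at most k. Otherwise the
      degree is small compared with k, and the count n^(2 D) of small edge sets is at most exp
      k.\<close>
    have G_lin: "G ?N \<le> exp (?k \<theta>)"
      using deg[OF k_le]
    proof
      assume "?x * ?k \<theta> \<le> 2"
      then have "?x * ?k \<theta> * (?k \<theta> / 2) \<le> 2 * (?k \<theta> / 2)" by (rule mult_right_mono) simp
      then have "exp (?x * (?k \<theta>)\<^sup>2 / 2) \<le> exp (?k \<theta>)" by (simp add: power2_eq_square)
      with G_exp show ?thesis by linarith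
    next
      assume *: "?x \<le> 1 \<and> 2 * real D * ln (real n) \<le> ?k \<theta>"
      have "G ?N \<le> (\<Sum>k\<le>D. real (?N choose k))"
        unfolding G_def using * by (intro sum_mono) (auto intro: mult_left_le simp: power_le_one)
      also have "\<dots> \<le> (real ?N + 1) ^ D"
      proof -
        have "real (\<Sum>k\<le>D. ?N choose k) \<le> real ((?N + 1) ^ D)"
          using sum_choose_le_power by (rule of_nat_mono)
        then show ?thesis by (simp add: add.commute)
      qed
      also have "\<dots> \<le> ((real n)\<^sup>2) ^ D"
      proof (rule power_mono)
        have "(?k \<theta>)\<^sup>2 \<le> (real n)\<^sup>2" using k_le by (intro power_mono) auto
        moreover have "4 \<le> (real n)\<^sup>2" using power_mono[of 2 "real n" 2] n by simp
        ultimately show "real ?N + 1 \<le> (real n)\<^sup>2" using N by linarith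
      qed simp
      also have "\<dots> = exp (2 * real D * ln (real n))"
      proof -
        have "2 * real D * ln (real n) = real (2 * D) * ln (real n)" by simp
        then show ?thesis using n by (simp only: exp_of_nat_mult power_mult) simp
      qed
      also have "\<dots> \<le> exp (?k \<theta>)" using * by simp
      finally show ?thesis .
    qed
    show "G ?N \<le> exp (?x * m\<^sup>2 / 2) + exp (- m) * exp (2 * ?k \<theta>)"
    proof (cases "?k \<theta> \<le> m")
      case True
      then have "?x * (?k \<theta>)\<^sup>2 / 2 \<le> ?x * m\<^sup>2 / 2"
        by (intro divide_right_mono mult_left_mono power_mono) auto
      then have "exp (?x * (?k \<theta>)\<^sup>2 / 2) \<le> exp (?x * m\<^sup>2 / 2)" by simp
      moreover have "0 \<le> exp (- m) * exp (2 * ?k \<theta>)" by simp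
      ultimately show ?thesis using G_exp by linarith
    next
      case False
      then have "exp (?k \<theta>) \<le> exp (- m + 2 * ?k \<theta>)" by simp
      then have "exp (?k \<theta>) \<le> exp (- m) * exp (2 * ?k \<theta>)" by (simp only: exp_add)
      moreover have "0 \<le> exp (?x * m\<^sup>2 / 2)" by simp
      ultimately show ?thesis using G_lin by linarith
    qed
  qed
  also have "\<dots> = exp (?x * m\<^sup>2 / 2) + exp (- m) * measure_pmf.expectation ?T (\<lambda>\<theta>. exp (2 * ?k \<theta>))"
    using int by (subst Bochner_Integration.integral_add) auto
  also have "\<dots> \<le> exp (?x * m\<^sup>2 / 2) + exp (- m) * exp m"
  proof -
    have card: "?k \<theta> = (\<Sum>i<n. of_bool (\<theta> i))" for \<theta>
      by (simp add: planted_card_def lessThan_def Int_def conj_commute)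
    have "measure_pmf.expectation ?T (\<lambda>\<theta>. exp (2 * ?k \<theta>)) \<le> exp ((exp 2 - 1) * (\<Sum>i<n. \<rho>\<^sup>2))"
      unfolding card using expectation_exp_sum_bernoulli_le[of "{..<n}" "{..<n}" "\<lambda>_. \<rho>\<^sup>2" 2] \<rho>2 by simp
    also have "(exp 2 - 1) * (\<Sum>i<n. \<rho>\<^sup>2) \<le> 8 * (\<Sum>i<n. \<rho>\<^sup>2)"
    proof (rule mult_right_mono)
      have "exp (2 :: real) = exp 1 * exp 1" by (simp flip: exp_add)
      also have "\<dots> \<le> 3 * 3" using exp_le by (intro mult_mono) auto
      finally show "exp 2 - 1 \<le> (8 :: real)" by simp
    qed (simp add: sum_nonneg)
    finally show ?thesis by (simp add: m_def mult.commute)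
  qed
  also have "\<dots> = exp (32 * ?x * \<rho> ^ 4 * n\<^sup>2) + 1"
    by (simp add: m_def power2_eq_square power4_eq_xxxx algebra_simps flip: exp_add)
  finally show ?thesis .
qed

section \<open>Choice of the parameters\<close>

text \<open>Evaluating an expression takes time at least 1, so every command other than
  \<open>Pass\<close> takes time at least 2.\<close>

lemma exec_time_1: "exec c s k t \<Longrightarrow> k \<le> 1 \<Longrightarrow> t = s"
proof (induction rule: exec.induct)
  case (Store a e f s)
  then show ?case using atime_pos[of e s] by simp
next
  case (Seq c s k t d l u)
  then show ?case using exec_time_pos by fastforce
next
  case (Cond_True b s c k t d)
  then show ?case using atime_pos[of b s] by simp
next
  case (Cond_False b s d k t c)
  then show ?case using atime_pos[of b s] by simp
next
  case (Loop_True b s c k t l u)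
  then show ?case using atime_pos[of b s] by simp
qed auto

text \<open>A program halting after one step leaves the output arrays empty, hence outputs \<open>0 / 0 = 0\<close>.\<close>

lemma recovery_time_ge_2:
  assumes alg: "computes_in_time (edge_addr n) (edges n) r (out_matrix n) X \<tau>"
    and corr: "0 < expected_correlation n p0 p1 \<rho> r X"
  shows "2 \<le> \<tau>"
proof (rule ccontr)
  assume "\<not> 2 \<le> \<tau>"
  then have \<tau>: "\<tau> < 2" by simp
  obtain c where c: "\<forall>y \<omega>. (\<forall>e. y e \<longrightarrow> e \<in> edges n) \<longrightarrow> (\<forall>k. \<omega> k \<longrightarrow> k < r) \<longrightarrow>
      (\<exists>k s. exec c (init_mem (edge_addr n) y \<omega>) k s \<and> real k \<le> \<tau> \<and> out_matrix n s (X y \<omega>))"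
    using alg unfolding computes_in_time_def by (elim exE conjE)
  have zero: "frob_inner n (X y \<omega>) A = 0"
    if y: "\<forall>e. y e \<longrightarrow> e \<in> edges n" and \<omega>: "\<forall>k. \<omega> k \<longrightarrow> k < r" for y \<omega> A
  proof -
    from c[rule_format, OF y[rule_format] \<omega>[rule_format]] obtain k s where
      k: "exec c (init_mem (edge_addr n) y \<omega>) k s" "real k \<le> \<tau>" "out_matrix n s (X y \<omega>)" by blast
    have "k \<le> 1" using k(2) \<tau> by linarith
    then have "s = init_mem (edge_addr n) y \<omega>" using exec_time_1[OF k(1)] by blast
    then have "X y \<omega> i j = 0" if "i < n" "j < n" for i j
      using k(3) that by (simp add: out_matrix_def init_mem_def)
    then show ?thesis by (simp add: frob_inner_def)
  qed
  have "expected_correlation n p0 p1 \<rho> r X =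
      measure_pmf.expectation (pair_pmf (pds_joint n p0 p1 \<rho>) (coins r)) (\<lambda>_. 0)"
    unfolding expected_correlation_def
  proof (rule integral_cong_AE)
    show "AE x in measure_pmf (pair_pmf (pds_joint n p0 p1 \<rho>) (coins r)).
      (case x of (a, b) \<Rightarrow> (case a of (\<theta>, Y) \<Rightarrow> \<lambda>\<omega>. frob_inner n (X Y \<omega>) (signal p0 p1 \<theta>) /
        (frob_norm n (X Y \<omega>) * frob_norm n (signal p0 p1 \<theta>))) b) = 0"
    proof (rule AE_pmfI)
      fix x assume x: "x \<in> set_pmf (pair_pmf (pds_joint n p0 p1 \<rho>) (coins r))"
      obtain \<theta> Y \<omega> where eq: "x = ((\<theta>, Y), \<omega>)" by (metis prod.collapse)
      have "Y \<in> {f. \<forall>e. e \<notin> edges n \<longrightarrow> f e = False}"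
        using x set_Pi_pmf_subset[OF finite_edges[of n]] unfolding eq pds_joint_bind by fastforce
      moreover have "\<omega> \<in> {f. \<forall>k. k \<notin> {..<r} \<longrightarrow> f k = False}"
        using x set_Pi_pmf_subset[OF finite_lessThan[of r]] unfolding eq coins_def by fastforce
      ultimately have "frob_inner n (X Y \<omega>) (signal p0 p1 \<theta>) = 0" by (intro zero) auto
      then show "(case x of (a, b) \<Rightarrow> (case a of (\<theta>, Y) \<Rightarrow> \<lambda>\<omega>. frob_inner n (X Y \<omega>) (signal p0 p1 \<theta>) /
        (frob_norm n (X Y \<omega>) * frob_norm n (signal p0 p1 \<theta>))) b) = 0" by (simp add: eq)
    qed
  qed auto
  then show False using corr by simp
qed

lemma snr_square: "0 \<le> p0 \<Longrightarrow> p0 \<le> 1 \<Longrightarrow> (snr p0 p1)\<^sup>2 = (p1 - p0)\<^sup>2 / (p0 * (1 - p0))"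
  by (simp add: snr_def power_divide)

text \<open>
  All inequalities at a fixed large \<open>n\<close>.  The base pair of the hidden informative sample problem
  has parameters \<open>h0 = 2 p0\<close> and \<open>h1 = h0 + H\<close>.  The lower bound \<open>H0\<close> on the jump \<open>H\<close> makes the scan
  test powerful even if \<open>p1 - p0\<close> is tiny; it costs nothing, since below \<open>H0\<close> the advantage is bounded
  in every degree.
\<close>

locale regime_at =
  fixes n :: nat and p0 p1 \<rho> \<epsilon> :: real
  assumes eps: "0 < \<epsilon>" "\<epsilon> \<le> 1"
    and ln4: "4 \<le> ln (real n)"
    and p: "0 < p0" "p0 \<le> p1" "p1 \<le> 1 / 64"
    and rho: "0 < \<rho>" "\<rho> \<le> \<epsilon>" "\<rho> * ln (real n) \<le> 1"
    and p0n: "1 \<le> p0 * real n"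
    and rho_big: "(ln (real n))\<^sup>2 \<le> \<rho> * sqrt (real n)"
    and snr_small: "(snr p0 p1)\<^sup>2 * \<rho>\<^sup>2 * real n * (ln (real n))\<^sup>2 \<le> 1"
    and ln_eps: "ln (real n) / sqrt (real n) \<le> \<epsilon>" "2 / (ln (real n))\<^sup>2 \<le> \<epsilon>"
begin

definition "L = ln (real n)"
text \<open>Chosen so that H0^2 R / p0 = L^3. This suffices for the exponent of the test, while the
  contribution L^3 \<rho>^2 to the exponent of the advantage is at most L because \<rho> L <=
  1.\<close>

definition "H0 = sqrt p0 * sqrt (L ^ 3) / (\<rho> * real n)"
definition "H = max (2 * (p1 - p0)) H0"
definition "h0 = 2 * p0"
definition "h1 = 2 * p0 + H"
text \<open>The mask solves the linear equations p = a h + b (1 - h) for both pairs of densities: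
  the slope a - b is \<tau>, and h0 = 2 p0 gives b = p0 (1 - 2 \<tau>). As H is at least 2 (p1 -
  p0), \<tau> is at most 1 / 2; hence b is nonnegative and a stays away from 1, so a fixed fraction
  of the present edges is held out.\<close>

definition "\<tau> = (p1 - p0) / H"
definition "b = p0 * (1 - 2 * \<tau>)"
definition "a = \<tau> + b"
definition "q0 = (1 - a) * h0 / (1 - p0)"
definition "q1 = (1 - a) * h1 / (1 - p1)"
definition "x = (snr h0 h1)\<^sup>2"
definition "R = (\<rho> * real n)\<^sup>2"

lemma n_pos: "0 < real n" "1 < real n"
proof -
  have "n \<noteq> 0" using p0n by (cases "n = 0") auto
  moreover have "n \<noteq> 1" using ln4 by (cases "n = 1") auto
  ultimately show "0 < real n" "1 < real n" by auto
qed

lemma L4: "4 \<le> L" using ln4 by (simp add: L_def)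

lemma H0_pos: "0 < H0"
  unfolding H0_def using p rho n_pos L4 by simp

lemma sqrt_L3: "sqrt (L ^ 3) \<le> L\<^sup>2" "0 \<le> sqrt (L ^ 3)"
proof -
  have "L ^ 3 \<le> L ^ 4" using L4 by (intro power_increasing) auto
  then show "sqrt (L ^ 3) \<le> L\<^sup>2" by (intro real_le_lsqrt) (simp_all flip: power_mult)
  show "0 \<le> sqrt (L ^ 3)" using L4 by simp
qed

lemma H0_le: "H0 \<le> sqrt p0"
proof -
  have "sqrt (L ^ 3) \<le> \<rho> * sqrt (real n)" using sqrt_L3 rho_big by (simp add: L_def)
  also have "\<dots> \<le> \<rho> * real n"
    using rho n_pos by (intro mult_left_mono) (auto simp: sqrt_le_D real_le_lsqrt power2_eq_square)
  finally have "sqrt (L ^ 3) / (\<rho> * real n) \<le> 1" using rho n_pos by simp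
  then have "sqrt p0 * (sqrt (L ^ 3) / (\<rho> * real n)) \<le> sqrt p0 * 1" using p by (intro mult_left_mono) auto
  then show ?thesis by (simp add: H0_def)
qed

lemma H_bounds: "0 < H" "H \<le> 1 / 8" "2 * (p1 - p0) \<le> H" "H0 \<le> H"
proof -
  show "0 < H" "2 * (p1 - p0) \<le> H" "H0 \<le> H" using H0_pos by (auto simp: H_def)
  have "sqrt p0 \<le> sqrt ((1 / 8)\<^sup>2)" using p by (intro real_sqrt_le_mono) (simp add: power2_eq_square)
  then have "sqrt p0 \<le> 1 / 8" by simp
  then have "H0 \<le> 1 / 8" using H0_le by linarith
  moreover have "2 * (p1 - p0) \<le> 1 / 8"
  proof -
    have "p1 - p0 \<le> 1 / 16" using p by simp
    then show ?thesis by simp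
  qed
  ultimately show "H \<le> 1 / 8" unfolding H_def by (rule max.boundedI[rotated])
qed

lemma \<tau>_bounds: "0 \<le> \<tau>" "\<tau> \<le> 1 / 2" "\<tau> * H = p1 - p0"
  using H_bounds p by (auto simp: \<tau>_def divide_le_eq)

lemma ab_bounds: "0 \<le> b" "b \<le> p0" "0 \<le> a" "a \<le> 3 / 4"
proof -
  show b: "0 \<le> b" "b \<le> p0" unfolding b_def using \<tau>_bounds p by (auto simp: mult_left_le)
  show "0 \<le> a" "a \<le> 3 / 4" unfolding a_def using b \<tau>_bounds p by auto
qed

lemma h_bounds: "0 < h0" "h0 < 1" "h0 \<le> h1" "h1 \<le> 1 / 2"
  unfolding h0_def h1_def using p H_bounds by auto

text \<open>A present edge is held out with probability at least 1 / 4, so the held-out edges keep a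
  quarter of the jump H, while their null density remains of order p0.\<close>

lemma q_bounds: "0 \<le> q0" "q0 \<le> 4 * p0" "q0 \<le> 1" "H / 4 \<le> q1 - q0" "q1 \<le> 1"
proof -
  have a: "1 / 4 \<le> 1 - a" "1 - a \<le> 1" using ab_bounds by auto
  show "0 \<le> q0" unfolding q0_def using a p h_bounds by simp
  have "q0 \<le> 1 * h0 / (1 / 2)"
    unfolding q0_def using a p h_bounds by (intro frac_le mult_right_mono) auto
  then show "q0 \<le> 4 * p0" "q0 \<le> 1" using p by (auto simp: h0_def)
  have "q1 \<le> 1 * h1 / (1 / 2)"
    unfolding q1_def using a p h_bounds by (intro frac_le mult_right_mono) auto
  then show "q1 \<le> 1" using h_bounds by simp
  have "(1 - a) * h1 / (1 - p0) \<le> q1"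
    unfolding q1_def using a p h_bounds by (intro divide_left_mono) auto
  moreover have "(1 - a) * h1 / (1 - p0) = q0 + (1 - a) * H / (1 - p0)"
    by (simp add: q0_def h0_def h1_def add_divide_distrib[symmetric] algebra_simps)
  moreover have "1 / 4 * H / 1 \<le> (1 - a) * H / (1 - p0)"
    using a p H_bounds by (intro frac_le mult_right_mono mult_nonneg_nonneg) auto
  ultimately show "H / 4 \<le> q1 - q0" by linarith
qed

lemma channel: "channel a b p0 p1 h0 h1 q0 q1"
proof
  show "a \<in> {0..1}" "b \<in> {0..1}" using ab_bounds p by auto
  show "h0 \<in> {0..1}" "h1 \<in> {0..1}" using h_bounds by auto
  show "q0 \<in> {0..1}" "q1 \<in> {0..1}" using q_bounds H_bounds by auto
  show "p0 = a * h0 + b * (1 - h0)"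
    by (simp add: a_def b_def h0_def algebra_simps)
  have "a * h1 + b * (1 - h1) = p0 + \<tau> * H"
    by (simp add: a_def b_def h1_def algebra_simps)
  then show "p1 = a * h1 + b * (1 - h1)" using \<tau>_bounds by simp
  show "q0 * (1 - p0) = (1 - a) * h0" "q1 * (1 - p1) = (1 - a) * h1"
    using p by (auto simp: q0_def q1_def)
qed

section \<open>Signal of the test against the exponent of the advantage\<close>

lemma x_eq: "x = H\<^sup>2 / (h0 * (1 - h0))"
  unfolding x_def using h_bounds by (subst snr_square) (auto simp: h1_def h0_def)

lemma x_nonneg: "0 \<le> x" by (simp add: x_def)

lemma x_le: "x \<le> H\<^sup>2 / p0"
  unfolding x_eq using p by (intro divide_left_mono) (auto simp: h0_def)

lemma H0_square: "H0\<^sup>2 = p0 * L ^ 3 / R"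
  using p L4 by (simp add: H0_def R_def power_divide power_mult_distrib)

lemma R_pos: "0 < R" using rho n_pos by (simp add: R_def)

lemma jump_snr: "(2 * (p1 - p0))\<^sup>2 / p0 \<le> 4 * (snr p0 p1)\<^sup>2"
proof -
  have "(p1 - p0)\<^sup>2 / p0 \<le> (p1 - p0)\<^sup>2 / (p0 * (1 - p0))"
    using p by (intro divide_left_mono) (auto simp: mult_left_le)
  moreover have "(2 * (p1 - p0))\<^sup>2 / p0 = 4 * ((p1 - p0)\<^sup>2 / p0)"
    unfolding power_mult_distrib by simp
  moreover have "(snr p0 p1)\<^sup>2 = (p1 - p0)\<^sup>2 / (p0 * (1 - p0))"
    using p by (intro snr_square) auto
  ultimately show ?thesis by linarith
qed

lemma x_le_sum: "x \<le> 4 * (snr p0 p1)\<^sup>2 + L ^ 3 / R"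
proof -
  have "H\<^sup>2 \<le> (2 * (p1 - p0))\<^sup>2 + H0\<^sup>2" by (auto simp: H_def max_def)
  then have "H\<^sup>2 / p0 \<le> ((2 * (p1 - p0))\<^sup>2 + H0\<^sup>2) / p0" using p by (intro divide_right_mono) auto
  also have "\<dots> = (2 * (p1 - p0))\<^sup>2 / p0 + L ^ 3 / R"
    using p by (simp add: add_divide_distrib H0_square)
  finally show ?thesis using x_le jump_snr by linarith
qed

text \<open>H R is the order of the expected excess on the community, and H^2 R / p0 the order of
  its square over the variance. The Chernoff exponent is governed by the smaller one, so both must
  dominate L for the factors polynomial in n to be absorbed.\<close>

lemma U2_ge: "L\<^sup>2 \<le> H\<^sup>2 * R / p0"
proof -
  have "L\<^sup>2 \<le> L ^ 3" using L4 by (intro power_increasing) auto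
  also have "L ^ 3 = H0\<^sup>2 * R / p0" using p R_pos by (simp add: H0_square)
  also have "\<dots> \<le> H\<^sup>2 * R / p0"
    using p R_pos H_bounds H0_pos by (intro divide_right_mono mult_right_mono power_mono) auto
  finally show ?thesis .
qed

lemma sqrt_p0n: "1 \<le> sqrt p0 * sqrt (real n)"
  using p0n by (simp flip: real_sqrt_mult)

lemma U1_ge: "L\<^sup>2 \<le> H * R"
proof -
  have "1 \<le> L ^ 3" using L4 by (intro one_le_power) auto
  then have "1 \<le> sqrt (L ^ 3)" by simp
  then have "1 * (1 * L\<^sup>2) \<le> sqrt (L ^ 3) * ((sqrt p0 * sqrt (real n)) * (\<rho> * sqrt (real n)))"
    using sqrt_p0n rho_big L4 by (intro mult_mono) (auto simp: L_def)
  also have "\<dots> = sqrt p0 * sqrt (L ^ 3) * \<rho> * (sqrt (real n))\<^sup>2"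
    by (simp only: power2_eq_square mult.commute mult.left_commute mult.assoc)
  also have "\<dots> = H0 * R"
    using rho n_pos by (simp add: H0_def R_def power2_eq_square)
  also have "\<dots> \<le> H * R" using H_bounds R_pos by (intro mult_right_mono) auto
  finally show ?thesis by simp
qed

text \<open>The advantage involves pairs in the intersection of two communities, about (\<rho>^2
  n)^2 of them, the test pairs inside a single one, about (\<rho> n)^2. The quotient is the small
  factor \<rho>^2.\<close>

lemma V_le_U2: "x * \<rho> ^ 4 * (real n)\<^sup>2 \<le> \<epsilon> * (H\<^sup>2 * R / p0)"
proof -
  have "\<rho>\<^sup>2 \<le> \<rho>" using rho eps by (simp add: power2_eq_square mult_left_le)
  then have \<rho>2: "\<rho>\<^sup>2 \<le> \<epsilon>" using rho by linarith
  have "x * (\<rho> ^ 4 * (real n)\<^sup>2) \<le> H\<^sup>2 / p0 * (\<rho> ^ 4 * (real n)\<^sup>2)"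
    by (rule mult_right_mono[OF x_le]) simp
  also have "\<dots> = \<rho>\<^sup>2 * (H\<^sup>2 * R / p0)"
    by (simp add: R_def power_mult_distrib power4_eq_xxxx power2_eq_square)
  also have "\<dots> \<le> \<epsilon> * (H\<^sup>2 * R / p0)"
    using \<rho>2 p R_pos by (intro mult_right_mono) auto
  finally show ?thesis by (simp add: mult.assoc)
qed

text \<open>This is the factor between V and H R, the exponent when the excess outweighs the
  background. For H = H0 it is small because p0 n >= 1 and \<rho> L <= 1; for H = 2 (p1 - p0) the
  smallness of the signal-to-noise ratio is used as well.\<close>

lemma jump_small: "H * \<rho>\<^sup>2 / p0 \<le> \<epsilon>"
proof -
  have sp: "0 < sqrt p0" "0 < sqrt (real n)" using p n_pos by auto
  have "H0 * \<rho>\<^sup>2 / p0 = sqrt (L ^ 3) * \<rho> / (sqrt p0 * real n)"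
  proof -
    have "p0 = sqrt p0 * sqrt p0" using p by simp
    then have "H0 * \<rho>\<^sup>2 / p0 = sqrt p0 * sqrt (L ^ 3) / (\<rho> * real n) * \<rho>\<^sup>2 / (sqrt p0 * sqrt p0)"
      by (simp add: H0_def)
    also have "\<dots> = sqrt (L ^ 3) * \<rho> / (sqrt p0 * real n)"
      using sp rho n_pos by (simp add: power2_eq_square field_simps)
    finally show ?thesis .
  qed
  also have "\<dots> \<le> (L\<^sup>2 * \<rho>) / (1 * sqrt (real n))"
  proof (rule frac_le)
    show "sqrt (L ^ 3) * \<rho> \<le> L\<^sup>2 * \<rho>" using sqrt_L3 rho by (intro mult_right_mono) auto
    have "sqrt p0 * real n = (sqrt p0 * sqrt (real n)) * sqrt (real n)" by simp
    also have "\<dots> \<ge> 1 * sqrt (real n)" using sqrt_p0n by (intro mult_right_mono) auto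
    finally show "1 * sqrt (real n) \<le> sqrt p0 * real n" .
  qed (use L4 rho sp in auto)
  also have "\<dots> = (\<rho> * L) * L / sqrt (real n)" by (simp add: power2_eq_square)
  also have "\<dots> \<le> 1 * L / sqrt (real n)"
    using rho L4 by (intro divide_right_mono mult_right_mono) (auto simp: L_def)
  also have "\<dots> \<le> \<epsilon>" using ln_eps by (simp add: L_def)
  finally have small0: "H0 * \<rho>\<^sup>2 / p0 \<le> \<epsilon>" .
  have "2 * (p1 - p0) * \<rho>\<^sup>2 / p0 \<le> \<epsilon>"
  proof -
    let ?l = "snr p0 p1"
    have l: "0 \<le> ?l" using p by (simp add: snr_def)
    have d: "p1 - p0 \<le> ?l * sqrt p0"
    proof -
      have "?l * sqrt p0 = (p1 - p0) / sqrt (1 - p0)" using p sp by (simp add: snr_def real_sqrt_mult)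
      also have "\<dots> \<ge> (p1 - p0) / 1" using p by (intro divide_left_mono) auto
      finally show ?thesis by simp
    qed
    have "(?l * \<rho> * sqrt (real n) * L)\<^sup>2 \<le> 1\<^sup>2"
      using snr_small by (simp add: power_mult_distrib L_def)
    then have lr: "?l * \<rho> * sqrt (real n) * L \<le> 1" by (rule power2_le_imp_le) simp
    have "p0 = sqrt p0 * sqrt p0" using p by simp
    then have "2 * (p1 - p0) * \<rho>\<^sup>2 / p0 \<le> 2 * (?l * sqrt p0) * \<rho>\<^sup>2 / (sqrt p0 * sqrt p0)"
      using d p by (auto intro!: divide_right_mono mult_right_mono)
    also have "\<dots> = 2 * ?l * \<rho>\<^sup>2 / sqrt p0"
    proof -
      have "2 * (?l * s) * \<rho>\<^sup>2 / (s * s) = 2 * ?l * \<rho>\<^sup>2 / s" if "s \<noteq> 0" for s :: real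
        using that by simp
      then show ?thesis using sp by (metis less_irrefl)
    qed
    also have "\<dots> = 2 * (?l * \<rho> * sqrt (real n) * L) * (\<rho> * L) / (L\<^sup>2 * (sqrt p0 * sqrt (real n)))"
      using sp L4 by (simp add: power2_eq_square field_simps)
    also have "\<dots> \<le> 2 * 1 * 1 / (L\<^sup>2 * 1)"
      using lr rho sqrt_p0n L4 l by (intro frac_le mult_mono mult_left_mono) (auto simp: L_def)
    also have "\<dots> \<le> \<epsilon>" using ln_eps by (simp add: L_def)
    finally show ?thesis .
  qed
  with small0 show ?thesis unfolding H_def by (auto simp: max_def)
qed

lemma V_le_U1: "x * \<rho> ^ 4 * (real n)\<^sup>2 \<le> \<epsilon> * (H * R)"
proof -
  have "x * (\<rho> ^ 4 * (real n)\<^sup>2) \<le> H\<^sup>2 / p0 * (\<rho> ^ 4 * (real n)\<^sup>2)"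
    by (rule mult_right_mono[OF x_le]) simp
  also have "\<dots> = (H * \<rho>\<^sup>2 / p0) * (H * R)"
    by (simp add: R_def power_mult_distrib power4_eq_xxxx power2_eq_square)
  also have "\<dots> \<le> \<epsilon> * (H * R)"
    using jump_small H_bounds R_pos by (intro mult_right_mono) auto
  finally show ?thesis by (simp add: mult.assoc)
qed

text \<open>With l the squared signal-to-noise ratio, the square of l \<rho>^2 n L^2 <= 1 reads l
  \<rho>^4 n^2 <= 1 / (l L^4). This is where the exponent of the theorem comes from; the forced jump
  H0 adds at most L.\<close>

lemma V_le:
  assumes "0 < (snr p0 p1)\<^sup>2"
  shows "x * \<rho> ^ 4 * (real n)\<^sup>2 \<le> 4 / ((snr p0 p1)\<^sup>2 * L ^ 4) + L"
proof -
  let ?l = "(snr p0 p1)\<^sup>2"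
  have "x * (\<rho> ^ 4 * (real n)\<^sup>2) \<le> (4 * ?l + L ^ 3 / R) * (\<rho> ^ 4 * (real n)\<^sup>2)"
    by (rule mult_right_mono[OF x_le_sum]) simp
  also have "\<dots> = 4 * (?l * \<rho> ^ 4 * (real n)\<^sup>2) + L ^ 3 * \<rho>\<^sup>2"
    using rho n_pos by (simp add: R_def power_mult_distrib power4_eq_xxxx power2_eq_square field_simps)
  also have "L ^ 3 * \<rho>\<^sup>2 = (\<rho> * L)\<^sup>2 * L" by (simp add: power2_eq_square power3_eq_cube)
  also have "(\<rho> * L)\<^sup>2 * L \<le> 1 * L"
    using rho L4 by (intro mult_right_mono) (auto simp: L_def power_le_one)
  also have "?l * \<rho> ^ 4 * (real n)\<^sup>2 \<le> 1 / (?l * L ^ 4)"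
  proof -
    have "(?l * \<rho>\<^sup>2 * real n * L\<^sup>2)\<^sup>2 \<le> 1"
      using snr_small by (simp add: L_def power_le_one)
    then have "(?l * \<rho> ^ 4 * (real n)\<^sup>2) * (?l * L ^ 4) \<le> 1"
      by (simp add: power2_eq_square power4_eq_xxxx ac_simps)
    then show ?thesis using assms L4 by (subst pos_le_divide_eq) auto
  qed
  finally show ?thesis by (simp add: mult.assoc)
qed

text \<open>If H = H0, the first alternative holds for every u, since x n <= L^3 / (\<rho>^2 n) <=
  1. Otherwise x is at most four times the squared signal-to-noise ratio l, so failure of the first
  alternative gives u >= 1 / (2 l), which exceeds 2 D L because D <= 1 / (l L^2) and L >= 4.\<close>

lemma degree_condition:
  assumes l: "0 < (snr p0 p1)\<^sup>2" "(snr p0 p1)\<^sup>2 * L ^ 4 \<le> 1"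
    and D: "real D \<le> 1 / ((snr p0 p1)\<^sup>2 * L\<^sup>2)" and u: "u \<le> n"
  shows "x * real u \<le> 2 \<or> x \<le> 1 \<and> 2 * real D * ln (real n) \<le> real u"
proof (cases "2 * (p1 - p0) \<le> H0")
  case True
  then have "H = H0" by (simp add: H_def)
  then have "x \<le> L ^ 3 / R" using x_le p by (simp add: H0_square)
  then have "x * real u \<le> L ^ 3 / R * real n" using u x_nonneg by (intro mult_mono) auto
  also have "\<dots> \<le> 2"
  proof -
    have "(L\<^sup>2)\<^sup>2 \<le> (\<rho> * sqrt (real n))\<^sup>2" using rho_big by (intro power_mono) (auto simp: L_def)
    moreover have "L ^ 3 \<le> L ^ 4" using L4 by (intro power_increasing) auto
    ultimately have "L ^ 3 \<le> \<rho>\<^sup>2 * real n" by (simp add: power_mult_distrib flip: power_mult)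
    then have "L ^ 3 * real n \<le> \<rho>\<^sup>2 * real n * real n" by (intro mult_right_mono) auto
    then have "L ^ 3 * real n \<le> 1 * R" by (simp add: R_def power2_eq_square ac_simps)
    then show ?thesis using R_pos by (simp add: divide_le_eq)
  qed
  finally show ?thesis by simp
next
  case False
  let ?l = "(snr p0 p1)\<^sup>2"
  have H: "H = 2 * (p1 - p0)" using False by (simp add: H_def)
  have x4: "x \<le> 4 * ?l" using x_le jump_snr by (simp add: H)
  have "(4 :: real) ^ 4 \<le> L ^ 4" using L4 by (intro power_mono) auto
  then have "4 \<le> L ^ 4" by simp
  then have "?l * 4 \<le> ?l * L ^ 4" by (intro mult_left_mono) auto
  then have x1: "x \<le> 1" using x4 l(2) by linarith
  show ?thesis
  proof (cases "x * real u \<le> 2")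
    case False
    then have "2 \<le> 4 * ?l * real u" using x4 mult_right_mono[OF x4, of "real u"] by linarith
    then have u': "1 / ?l \<le> 2 * real u" using l(1) by (simp add: divide_le_eq mult.commute mult.left_commute)
    have "2 * real D * L \<le> 2 * (1 / (?l * L\<^sup>2)) * L" using D L4 by (intro mult_right_mono mult_left_mono) auto
    also have "\<dots> = 2 / L * (1 / ?l)" using L4 l(1) by (simp add: power2_eq_square)
    also have "\<dots> \<le> 2 / L * (2 * real u)" using u' L4 by (intro mult_left_mono) auto
    also have "\<dots> = 4 / L * real u" by simp
    also have "\<dots> \<le> 1 * real u" using L4 by (intro mult_right_mono) auto
    finally show ?thesis using x1 by (simp add: L_def)
  qed simp
qed


definition "V = x * \<rho> ^ 4 * (real n)\<^sup>2"
definition "\<Delta> = exp (32 * V) + 1"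

lemma \<Delta>_le: "\<Delta> \<le> 2 * exp (32 * V)" "1 < \<Delta>"
proof -
  have "0 \<le> V" using x_nonneg by (simp add: V_def)
  then have "1 \<le> exp (32 * V)" by simp
  then show "\<Delta> \<le> 2 * exp (32 * V)" "1 < \<Delta>" by (simp_all add: \<Delta>_def)
qed

lemma exp_L: "exp L = real n" using n_pos by (simp add: L_def)

section \<open>Power and running time of the scan at a fixed size\<close>

lemma scan_detects:
  fixes c \<kappa> k0 :: real and M :: nat
  assumes c: "0 < c" "c \<le> expected_correlation n p0 p1 \<rho> r X" and c1: "c \<le> 1"
    and \<kappa>: "\<kappa> = c / 8" and k0: "k0 = min (\<kappa>\<^sup>2 / 512) (\<kappa> ^ 6 / 2 ^ 24)"
    and small: "128 * \<epsilon> \<le> k0" "32 \<le> k0 * L"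
    and size: "16 / c\<^sup>2 \<le> \<rho> * real n / 2"
    and tails: "exp (- (\<rho> * n) / 16) + exp (- (\<rho> * n) / 4) + 8 * p1 / \<kappa>\<^sup>2 \<le> c / 8" "2 / real n \<le> c / 32"
    and M: "0 < M" "real M \<le> (real n)\<^sup>2 * \<Delta>"
  shows "\<exists>d w P Q S. (\<forall>e. snd (w e) \<longrightarrow> e \<in> edges n) \<and>
    0 \<le> P \<and> real_of_int P \<le> 5 * real n ^ 2 \<and> 0 \<le> Q \<and> real_of_int Q \<le> 2 * real n ^ 2 \<and>
    0 \<le> S \<and> real_of_int S \<le> 5 * real n ^ 4 \<and>
    error_sum (hidden_planted M (pds n h0 h1 \<rho>) (erdos_renyi n h0)) (hidden_null M (erdos_renyi n h0)) (r * M)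
      (\<lambda>y \<omega>. \<exists>j<M. scan_accepts n P Q S
        (entry d (X (thin w (\<lambda>e. y (j, e))) (\<lambda>z. \<omega> (z * M + j))))
        (thin w (\<lambda>e. y (j, e))) (\<lambda>e. y (j, e))) \<le> 1 - c / 16"
proof -
  interpret ch: channel a b p0 p1 h0 h1 q0 q1 by (rule channel)
  define g ov aa where "g = q1 - q0" and "ov = \<kappa>\<^sup>2 * R / 32" and "aa = 16 * R / \<kappa>\<^sup>2"
  \<comment> \<open>The offset s and the surplus slope, t q0 per edge on at most aa edges, each
    spend at most a quarter of the guaranteed excess g ov. The cap t <= 1 is the range of the
    quadratic bound on the exponential.\<close>
  define s where "s = g * ov / 4"
  define t where "t = min 1 (g * ov / (4 * q0 * aa))"
  \<comment> \<open>This denominator exceeds the number of edges, so rounding P and S to integers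
    shifts the threshold by at most 1.\<close>
  define Q where "Q = int (n\<^sup>2 + 1)"
  define P where "P = \<lceil>q0 * (1 + t) * real_of_int Q\<rceil>"
  define S where "S = \<lceil>s * real_of_int Q\<rceil>"
  define m where "m = min (H * R) (H\<^sup>2 * R / p0)"
  have \<kappa>0: "0 < \<kappa>" "\<kappa> \<le> 1" using c c1 \<kappa> by auto
  have k0_pos: "0 < k0" "k0 \<le> \<kappa>\<^sup>2 / 512" "k0 \<le> \<kappa> ^ 6 / 2 ^ 24" using \<kappa>0 by (auto simp: k0)
  have g: "H / 4 \<le> g" "0 < g" "g \<le> 1" using q_bounds H_bounds by (auto simp: g_def)
  have q0_pos: "0 < q0"
    unfolding q0_def using ab_bounds h_bounds p by (intro divide_pos_pos mult_pos_pos) auto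
  have ov: "0 < ov" and aa: "0 < aa" using \<kappa>0 R_pos by (auto simp: ov_def aa_def)
  have m: "L\<^sup>2 \<le> m" using U1_ge U2_ge by (simp add: m_def)
  have m0: "0 < m" using m L4 by (intro less_le_trans[OF _ m]) simp
  have k0m: "32 * L \<le> k0 * m"
  proof -
    have "32 * L \<le> k0 * L * L" using small(2) L4 by (intro mult_right_mono) auto
    also have "\<dots> = k0 * L\<^sup>2" by (simp add: power2_eq_square)
    also have "\<dots> \<le> k0 * m" using m k0_pos by (intro mult_left_mono) auto
    finally show ?thesis .
  qed
  have gov: "\<kappa>\<^sup>2 * (H * R) / 128 \<le> g * ov"
  proof -
    have "H / 4 * ov \<le> g * ov" using g(1) ov by (intro mult_right_mono) auto
    then show ?thesis by (simp add: ov_def algebra_simps)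
  qed
  have gov_k0: "k0 * m \<le> g * ov / 4"
  proof -
    have "k0 * m \<le> \<kappa>\<^sup>2 / 512 * (H * R)"
      using k0_pos m0 by (intro mult_mono) (auto simp: m_def)
    then show ?thesis using gov by simp
  qed
  have ratio: "k0 * m \<le> (g * ov)\<^sup>2 / (16 * q0 * aa)"
  proof -
    have "k0 * m \<le> \<kappa> ^ 6 / 2 ^ 24 * (H\<^sup>2 * R / p0)"
      using k0_pos m0 by (intro mult_mono) (auto simp: m_def)
    also have "\<dots> = (\<kappa>\<^sup>2 * (H * R) / 128)\<^sup>2 / (16 * (4 * p0) * aa)"
    proof -
      have "(\<kappa>\<^sup>2 * (H * R) / 128)\<^sup>2 / (16 * (4 * p0) * aa)
        = (\<kappa>\<^sup>2 * \<kappa>\<^sup>2 * \<kappa>\<^sup>2) * (H\<^sup>2 * (R * R / R) / p0) / 2 ^ 24"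
        using \<kappa>0 p R_pos by (simp add: aa_def power_mult_distrib power_divide field_simps power2_eq_square)
      also have "\<kappa>\<^sup>2 * \<kappa>\<^sup>2 * \<kappa>\<^sup>2 = \<kappa> ^ 6" by (simp flip: power_add)
      also have "R * R / R = R" using R_pos by simp
      finally show ?thesis by simp
    qed
    also have "\<dots> \<le> (g * ov)\<^sup>2 / (16 * q0 * aa)"
    proof (rule frac_le)
      show "(\<kappa>\<^sup>2 * (H * R) / 128)\<^sup>2 \<le> (g * ov)\<^sup>2"
        using gov H_bounds R_pos by (intro power_mono) auto
      show "16 * q0 * aa \<le> 16 * (4 * p0) * aa" using q_bounds aa by (intro mult_right_mono) auto
    qed (use q0_pos aa in auto)
    finally show ?thesis .
  qed
  have t: "0 \<le> t" "t \<le> 1" "t * q0 * aa \<le> g * ov / 4"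
  proof -
    show "0 \<le> t" "t \<le> 1" using g ov q0_pos aa by (auto simp: t_def)
    have "t * (q0 * aa) \<le> g * ov / (4 * q0 * aa) * (q0 * aa)"
      using q0_pos aa by (intro mult_right_mono) (auto simp: t_def)
    also have "\<dots> = g * ov / 4" using q0_pos aa by simp
    finally show "t * q0 * aa \<le> g * ov / 4" by (simp add: mult.assoc)
  qed
  \<comment> \<open>If t = 1, the exponent is g ov / 4, at least \<kappa>^2 H R / 512. Otherwise it
    is (g ov)^2 / (16 q0 aa), and q0 <= 4 p0 together with the value of aa gives \<kappa>^6 H^2 R /
    (2^24 p0). These are the constants in k0.\<close>
  have ts: "k0 * m \<le> t * s"
  proof (cases "1 \<le> g * ov / (4 * q0 * aa)")
    case True
    then show ?thesis using gov_k0 by (simp add: t_def s_def)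
  next
    case False
    then have "t * s = (g * ov)\<^sup>2 / (16 * q0 * aa)" by (simp add: t_def s_def power2_eq_square)
    then show ?thesis using ratio by simp
  qed
  have big: "128 \<le> g * ov" "128 * (q0 * aa) \<le> (g * ov)\<^sup>2"
  proof -
    show "128 \<le> g * ov" using gov_k0 k0m L4 by linarith
    have "128 \<le> (g * ov)\<^sup>2 / (16 * q0 * aa)" using ratio k0m L4 by linarith
    then have "128 * (16 * q0 * aa) \<le> (g * ov)\<^sup>2" using q0_pos aa by (subst (asm) pos_le_divide_eq) auto
    moreover have "0 \<le> q0 * aa" using q0_pos aa by simp
    ultimately show "128 * (q0 * aa) \<le> (g * ov)\<^sup>2" by linarith
  qed
  have Q: "0 < Q" "(real n)\<^sup>2 + 1 \<le> real_of_int Q" "real_of_int Q = (real n)\<^sup>2 + 1"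
  proof -
    show "0 < Q" unfolding Q_def of_nat_0_less_iff by simp
    show "(real n)\<^sup>2 + 1 \<le> real_of_int Q" "real_of_int Q = (real n)\<^sup>2 + 1" by (simp_all add: Q_def)
  qed
  have P: "q0 * (1 + t) * real_of_int Q \<le> real_of_int P" "real_of_int P \<le> q0 * (1 + t) * real_of_int Q + 1"
    unfolding P_def by linarith+
  have S: "s * real_of_int Q \<le> real_of_int S" "real_of_int S \<le> s * real_of_int Q + 1"
    unfolding S_def by linarith+
  have s0: "0 \<le> s" using g ov by (simp add: s_def)
  have n2: "1 \<le> (real n)\<^sup>2" using n_pos by simp
  have P_bounds: "0 \<le> P" "real_of_int P \<le> 5 * real n ^ 2"
  proof -
    have "0 \<le> q0 * (1 + t) * real_of_int Q" using q0_pos t Q by simp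
    then have "0 \<le> real_of_int P" using P(1) by linarith
    then show "0 \<le> P" by simp
    have "q0 * (1 + t) * real_of_int Q \<le> 1 * 2 * ((real n)\<^sup>2 + 1)"
      unfolding Q(3) using q_bounds t by (intro mult_mono) auto
    then have "q0 * (1 + t) * real_of_int Q + 1 \<le> 5 * real n ^ 2" using n2 by simp
    with P(2) show "real_of_int P \<le> 5 * real n ^ 2" by (rule order_trans)
  qed
  have S_bounds: "0 \<le> S" "real_of_int S \<le> 5 * real n ^ 4"
  proof -
    have "0 \<le> s * real_of_int Q" using s0 Q by simp
    then have "0 \<le> real_of_int S" using S(1) by linarith
    then show "0 \<le> S" by simp
    have "R \<le> (real n)\<^sup>2"
      unfolding R_def using rho eps n_pos by (intro power_mono) (auto simp: mult_left_le_one_le)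
    then have "\<kappa>\<^sup>2 * R \<le> 1 * (real n)\<^sup>2" using \<kappa>0 R_pos by (intro mult_mono) (auto simp: power_le_one)
    then have "ov \<le> (real n)\<^sup>2" using n2 by (simp add: ov_def)
    then have "g * ov \<le> 1 * (real n)\<^sup>2" using g ov by (intro mult_mono) auto
    then have "s \<le> (real n)\<^sup>2" using n2 by (simp add: s_def)
    then have "s * real_of_int Q \<le> (real n)\<^sup>2 * (2 * (real n)\<^sup>2)"
      using Q s0 n2 by (intro mult_mono) auto
    also have "\<dots> = 2 * real n ^ 4" by (simp flip: power_add)
    finally have "s * real_of_int Q \<le> 2 * real n ^ 4" .
    moreover have "1 \<le> real n ^ 4" using n_pos by (intro one_le_power) simp
    ultimately have "s * real_of_int Q + 1 \<le> 5 * real n ^ 4" by simp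
    with S(2) show "real_of_int S \<le> 5 * real n ^ 4" by (rule order_trans)
  qed
  obtain d where d: "(c / 2 - exp (- (\<rho> * n) / 16) - exp (- (\<rho> * n) / 4) - 8 * p1 / \<kappa>\<^sup>2) / 2
    \<le> measure_pmf.prob (pair_pmf (pds_joint n p0 p1 \<rho>) (coins r)) (good_event n \<rho> \<kappa> d X)"
    using prob_good_event[OF c(2,1) _ p(2) _ _ size \<kappa>] p rho eps by auto
  have pos: "0 < \<rho> * real n" using rho n_pos by simp
  have qq: "q0 \<in> {0..1}" "q1 \<in> {0..1}" using ch.q by auto
  have good: "1 / 2 \<le> measure_pmf.prob (Pi_pmf (edges n) False (\<lambda>e. bernoulli_pmf (edge_prob q0 q1 \<theta> e)))
        {z. scan_accepts n P Q S (entry d (X y \<omega>)) y z}"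
    if "((\<theta>, y), \<omega>) \<in> good_event n \<rho> \<kappa> d X" for \<theta> y \<omega>
    by (rule good_event_accepts[OF qq g_def less_imp_le[OF g(2)] \<kappa>0(1) pos ov_def[unfolded R_def]
      aa_def[unfolded R_def] big t(1,3) s_def Q(2) P(2) S(2) that])
  obtain w where w: "\<forall>e. snd (w e) \<longrightarrow> e \<in> edges n"
    "error_sum (hidden_planted M (pds n h0 h1 \<rho>) (erdos_renyi n h0)) (hidden_null M (erdos_renyi n h0)) (r * M)
      (\<lambda>y \<omega>. \<exists>j<M. scan_accepts n P Q S
        (entry d (X (thin w (\<lambda>e. y (j, e))) (\<lambda>z. \<omega> (z * M + j))))
        (thin w (\<lambda>e. y (j, e))) (\<lambda>e. y (j, e)))
    \<le> M * ((real n)\<^sup>2 * exp (- t * s)) +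
      (1 - 1 / 2 * measure_pmf.prob (pair_pmf (pds_joint n p0 p1 \<rho>) (coins r)) (good_event n \<rho> \<kappa> d X))"
    using ch.exists_mask[where Z = "\<lambda>y \<omega>. entry d (X y \<omega>)" and G = "good_event n \<rho> \<kappa> d X" and \<rho> = \<rho> and r = r,
      OF M(1) t(1,2) Q(1) P(1) S(1) good] by blast
  \<comment> \<open>The samples and thresholds contribute 4 L + 32 V to the exponent. By the choice
    of \<epsilon> the term 32 V is at most a quarter of k0 m, and k0 m >= 32 L leaves more than L to
    spare.\<close>
  have "real M * ((real n)\<^sup>2 * exp (- t * s)) \<le> 2 / real n"
  proof -
    have V: "32 * V \<le> k0 * m / 4"
    proof -
      have "V \<le> \<epsilon> * m" using V_le_U1 V_le_U2 eps by (auto simp: V_def m_def min_def)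
      moreover have "128 * \<epsilon> * m \<le> k0 * m" using small(1) m0 by (intro mult_right_mono) auto
      ultimately show ?thesis by linarith
    qed
    have "real M * ((real n)\<^sup>2 * exp (- t * s)) \<le> ((real n)\<^sup>2 * (2 * exp (32 * V))) * ((real n)\<^sup>2 * exp (- (k0 * m)))"
    proof (intro mult_mono)
      have "(real n)\<^sup>2 * \<Delta> \<le> (real n)\<^sup>2 * (2 * exp (32 * V))"
        using \<Delta>_le by (intro mult_left_mono) auto
      then show "real M \<le> (real n)\<^sup>2 * (2 * exp (32 * V))" using M(2) by linarith
    qed (use ts in auto)
    also have "\<dots> = 2 * exp (4 * L + 32 * V - k0 * m)"
    proof -
      have "exp (4 * L) = (real n)\<^sup>2 * (real n)\<^sup>2"
        using exp_of_nat_mult[of 4 L] by (simp add: exp_L flip: power_add)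
      then show ?thesis by (simp add: exp_add exp_diff exp_minus field_simps)
    qed
    also have "\<dots> \<le> 2 * exp (- L)" using V k0m L4 by simp
    also have "\<dots> = 2 / real n" by (simp add: exp_minus exp_L field_simps)
    finally show ?thesis .
  qed
  \<comment> \<open>The informative sample is accepted with probability at least half of (c / 2 - c
    / 8) / 2, that is 3 c / 32, and the false alarms cost at most c / 32.\<close>
  with w(2) d tails have "error_sum (hidden_planted M (pds n h0 h1 \<rho>) (erdos_renyi n h0)) (hidden_null M (erdos_renyi n h0)) (r * M)
      (\<lambda>y \<omega>. \<exists>j<M. scan_accepts n P Q S
        (entry d (X (thin w (\<lambda>e. y (j, e))) (\<lambda>z. \<omega> (z * M + j))))
        (thin w (\<lambda>e. y (j, e))) (\<lambda>e. y (j, e))) \<le> 1 - c / 16"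
    by argo
  moreover have "real_of_int Q \<le> 2 * real n ^ 2" using Q n2 by simp
  ultimately show ?thesis
    using w(1) P_bounds S_bounds Q(1)
    by (intro exI[of _ d] exI[of _ w] exI[of _ P] exI[of _ Q] exI[of _ S] conjI) simp_all
qed

text \<open>Deliberately crude: bounding bit lengths by the numbers themselves keeps B polynomial in
  n, M and T, and fixed powers only change constants in the exponent.\<close>

lemma bits_le_abs: "bits z \<le> nat \<bar>z\<bar> + 1"
proof -
  have "nat \<bar>z\<bar> < 2 ^ nat \<bar>z\<bar>" by (rule less_exp)
  then have "int (nat \<bar>z\<bar>) < int (2 ^ nat \<bar>z\<bar>)" by (simp only: of_nat_less_iff)
  then have "\<bar>z\<bar> < 2 ^ nat \<bar>z\<bar>" by simp
  then show ?thesis using bits_le_iff[of z "nat \<bar>z\<bar>"] by simp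
qed

text \<open>M enters with the third power, once as the number of samples and twice through B; this
  turns the factor exp (32 V) of M into exp (96 V).\<close>

lemma time_polynomial:
  fixes N M T B e :: real
  assumes "1 \<le> N" "1 \<le> M" "0 \<le> B" and M: "M \<le> N\<^sup>2 * (2 * e)" and B: "B \<le> 53 * (N ^ 4 * (M * T))"
  shows "1000000 * M * (N\<^sup>2 + 1)\<^sup>2 * B\<^sup>2 \<le> 89888000000 * (e ^ 3 * N ^ 18 * T\<^sup>2)"
proof -
  have "1 \<le> N\<^sup>2" using assms(1) by simp
  then have "(N\<^sup>2 + 1)\<^sup>2 \<le> (2 * N\<^sup>2)\<^sup>2" by (intro power_mono) auto
  moreover have "B\<^sup>2 \<le> (53 * (N ^ 4 * (M * T)))\<^sup>2" using B assms(3) by (rule power_mono)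
  ultimately have "1000000 * M * (N\<^sup>2 + 1)\<^sup>2 * B\<^sup>2 \<le> 1000000 * M * (2 * N\<^sup>2)\<^sup>2 * (53 * (N ^ 4 * (M * T)))\<^sup>2"
    using assms(2) by (intro mult_mono) auto
  also have "\<dots> = 11236000000 * (M ^ 3 * (N ^ 12 * T\<^sup>2))" by algebra
  also have "\<dots> \<le> 11236000000 * ((N\<^sup>2 * (2 * e)) ^ 3 * (N ^ 12 * T\<^sup>2))"
    using M assms(1,2) by (intro mult_left_mono mult_right_mono power_mono) auto
  also have "\<dots> = 89888000000 * (e ^ 3 * N ^ 18 * T\<^sup>2)" by algebra
  finally show ?thesis .
qed

lemma scan_time:
  fixes P Q S :: int and M r :: nat and T :: real
  assumes alg: "computes_in_time (edge_addr n) (edges n) r (out_matrix n) X T"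
    and w: "\<And>e. snd (w e) \<Longrightarrow> e \<in> edges n"
    and P: "0 \<le> P" "real_of_int P \<le> 5 * real n ^ 2" and Q: "0 \<le> Q" "real_of_int Q \<le> 2 * real n ^ 2"
    and S: "0 \<le> S" "real_of_int S \<le> 5 * real n ^ 4"
    and M: "0 < M" "real M \<le> (real n)\<^sup>2 * \<Delta>" and T: "2 \<le> T"
  shows "\<exists>\<tau>. computes_in_time (hidden_edge_addr n) ({..<M} \<times> edges n) (r * M) out_bit
    (\<lambda>y \<omega>. \<exists>j<M. scan_accepts n P Q S
       (entry d (X (thin w (\<lambda>e. y (j, e))) (\<lambda>z. \<omega> (z * M + j))))
       (thin w (\<lambda>e. y (j, e))) (\<lambda>e. y (j, e))) \<tau> \<and> \<tau> \<le> exp (60 + 18 * L + 96 * V) * T\<^sup>2"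
proof -
  define B where "B = nat \<lceil>T\<rceil> + M + 50 * n ^ 4"
  have n1: "1 \<le> n" using n_pos by simp
  have n24: "n\<^sup>2 \<le> n ^ 4" "1 \<le> n ^ 4" using n1 by (auto intro!: power_increasing)
  have Pn: "P \<le> 5 * int n ^ 2" "Q \<le> 2 * int n ^ 2" "S \<le> 5 * int n ^ 4"
  proof -
    have "real_of_int P \<le> real_of_int (5 * int n ^ 2)" "real_of_int Q \<le> real_of_int (2 * int n ^ 2)"
      "real_of_int S \<le> real_of_int (5 * int n ^ 4)"
      using P(2) Q(2) S(2) by simp_all
    then show "P \<le> 5 * int n ^ 2" "Q \<le> 2 * int n ^ 2" "S \<le> 5 * int n ^ 4"
      by (simp_all only: of_int_le_iff)
  qed
  have bits: "bits z \<le> B" if "\<bar>z\<bar> \<le> int (49 * n ^ 4 + M)" for z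
  proof -
    have "nat \<bar>z\<bar> \<le> 49 * n ^ 4 + M" using that by linarith
    then show ?thesis using bits_le_abs[of z] n24 unfolding B_def by linarith
  qed
  have i24: "int n ^ 2 \<le> int n ^ 4" "1 \<le> int n ^ 4" using n24 by (simp_all flip: of_nat_power)
  have small_bits: "bits z \<le> B" if "0 \<le> z" "z \<le> 49 * int n ^ 4" for z
    by (rule bits) (use that in simp)
  have PQ: "int (n\<^sup>2) * (\<bar>P\<bar> + \<bar>Q\<bar>) \<le> 7 * int n ^ 4"
  proof -
    have "int (n\<^sup>2) * (\<bar>P\<bar> + \<bar>Q\<bar>) \<le> int n ^ 2 * (7 * int n ^ 2)"
      using Pn P Q by (intro mult_mono) auto
    also have "\<dots> = 7 * int n ^ 4" by (simp flip: power_add)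
    finally show ?thesis .
  qed
  have TB: "T \<le> real B"
  proof -
    have "real B = real (nat \<lceil>T\<rceil>) + (real M + 50 * real n ^ 4)" by (simp add: B_def)
    moreover have "0 \<le> real M + 50 * real n ^ 4" by simp
    ultimately show ?thesis using real_nat_ceiling_ge[of T] by linarith
  qed
  have "computes_in_time (hidden_edge_addr n) ({..<M} \<times> edges n) (r * M) out_bit
    (\<lambda>y \<omega>. \<exists>j<M. scan_accepts n P Q S
       (entry d (X (thin w (\<lambda>e. y (j, e))) (\<lambda>z. \<omega> (z * M + j))))
       (thin w (\<lambda>e. y (j, e))) (\<lambda>e. y (j, e))) (real (1000000 * M * (n\<^sup>2 + 1)\<^sup>2 * B\<^sup>2))"
  proof (rule hidden_scan_computes_in_time[OF alg M(1) w TB])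
    show "4 \<le> B" using n24 by (simp add: B_def)
    show "bits (int M) \<le> B" by (rule bits) simp
    show "bits (int (n\<^sup>2)) \<le> B" by (rule small_bits) (use i24 in simp_all)
    show "bits P \<le> B" by (rule small_bits[OF P(1)]) (use Pn i24 in linarith)
    show "bits Q \<le> B" by (rule small_bits[OF Q(1)]) (use Pn i24 in linarith)
    show "bits S \<le> B" by (rule small_bits[OF S(1)]) (use Pn i24 in linarith)
    show "bits (int (n\<^sup>2) * (\<bar>P\<bar> + \<bar>Q\<bar>)) \<le> B"
      by (rule small_bits, simp) (use PQ i24 in linarith)
  qed
  moreover have "real (1000000 * M * (n\<^sup>2 + 1)\<^sup>2 * B\<^sup>2) \<le> exp (60 + 18 * L + 96 * V) * T\<^sup>2"
  proof -
    let ?N = "real n ^ 4"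
    have N1: "1 \<le> ?N" using n_pos by (intro one_le_power) auto
    have M1: "1 \<le> real M" using M by simp
    have "1 * (1 * T) \<le> ?N * (real M * T)" using N1 M1 T by (intro mult_mono) auto
    moreover have "1 * (real M * 1) \<le> ?N * (real M * T)" using N1 M1 T by (intro mult_mono) auto
    moreover have "?N * (1 * 1) \<le> ?N * (real M * T)" using N1 M1 T by (intro mult_mono) auto
    moreover have "real B \<le> T + 1 + real M + 50 * ?N"
    proof -
      have "real (nat \<lceil>T\<rceil>) = real_of_int \<lceil>T\<rceil>" using T by simp
      then show ?thesis using of_int_ceiling_le_add_one[of T] by (simp add: B_def)
    qed
    ultimately have B: "real B \<le> 53 * (?N * (real M * T))" using T by linarith
    have M_le: "real M \<le> (real n)\<^sup>2 * (2 * exp (32 * V))"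
    proof -
      have "(real n)\<^sup>2 * \<Delta> \<le> (real n)\<^sup>2 * (2 * exp (32 * V))"
        using \<Delta>_le by (intro mult_left_mono) auto
      then show ?thesis using M(2) by linarith
    qed
    have "real (1000000 * M * (n\<^sup>2 + 1)\<^sup>2 * B\<^sup>2) = 1000000 * real M * ((real n)\<^sup>2 + 1)\<^sup>2 * (real B)\<^sup>2"
      by (simp add: add.commute)
    also have "\<dots> \<le> 89888000000 * (exp (32 * V) ^ 3 * real n ^ 18 * T\<^sup>2)"
      using n_pos M1 by (intro time_polynomial M_le B) auto
    also have "exp (32 * V) ^ 3 = exp (96 * V)" using exp_of_nat_mult[of 3 "32 * V"] by simp
    also have "real n ^ 18 = exp (18 * L)" using exp_of_nat_mult[of 18 L] exp_L by simp
    also have "89888000000 * (exp (96 * V) * exp (18 * L) * T\<^sup>2) \<le> exp 60 * (exp (96 * V) * exp (18 * L) * T\<^sup>2)"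
    proof (rule mult_right_mono)
      have "(2 :: real) ^ 60 \<le> exp 1 ^ 60"
        using exp_ge_add_one_self[of 1] by (intro power_mono) auto
      moreover have "exp 1 ^ 60 = exp (60 :: real)" using exp_of_nat_mult[of 60 "1 :: real"] by simp
      moreover have "(89888000000 :: real) \<le> 2 ^ 60" by simp
      ultimately show "89888000000 \<le> exp (60 :: real)" by linarith
    qed simp
    also have "\<dots> = exp (60 + 18 * L + 96 * V) * T\<^sup>2" by (simp only: exp_add ac_simps)
    finally show ?thesis .
  qed
  ultimately show ?thesis by blast
qed

end

section \<open>From a fixed size to sequences\<close>

lemma computes_in_time_mono:
  "computes_in_time addr I r out F \<tau> \<Longrightarrow> \<tau> \<le> \<tau>' \<Longrightarrow> computes_in_time addr I r out F \<tau>'"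
proof -
  assume F: "computes_in_time addr I r out F \<tau>" and le: "\<tau> \<le> \<tau>'"
  from F obtain c where c: "real (csize c) \<le> \<tau>"
    and run: "\<And>y \<omega>. (\<forall>i. y i \<longrightarrow> i \<in> I) \<Longrightarrow> (\<forall>k. \<omega> k \<longrightarrow> k < r) \<Longrightarrow>
      \<exists>k s. exec c (init_mem addr y \<omega>) k s \<and> real k \<le> \<tau> \<and> out s (F y \<omega>)"
    unfolding computes_in_time_def by blast
  show ?thesis
    unfolding computes_in_time_def
  proof (intro exI[of _ c] conjI allI impI)
    show "real (csize c) \<le> \<tau>'" using c le by linarith
  next
    fix y \<omega> assume "\<forall>i. y i \<longrightarrow> i \<in> I" "\<forall>k. \<omega> k \<longrightarrow> k < r"
    from run[OF this] obtain k s where "exec c (init_mem addr y \<omega>) k s" "real k \<le> \<tau>" "out s (F y \<omega>)"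
      by blast
    moreover from this(2) le have "real k \<le> \<tau>'" by linarith
    ultimately show "\<exists>k s. exec c (init_mem addr y \<omega>) k s \<and> real k \<le> \<tau>' \<and> out s (F y \<omega>)" by blast
  qed
qed

lemma card_edges_ge: "real n - 1 \<le> real (card (edges n))"
proof -
  have "card ((\<lambda>j. (0 :: nat, j)) ` {1..<n}) \<le> card (edges n)"
    by (rule card_mono[OF finite_edges]) (auto simp: edges_def)
  moreover have "card ((\<lambda>j. (0 :: nat, j)) ` {1..<n}) = n - 1"
    by (subst card_image) (auto simp: inj_on_def)
  ultimately show ?thesis by linarith
qed

lemma finite_set_pds [simp]: "finite (set_pmf (pds n p0 p1 \<rho>))"
  unfolding pds_bind by (auto simp: set_bind_pmf)

lemma pds_regime_limits:
  assumes regime: "pds_regime (\<lambda>n. n) p0 p1 \<rho>"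
  shows "p1 \<longlonglongrightarrow> 0"
    and "(\<lambda>n. (snr (p0 n) (p1 n))\<^sup>2 * (\<rho> n)\<^sup>2 * real n * (ln (real n))\<^sup>2) \<longlonglongrightarrow> 0"
    and "0 < \<epsilon> \<Longrightarrow> \<epsilon> \<le> 1 \<Longrightarrow> \<forall>\<^sub>F n in sequentially. regime_at n (p0 n) (p1 n) (\<rho> n) \<epsilon>"
proof -
  have range: "\<And>n. 0 \<le> \<rho> n \<and> \<rho> n \<le> 1 \<and> 0 \<le> p0 n \<and> p0 n \<le> p1 n \<and> p1 n \<le> 1"
    and o1: "(\<lambda>n. 1 / real n) \<in> o(p0)" and o2: "p1 \<in> o(\<lambda>_. 1)"
    and o3: "(\<lambda>n. (ln (real n))\<^sup>2 / sqrt (real n)) \<in> o(\<rho>)"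
    and o4: "\<rho> \<in> o(\<lambda>n. 1 / ln (real n))"
    and o5: "(\<lambda>n. (snr (p0 n) (p1 n))\<^sup>2 * (\<rho> n)\<^sup>2 * real n) \<in> o(\<lambda>n. 1 / (ln (real n))\<^sup>2)"
    using regime unfolding pds_regime_def by auto
  show p1_lim: "p1 \<longlonglongrightarrow> 0" using smalloD_tendsto[OF o2] by simp
  show w_lim: "(\<lambda>n. (snr (p0 n) (p1 n))\<^sup>2 * (\<rho> n)\<^sup>2 * real n * (ln (real n))\<^sup>2) \<longlonglongrightarrow> 0"
    using smalloD_tendsto[OF o5] by simp
  assume \<epsilon>: "0 < \<epsilon>" "\<epsilon> \<le> 1"
  have ln4: "\<forall>\<^sub>F n in sequentially. 4 \<le> ln (real n)" by real_asymp
  have "(\<lambda>n. ln (real n) / sqrt (real n)) \<longlonglongrightarrow> 0" by real_asymp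
  then have l1: "\<forall>\<^sub>F n in sequentially. ln (real n) / sqrt (real n) < \<epsilon>" using \<epsilon>(1) by (rule order_tendstoD)
  have "(\<lambda>n. 2 / (ln (real n))\<^sup>2) \<longlonglongrightarrow> 0" by real_asymp
  then have l2: "\<forall>\<^sub>F n in sequentially. 2 / (ln (real n))\<^sup>2 < \<epsilon>" using \<epsilon>(1) by (rule order_tendstoD)
  show "\<forall>\<^sub>F n in sequentially. regime_at n (p0 n) (p1 n) (\<rho> n) \<epsilon>"
  proof -
    have e1: "\<forall>\<^sub>F n in sequentially. 1 / real n \<le> p0 n"
      by (rule eventually_mono[OF landau_o.smallD[OF o1 zero_less_one]]) (use range in simp)
    have e2: "\<forall>\<^sub>F n in sequentially. p1 n \<le> 1 / 64"
      by (rule order_tendstoD(2)[OF p1_lim, of "1 / 64", THEN eventually_mono]) auto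
    have e3: "\<forall>\<^sub>F n in sequentially. (ln (real n))\<^sup>2 / sqrt (real n) \<le> \<rho> n"
      by (rule eventually_mono[OF landau_o.smallD[OF o3 zero_less_one]]) (use range in simp)
    have e4: "\<forall>\<^sub>F n in sequentially. \<rho> n \<le> \<epsilon> * \<bar>1 / ln (real n)\<bar>"
      by (rule eventually_mono[OF landau_o.smallD[OF o4 \<epsilon>(1)]]) (use range in simp)
    have e5: "\<forall>\<^sub>F n in sequentially. (snr (p0 n) (p1 n))\<^sup>2 * (\<rho> n)\<^sup>2 * real n * (ln (real n))\<^sup>2 < 1"
      by (rule order_tendstoD(2)[OF w_lim]) simp
    show ?thesis
      using e1 e2 e3 e4 e5 ln4 l1 l2 eventually_gt_at_top[of 0]
  proof eventually_elim
    case (elim n)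
    have n: "0 < real n" using elim by simp
    have L: "4 \<le> ln (real n)" by (rule elim)
    have p0n: "1 \<le> p0 n * real n" using elim(1) n by (simp add: pos_divide_le_eq)
    then have p0: "0 < p0 n" using range[of n] n by (cases "p0 n = 0") auto
    have \<rho>big: "(ln (real n))\<^sup>2 \<le> \<rho> n * sqrt (real n)"
      using elim(3) n by (simp add: pos_divide_le_eq)
    have "0 < (ln (real n))\<^sup>2" using L by simp
    then have \<rho>0: "0 < \<rho> n" using \<rho>big range[of n] by (cases "\<rho> n = 0") auto
    have \<rho>\<epsilon>: "\<rho> n \<le> \<epsilon> * (1 / ln (real n))" using elim(4) L by simp
    also have "\<dots> \<le> 1 * (1 / ln (real n))" using \<epsilon> L by (intro mult_right_mono) auto
    finally have \<rho>1: "\<rho> n * ln (real n) \<le> 1" using L by (simp add: pos_le_divide_eq)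
    have "\<epsilon> * (1 / ln (real n)) \<le> \<epsilon> * 1" using \<epsilon> L by (intro mult_left_mono) auto
    then have \<rho>2: "\<rho> n \<le> \<epsilon>" using \<rho>\<epsilon> by linarith
    show ?case
      using \<epsilon> L p0 range[of n] elim(2,5,7,8) \<rho>0 \<rho>1 \<rho>2 p0n \<rho>big
      by (intro regime_at.intro) auto
  qed
  qed
qed

text \<open>The base pair must stay sparse: even the forced jump H0 is at most the root of p0, so h1
  vanishes with p1.\<close>

lemma (in regime_at) h1_le: "h1 \<le> 4 * p1 + sqrt p1"
proof -
  have "sqrt p0 \<le> sqrt p1" using p by simp
  then have "H0 \<le> sqrt p1" using H0_le by linarith
  moreover have "- (2 * p0) \<le> sqrt p1" by (rule order_trans[of _ 0]) (use p in simp_all)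
  ultimately have "H \<le> 2 * p1 + sqrt p1" using p unfolding H_def by (intro max.boundedI) auto
  then show ?thesis using p unfolding h1_def by simp
qed

lemma (in regime_at) x_small:
  "x * \<rho>\<^sup>2 * real n * L\<^sup>2 \<le> 4 * ((snr p0 p1)\<^sup>2 * \<rho>\<^sup>2 * real n * L\<^sup>2) + L ^ 5 / real n"
proof -
  have "x * (\<rho>\<^sup>2 * real n * L\<^sup>2) \<le> (4 * (snr p0 p1)\<^sup>2 + L ^ 3 / R) * (\<rho>\<^sup>2 * real n * L\<^sup>2)"
    using x_le_sum by (rule mult_right_mono) simp
  also have "\<dots> = 4 * ((snr p0 p1)\<^sup>2 * \<rho>\<^sup>2 * real n * L\<^sup>2) + (L ^ 3 * L\<^sup>2) * (\<rho>\<^sup>2 * real n / R)"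
    by (simp add: algebra_simps)
  also have "\<rho>\<^sup>2 * real n / R = 1 / real n"
    using rho n_pos by (simp add: R_def power2_eq_square)
  also have "L ^ 3 * L\<^sup>2 = L ^ 5" by (simp flip: power_add)
  finally show ?thesis by (simp add: mult.assoc)
qed

text \<open>The heuristic is assumed only inside the regime, so the modified densities have to
  satisfy the same conditions along \<phi>. Doubling p0 is harmless, and the forced jump H0 adds
  only L^5 / n to the normalised signal-to-noise condition.\<close>

lemma base_pair_regime:
  assumes regime: "pds_regime (\<lambda>n. n) p0 p1 \<rho>" and \<phi>: "filterlim \<phi> at_top sequentially"
    and at: "\<And>k. regime_at (\<phi> k) (p0 (\<phi> k)) (p1 (\<phi> k)) (\<rho> (\<phi> k)) \<epsilon>"
  shows "pds_regime \<phi> (\<lambda>k. regime_at.h0 (p0 (\<phi> k)))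
    (\<lambda>k. regime_at.h1 (\<phi> k) (p0 (\<phi> k)) (p1 (\<phi> k)) (\<rho> (\<phi> k))) (\<lambda>k. \<rho> (\<phi> k))"
proof -
  let ?h0 = "\<lambda>k. regime_at.h0 (p0 (\<phi> k))"
  let ?h1 = "\<lambda>k. regime_at.h1 (\<phi> k) (p0 (\<phi> k)) (p1 (\<phi> k)) (\<rho> (\<phi> k))"
  have range: "\<And>n. 0 \<le> \<rho> n \<and> \<rho> n \<le> 1"
    and o1: "(\<lambda>n. 1 / real n) \<in> o(p0)"
    and o3: "(\<lambda>n. (ln (real n))\<^sup>2 / sqrt (real n)) \<in> o(\<rho>)"
    and o4: "\<rho> \<in> o(\<lambda>n. 1 / ln (real n))"
    using regime unfolding pds_regime_def by auto
  have h0: "?h0 = (\<lambda>k. 2 * p0 (\<phi> k))" by (rule ext) (rule regime_at.h0_def[OF at])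
  have hb: "0 < ?h0 k" "?h0 k \<le> ?h1 k" "?h1 k \<le> 1 / 2" for k
    using regime_at.h_bounds[OF at, of k] by auto
  have p1: "(\<lambda>k. p1 (\<phi> k)) \<longlonglongrightarrow> 0"
    by (rule filterlim_compose[OF pds_regime_limits(1)[OF regime] \<phi>])
  have "?h1 \<longlonglongrightarrow> 0"
  proof (rule tendsto_sandwich)
    show "\<forall>\<^sub>F k in sequentially. 0 \<le> ?h1 k"
      using hb by (intro always_eventually allI) (meson less_imp_le order_trans)
    show "\<forall>\<^sub>F k in sequentially. ?h1 k \<le> 4 * p1 (\<phi> k) + sqrt (p1 (\<phi> k))"
      by (intro always_eventually allI regime_at.h1_le[OF at])
    have "(\<lambda>k. 4 * p1 (\<phi> k) + sqrt (p1 (\<phi> k))) \<longlonglongrightarrow> 4 * 0 + sqrt 0"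
      by (intro tendsto_intros p1)
    then show "(\<lambda>k. 4 * p1 (\<phi> k) + sqrt (p1 (\<phi> k))) \<longlonglongrightarrow> 0" by simp
  qed simp
  then have h1: "?h1 \<in> o(\<lambda>_. 1)" by (intro smalloI_tendsto) simp_all
  let ?f = "\<lambda>k. (snr (?h0 k) (?h1 k))\<^sup>2 * (\<rho> (\<phi> k))\<^sup>2 * real (\<phi> k)"
  let ?w = "\<lambda>n. (snr (p0 n) (p1 n))\<^sup>2 * (\<rho> n)\<^sup>2 * real n * (ln (real n))\<^sup>2"
  have L: "4 \<le> ln (real (\<phi> k))" for k using at[of k] by (simp add: regime_at_def)
  have "(\<lambda>k. ?f k / (1 / (ln (real (\<phi> k)))\<^sup>2)) \<longlonglongrightarrow> 0"
  proof (rule tendsto_sandwich)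
    show "\<forall>\<^sub>F k in sequentially. 0 \<le> ?f k / (1 / (ln (real (\<phi> k)))\<^sup>2)" by simp
    have "?f k / (1 / (ln (real (\<phi> k)))\<^sup>2) \<le> 4 * ?w (\<phi> k) + ln (real (\<phi> k)) ^ 5 / real (\<phi> k)" for k
      using regime_at.x_small[OF at, of k]
      unfolding regime_at.L_def[OF at] regime_at.x_def[OF at] by simp
    then show "\<forall>\<^sub>F k in sequentially. ?f k / (1 / (ln (real (\<phi> k)))\<^sup>2)
        \<le> 4 * ?w (\<phi> k) + ln (real (\<phi> k)) ^ 5 / real (\<phi> k)" by (intro always_eventually allI)
    have "(\<lambda>n. ln (real n) ^ 5 / real n) \<longlonglongrightarrow> 0" by real_asymp
    then have "(\<lambda>n. 4 * ?w n + ln (real n) ^ 5 / real n) \<longlonglongrightarrow> 4 * 0 + 0"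
      by (intro tendsto_add tendsto_mult tendsto_const pds_regime_limits(2)[OF regime])
    then have "(\<lambda>n. 4 * ?w n + ln (real n) ^ 5 / real n) \<longlonglongrightarrow> 0" by simp
    from filterlim_compose[OF this \<phi>]
    show "(\<lambda>k. 4 * ?w (\<phi> k) + ln (real (\<phi> k)) ^ 5 / real (\<phi> k)) \<longlonglongrightarrow> 0" .
  qed simp
  then have f: "?f \<in> o(\<lambda>k. 1 / (ln (real (\<phi> k)))\<^sup>2)"
  proof (rule smalloI_tendsto)
    have "1 / (ln (real (\<phi> k)))\<^sup>2 \<noteq> 0" for k using L[of k] by auto
    then show "\<forall>\<^sub>F k in sequentially. 1 / (ln (real (\<phi> k)))\<^sup>2 \<noteq> 0" by (intro always_eventually allI)
  qed
  have o1': "(\<lambda>k. 1 / real (\<phi> k)) \<in> o(?h0)"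
    using landau_o.small.compose[OF o1 \<phi>] unfolding h0 by simp
  have "0 \<le> \<rho> (\<phi> k) \<and> \<rho> (\<phi> k) \<le> 1 \<and> 0 \<le> ?h0 k \<and> ?h0 k \<le> ?h1 k \<and> ?h1 k \<le> 1" for k
    using range hb[of k] by auto
  then show ?thesis
    unfolding pds_regime_def
    using \<phi> o1' h1 f landau_o.small.compose[OF o3 \<phi>] landau_o.small.compose[OF o4 \<phi>] by blast
qed

lemma (in regime_at) advantage_le:
  assumes l: "0 < (snr p0 p1)\<^sup>2" "(snr p0 p1)\<^sup>2 * L ^ 4 \<le> 1"
    and D: "real D \<le> 1 / ((snr p0 p1)\<^sup>2 * L\<^sup>2)"
  shows "(Adv D (edges n) (pds n h0 h1 \<rho>) (erdos_renyi n h0))\<^sup>2 \<le> ereal \<Delta>"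
    and "0 < M \<Longrightarrow> Adv D ({..<M} \<times> edges n) (hidden_planted M (pds n h0 h1 \<rho>) (erdos_renyi n h0))
      (hidden_null M (erdos_renyi n h0)) \<le> ereal (sqrt (1 + \<Delta> / M))"
proof -
  define A where "A = (\<Sum>S\<in>small_sets (edges n) D. (measure_pmf.expectation (pds n h0 h1 \<rho>) (chi h0 S))\<^sup>2)"
  have n2: "2 \<le> n" using n_pos by linarith
  have A: "A \<le> \<Delta>"
    unfolding A_def \<Delta>_def V_def x_def
    using pds_advantage_le[OF h_bounds(1,2,3) _ _ n2 degree_condition[OF l D, unfolded x_def]]
      h_bounds rho eps by (simp add: mult.assoc)
  have A0: "0 \<le> A" unfolding A_def by (intro sum_nonneg) auto
  have "Adv D (edges n) (pds n h0 h1 \<rho>) (erdos_renyi n h0) \<le> ereal (sqrt A)"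
    unfolding erdos_renyi_def A_def by (intro Adv_le h_bounds) auto
  moreover have "0 \<le> Adv D (edges n) (pds n h0 h1 \<rho>) (erdos_renyi n h0)"
    using Adv_ge_1 by (rule order_trans[rotated]) simp
  ultimately have "(Adv D (edges n) (pds n h0 h1 \<rho>) (erdos_renyi n h0))\<^sup>2 \<le> ereal (sqrt A) * ereal (sqrt A)"
    unfolding power2_eq_square using A0 by (intro ereal_mult_mono) auto
  also have "\<dots> = ereal A" using A0 by simp
  also have "\<dots> \<le> ereal \<Delta>" using A by simp
  finally show "(Adv D (edges n) (pds n h0 h1 \<rho>) (erdos_renyi n h0))\<^sup>2 \<le> ereal \<Delta>" .
  show "Adv D ({..<M} \<times> edges n) (hidden_planted M (pds n h0 h1 \<rho>) (erdos_renyi n h0))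
      (hidden_null M (erdos_renyi n h0)) \<le> ereal (sqrt (1 + \<Delta> / M))" if "0 < M"
    using that A h_bounds unfolding A_def
    by (intro Adv_hidden_le[OF _ _ h_bounds(1,2)]) (auto simp: erdos_renyi_def hidden_null_erdos_renyi[unfolded erdos_renyi_def])
qed

lemma (in regime_at) sample_number:
  assumes M: "M = nat \<lfloor>real (card (edges n)) * \<Delta>\<rfloor>"
  shows "1 \<le> M" "real M \<le> real (card (edges n)) * \<Delta>" "real M \<le> (real n)\<^sup>2 * \<Delta>" "\<Delta> / real M \<le> 4 / real n"
    "2 \<le> card (edges n)"
proof -
  let ?N = "real (card (edges n))"
  have "real n = exp L" by (simp add: exp_L)
  moreover have "1 + L \<le> exp L" by (rule exp_ge_add_one_self)
  ultimately have n5: "5 \<le> real n" using L4 by linarith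
  have N: "real n / 2 + 1 \<le> ?N" using card_edges_ge[of n] n5 by linarith
  show "2 \<le> card (edges n)" using N n5 by linarith
  have \<Delta>1: "1 < \<Delta>" by (rule \<Delta>_le)
  have "1 * \<Delta> \<le> ?N * \<Delta>" using N n5 \<Delta>1 by (intro mult_right_mono) auto
  then have N\<Delta>: "1 \<le> ?N * \<Delta>" using \<Delta>1 by linarith
  have up: "real M \<le> ?N * \<Delta>" unfolding M using N\<Delta> by (simp add: of_nat_floor)
  then show "real M \<le> ?N * \<Delta>" .
  show "1 \<le> M" unfolding M using N\<Delta> by (simp add: le_nat_iff le_floor_iff)
  have "?N \<le> (real n)\<^sup>2" using card_edges_le[of n] by (metis of_nat_le_iff of_nat_power)
  then have "?N * \<Delta> \<le> (real n)\<^sup>2 * \<Delta>" using \<Delta>1 by (intro mult_right_mono) auto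
  then show "real M \<le> (real n)\<^sup>2 * \<Delta>" using up by linarith
  have "?N * \<Delta> - 1 \<le> real M" unfolding M using N\<Delta> by linarith
  moreover have "(real n / 2 + 1) * \<Delta> \<le> ?N * \<Delta>" using N \<Delta>1 by (intro mult_right_mono) auto
  ultimately have "real n / 2 * \<Delta> \<le> real M" using \<Delta>1 by (simp add: algebra_simps)
  then have "real n * \<Delta> \<le> 2 * real M" by simp
  moreover have "0 < real M" using \<open>1 \<le> M\<close> by simp
  ultimately have "\<Delta> / real M \<le> 2 / real n" using n5 by (simp add: field_simps)
  also have "\<dots> \<le> 4 / real n" using n5 by (intro divide_right_mono) auto
  finally show "\<Delta> / real M \<le> 4 / real n" .
qed

theorem theorem2p8:
  fixes p0 p1 \<rho> :: "nat \<Rightarrow> real"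
    and r :: "nat \<Rightarrow> nat"
    and X :: "nat \<Rightarrow> (nat \<times> nat \<Rightarrow> bool) \<Rightarrow> (nat \<Rightarrow> bool) \<Rightarrow> nat \<Rightarrow> nat \<Rightarrow> real"
    and T :: "nat \<Rightarrow> real"
  assumes regime: "pds_regime (\<lambda>n. n) p0 p1 \<rho>"
    and heuristic: "pds_low_degree_heuristic"
    and algorithm: "\<forall>\<^sub>F n in sequentially.
      computes_in_time (edge_addr n) (edges n) (r n) (out_matrix n) (X n) (T n)"
    and recovery: "weak_recovery p0 p1 \<rho> r X"
  shows "\<exists>\<gamma>>0. \<forall>\<^sub>F n in sequentially.
    T n \<ge> exp (\<gamma> * ((snr (p0 n) (p1 n)) powi (-2) * (ln (real n)) powi (-4)))"
proof (rule ccontr)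
  define \<beta> where "\<beta> n = (snr (p0 n) (p1 n)) powi (-2) * (ln (real n)) powi (-4)" for n
  assume neg: "\<not> ?thesis"
  \<comment> \<open>With \<gamma> = 1 / 2, the square of the running time, which the scan incurs,
    stays below exp \<beta>.\<close>
  have freq: "\<exists>\<^sub>F n in sequentially. T n < exp (1 / 2 * \<beta> n)"
  proof (rule ccontr)
    assume "\<not> (\<exists>\<^sub>F n in sequentially. T n < exp (1 / 2 * \<beta> n))"
    then have "\<forall>\<^sub>F n in sequentially. T n \<ge> exp (1 / 2 * \<beta> n)" by (simp only: not_frequently not_less)
    moreover have "0 < (1 / 2 :: real)" by simp
    ultimately show False using neg unfolding \<beta>_def by blast
  qed
  obtain c0 where c0: "0 < c0"
    "\<forall>\<^sub>F n in sequentially. c0 \<le> expected_correlation n (p0 n) (p1 n) (\<rho> n) (r n) (X n)"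
    using recovery unfolding weak_recovery_def by blast
  define c where "c = min c0 1"
  define \<kappa> where "\<kappa> = c / 8"
  define k0 where "k0 = min (\<kappa>\<^sup>2 / 512) (\<kappa> ^ 6 / 2 ^ 24)"
  define \<epsilon> where "\<epsilon> = min 1 (k0 / 128)"
  have c: "0 < c" "c \<le> 1" using c0 by (auto simp: c_def)
  then have \<kappa>: "0 < \<kappa>" by (simp add: \<kappa>_def)
  then have k0: "0 < k0" by (simp add: k0_def)
  then have \<epsilon>: "0 < \<epsilon>" "\<epsilon> \<le> 1" "128 * \<epsilon> \<le> k0" by (auto simp: \<epsilon>_def min_def)
  have corr: "\<forall>\<^sub>F n in sequentially. c \<le> expected_correlation n (p0 n) (p1 n) (\<rho> n) (r n) (X n)"
    using c0(2) by (rule eventually_mono) (simp add: c_def)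
  note reg = pds_regime_limits(3)[OF regime \<epsilon>(1,2)]
  have \<rho>n: "filterlim (\<lambda>n. \<rho> n * real n) at_top sequentially"
  proof (rule filterlim_at_top_mono)
    show "filterlim (\<lambda>n. (ln (real n))\<^sup>2 * sqrt (real n)) at_top sequentially" by real_asymp
    show "\<forall>\<^sub>F n in sequentially. (ln (real n))\<^sup>2 * sqrt (real n) \<le> \<rho> n * real n"
      using reg
    proof (rule eventually_mono)
      fix n assume "regime_at n (p0 n) (p1 n) (\<rho> n) \<epsilon>"
      then have "(ln (real n))\<^sup>2 \<le> \<rho> n * sqrt (real n)" by (simp add: regime_at_def)
      then have "(ln (real n))\<^sup>2 * sqrt (real n) \<le> \<rho> n * sqrt (real n) * sqrt (real n)"
        by (rule mult_right_mono) simp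
      then show "(ln (real n))\<^sup>2 * sqrt (real n) \<le> \<rho> n * real n" by (simp add: mult.assoc)
    qed
  qed
  have "(\<lambda>n. exp (- (\<rho> n * real n) / 16) + exp (- (\<rho> n * real n) / 4) + 8 * p1 n / \<kappa>\<^sup>2) \<longlonglongrightarrow> 0 + 0 + 8 * 0 / \<kappa>\<^sup>2"
  proof (intro tendsto_add tendsto_divide tendsto_mult tendsto_const pds_regime_limits(1)[OF regime])
    have lim: "((\<lambda>y :: real. exp (- y / 16)) \<longlongrightarrow> 0) at_top" "((\<lambda>y :: real. exp (- y / 4)) \<longlongrightarrow> 0) at_top"
      by real_asymp+
    show "(\<lambda>n. exp (- (\<rho> n * real n) / 16)) \<longlonglongrightarrow> 0" "(\<lambda>n. exp (- (\<rho> n * real n) / 4)) \<longlonglongrightarrow> 0"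
      by (rule filterlim_compose[OF lim(1) \<rho>n] filterlim_compose[OF lim(2) \<rho>n])+
  qed (use \<kappa> in simp)
  then have "\<forall>\<^sub>F n in sequentially. exp (- (\<rho> n * real n) / 16) + exp (- (\<rho> n * real n) / 4) + 8 * p1 n / \<kappa>\<^sup>2 < c / 8"
    using c by (intro order_tendstoD) auto
  moreover have "\<forall>\<^sub>F n in sequentially. 32 / c\<^sup>2 \<le> \<rho> n * real n"
    using \<rho>n by (simp add: filterlim_at_top)
  moreover have "\<forall>\<^sub>F n in sequentially. 2 / real n < c / 32"
  proof (rule order_tendstoD(2))
    show "(\<lambda>n. 2 / real n) \<longlonglongrightarrow> 0" by real_asymp
  qed (use c in simp)
  moreover have "\<forall>\<^sub>F n in sequentially. 32 / k0 \<le> ln (real n)"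
  proof -
    have "filterlim (\<lambda>n. ln (real n)) at_top sequentially" by real_asymp
    then show ?thesis by (simp add: filterlim_at_top)
  qed
  ultimately have "\<forall>\<^sub>F n in sequentially. regime_at n (p0 n) (p1 n) (\<rho> n) \<epsilon> \<and>
      c \<le> expected_correlation n (p0 n) (p1 n) (\<rho> n) (r n) (X n) \<and>
      computes_in_time (edge_addr n) (edges n) (r n) (out_matrix n) (X n) (T n) \<and>
      exp (- (\<rho> n * real n) / 16) + exp (- (\<rho> n * real n) / 4) + 8 * p1 n / \<kappa>\<^sup>2 \<le> c / 8 \<and>
      16 / c\<^sup>2 \<le> \<rho> n * real n / 2 \<and> 2 / real n \<le> c / 32 \<and> 32 \<le> k0 * ln (real n)"
    using reg corr algorithm
  proof eventually_elim
    case (elim n)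
    have "32 \<le> k0 * ln (real n)" using elim(4) k0 by (simp add: pos_divide_le_eq mult.commute)
    then show ?case using elim by simp
  qed
  \<comment> \<open>The claimed bound fails for infinitely many n only. The sequence \<phi>
    enumerates those at which all eventual estimates hold too, and the heuristic is then used for
    graphs on \<phi> k vertices.\<close>
  from frequently_eventually_frequently[OF freq this]
  have "infinite {n. T n < exp (1 / 2 * \<beta> n) \<and> regime_at n (p0 n) (p1 n) (\<rho> n) \<epsilon> \<and>
      c \<le> expected_correlation n (p0 n) (p1 n) (\<rho> n) (r n) (X n) \<and>
      computes_in_time (edge_addr n) (edges n) (r n) (out_matrix n) (X n) (T n) \<and>
      exp (- (\<rho> n * real n) / 16) + exp (- (\<rho> n * real n) / 4) + 8 * p1 n / \<kappa>\<^sup>2 \<le> c / 8 \<and>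
      16 / c\<^sup>2 \<le> \<rho> n * real n / 2 \<and> 2 / real n \<le> c / 32 \<and> 32 \<le> k0 * ln (real n)}"
    by (simp only: cofinite_eq_sequentially[symmetric] frequently_cofinite not_False_eq_True)
  from infinite_enumerate[OF this] obtain \<phi> :: "nat \<Rightarrow> nat" where mono: "strict_mono \<phi>" and
    mem: "\<And>k. \<phi> k \<in> {n. T n < exp (1 / 2 * \<beta> n) \<and> regime_at n (p0 n) (p1 n) (\<rho> n) \<epsilon> \<and>
      c \<le> expected_correlation n (p0 n) (p1 n) (\<rho> n) (r n) (X n) \<and>
      computes_in_time (edge_addr n) (edges n) (r n) (out_matrix n) (X n) (T n) \<and>
      exp (- (\<rho> n * real n) / 16) + exp (- (\<rho> n * real n) / 4) + 8 * p1 n / \<kappa>\<^sup>2 \<le> c / 8 \<and>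
      16 / c\<^sup>2 \<le> \<rho> n * real n / 2 \<and> 2 / real n \<le> c / 32 \<and> 32 \<le> k0 * ln (real n)}" by blast
  have \<phi>: "T (\<phi> k) < exp (1 / 2 * \<beta> (\<phi> k))"
      "regime_at (\<phi> k) (p0 (\<phi> k)) (p1 (\<phi> k)) (\<rho> (\<phi> k)) \<epsilon>"
      "c \<le> expected_correlation (\<phi> k) (p0 (\<phi> k)) (p1 (\<phi> k)) (\<rho> (\<phi> k)) (r (\<phi> k)) (X (\<phi> k))"
      "computes_in_time (edge_addr (\<phi> k)) (edges (\<phi> k)) (r (\<phi> k)) (out_matrix (\<phi> k)) (X (\<phi> k)) (T (\<phi> k))"
      "exp (- (\<rho> (\<phi> k) * real (\<phi> k)) / 16) + exp (- (\<rho> (\<phi> k) * real (\<phi> k)) / 4) + 8 * p1 (\<phi> k) / \<kappa>\<^sup>2 \<le> c / 8"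
      "16 / c\<^sup>2 \<le> \<rho> (\<phi> k) * real (\<phi> k) / 2" "2 / real (\<phi> k) \<le> c / 32"
      "32 \<le> k0 * ln (real (\<phi> k))" for k
    using mem[of k] by (simp_all only: mem_Collect_eq)
  have \<phi>_lim: "filterlim \<phi> at_top sequentially" by (rule filterlim_subseq[OF mono])
  have ln_lim: "filterlim (\<lambda>k. ln (real (\<phi> k))) at_top sequentially"
    by (rule filterlim_compose[OF _ \<phi>_lim]) real_asymp
  define l where "l k = (snr (p0 (\<phi> k)) (p1 (\<phi> k)))\<^sup>2" for k
  define L where "L k = ln (real (\<phi> k))" for k
  have L4: "4 \<le> L k" for k using \<phi>(2)[of k] by (simp add: regime_at_def L_def)
  have T2: "2 \<le> T (\<phi> k)" for k
    by (rule recovery_time_ge_2[OF \<phi>(4)[of k] less_le_trans[OF c(1) \<phi>(3)[of k]]])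
  \<comment> \<open>T < exp (\<beta> / 2) and T >= 2 force \<beta> > 1. This excludes a vanishing
    signal-to-noise ratio, for which \<open>powi\<close> yields \<beta> = 0, and it lets constants
    be absorbed into multiples of \<beta>.\<close>
  have \<beta>1: "1 < \<beta> (\<phi> k)" for k
  proof (rule ccontr)
    assume "\<not> 1 < \<beta> (\<phi> k)"
    then have "exp (1 / 2 * \<beta> (\<phi> k)) \<le> exp (1 / 2)" by simp
    also have "\<dots> \<le> 1 + 1 / 2 + (1 / 2 :: real)\<^sup>2" by (rule exp_bound) auto
    also have "\<dots> < 2" by (simp add: power2_eq_square)
    finally show False using \<phi>(1)[of k] T2[of k] by linarith
  qed
  have \<beta>: "\<beta> (\<phi> k) = 1 / (l k * L k ^ 4)" for k
    by (simp add: \<beta>_def l_def L_def power_int_minus divide_inverse)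
  have l: "0 < l k" "l k * L k ^ 4 \<le> 1" for k
  proof -
    have "l k \<noteq> 0" using \<beta>1[of k] \<beta>[of k] by auto
    then show l0: "0 < l k" by (simp add: l_def)
    have "0 < l k * L k ^ 4" using l0 L4[of k] by simp
    moreover have "1 < 1 / (l k * L k ^ 4)" using \<beta>1[of k] unfolding \<beta> .
    ultimately show "l k * L k ^ 4 \<le> 1" by (simp add: less_divide_eq)
  qed
  \<comment> \<open>\<beta> L^2 rounded down, the largest degree that the bound on the advantage
    admits.\<close>
  define D where "D k = nat \<lfloor>1 / (l k * (L k)\<^sup>2)\<rfloor>" for k
  have D: "real (D k) \<le> 1 / (l k * (L k)\<^sup>2)" "\<beta> (\<phi> k) * (L k)\<^sup>2 - 1 \<le> real (D k)" for k
  proof -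
    have pos: "0 \<le> 1 / (l k * (L k)\<^sup>2)" using l(1)[of k] by simp
    then show "real (D k) \<le> 1 / (l k * (L k)\<^sup>2)" by (simp add: D_def of_nat_floor)
    have "\<beta> (\<phi> k) * (L k)\<^sup>2 = 1 / (l k * (L k)\<^sup>2)"
      using L4[of k] unfolding \<beta> by (simp add: power2_eq_square power4_eq_xxxx)
    then show "\<beta> (\<phi> k) * (L k)\<^sup>2 - 1 \<le> real (D k)" using pos unfolding D_def by linarith
  qed
  define h0 where "h0 k = regime_at.h0 (p0 (\<phi> k))" for k
  define h1 where "h1 k = regime_at.h1 (\<phi> k) (p0 (\<phi> k)) (p1 (\<phi> k)) (\<rho> (\<phi> k))" for k
  define \<Delta> where "\<Delta> k = regime_at.\<Delta> (\<phi> k) (p0 (\<phi> k)) (p1 (\<phi> k)) (\<rho> (\<phi> k))" for k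
  define V where "V k = regime_at.V (\<phi> k) (p0 (\<phi> k)) (p1 (\<phi> k)) (\<rho> (\<phi> k))" for k
  have L_eq: "regime_at.L (\<phi> k) = L k" for k using regime_at.L_def[OF \<phi>(2)[of k]] by (simp add: L_def)
  note at = regime_at.advantage_le[OF \<phi>(2), folded l_def h0_def h1_def \<Delta>_def, unfolded L_eq, OF l D(1)]
  have sub_regime: "pds_regime \<phi> h0 h1 (\<lambda>k. \<rho> (\<phi> k))"
    using base_pair_regime[OF regime \<phi>_lim \<phi>(2)] unfolding h0_def[abs_def] h1_def[abs_def] .
  have "\<exists>C>0. \<forall>M :: nat \<Rightarrow> nat.
           \<Delta> \<in> o(\<lambda>k. real (M k)) \<longrightarrow>
           (\<forall>k. 1 \<le> M k \<and> real (M k) \<le> real (card (edges (\<phi> k))) * \<Delta> k) \<longrightarrow>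
           low_degree_heuristic C D
             (\<lambda>k. hidden_edge_addr (\<phi> k))
             (\<lambda>k. {..<M k} \<times> edges (\<phi> k))
             (\<lambda>k. hidden_planted (M k) (pds (\<phi> k) (h0 k) (h1 k) (\<rho> (\<phi> k))) (erdos_renyi (\<phi> k) (h0 k)))
             (\<lambda>k. hidden_null (M k) (erdos_renyi (\<phi> k) (h0 k)))"
    using heuristic[unfolded pds_low_degree_heuristic_def, rule_format, OF sub_regime, of \<Delta> D]
      at(1) regime_at.\<Delta>_le(2)[OF \<phi>(2), folded \<Delta>_def] by blast
  then obtain C where C: "0 < C" and heur: "\<And>M :: nat \<Rightarrow> nat.
           \<Delta> \<in> o(\<lambda>k. real (M k)) \<Longrightarrow>
           (\<And>k. 1 \<le> M k \<and> real (M k) \<le> real (card (edges (\<phi> k))) * \<Delta> k) \<Longrightarrow>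
           low_degree_heuristic C D
             (\<lambda>k. hidden_edge_addr (\<phi> k))
             (\<lambda>k. {..<M k} \<times> edges (\<phi> k))
             (\<lambda>k. hidden_planted (M k) (pds (\<phi> k) (h0 k) (h1 k) (\<rho> (\<phi> k))) (erdos_renyi (\<phi> k) (h0 k)))
             (\<lambda>k. hidden_null (M k) (erdos_renyi (\<phi> k) (h0 k)))" by blast
  define M where "M k = nat \<lfloor>real (card (edges (\<phi> k))) * \<Delta> k\<rfloor>" for k
  note M = regime_at.sample_number[OF \<phi>(2), folded \<Delta>_def, OF M_def]
  have ratio: "(\<lambda>k. \<Delta> k / real (M k)) \<longlonglongrightarrow> 0"
  proof (rule tendsto_sandwich)
    show "\<forall>\<^sub>F k in sequentially. 0 \<le> \<Delta> k / real (M k)"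
      using regime_at.\<Delta>_le(2)[OF \<phi>(2), folded \<Delta>_def] by (intro always_eventually allI divide_nonneg_nonneg) (auto intro: less_imp_le less_trans[OF zero_less_one])
    show "\<forall>\<^sub>F k in sequentially. \<Delta> k / real (M k) \<le> 4 / real (\<phi> k)" using M(4) by simp
    show "(\<lambda>k. 4 / real (\<phi> k)) \<longlonglongrightarrow> 0"
      by (rule filterlim_compose[OF _ \<phi>_lim]) real_asymp
  qed simp
  have M0: "0 < M k" for k using M(1)[of k] by simp
  have "\<Delta> \<in> o(\<lambda>k. real (M k))"
  proof (rule smalloI_tendsto[OF ratio], intro always_eventually allI)
    show "real (M k) \<noteq> 0" for k using M0[of k] by simp
  qed
  from heur[OF this] have ldh: "low_degree_heuristic C D
             (\<lambda>k. hidden_edge_addr (\<phi> k))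
             (\<lambda>k. {..<M k} \<times> edges (\<phi> k))
             (\<lambda>k. hidden_planted (M k) (pds (\<phi> k) (h0 k) (h1 k) (\<rho> (\<phi> k))) (erdos_renyi (\<phi> k) (h0 k)))
             (\<lambda>k. hidden_null (M k) (erdos_renyi (\<phi> k) (h0 k)))" using M(1,2) by blast
  have adv: "(\<lambda>k. Adv (D k) ({..<M k} \<times> edges (\<phi> k))
      (hidden_planted (M k) (pds (\<phi> k) (h0 k) (h1 k) (\<rho> (\<phi> k))) (erdos_renyi (\<phi> k) (h0 k)))
      (hidden_null (M k) (erdos_renyi (\<phi> k) (h0 k)))) \<longlonglongrightarrow> 1"
  proof (rule tendsto_sandwich[where f = "\<lambda>_. 1"])
    have "(\<lambda>k. ereal (sqrt (1 + \<Delta> k / real (M k)))) \<longlonglongrightarrow> ereal (sqrt (1 + 0))"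
      by (intro tendsto_ereal tendsto_intros ratio)
    then show "(\<lambda>k. ereal (sqrt (1 + \<Delta> k / real (M k)))) \<longlonglongrightarrow> 1" by (simp add: one_ereal_def)
    show "\<forall>\<^sub>F k in sequentially. 1 \<le> Adv (D k) ({..<M k} \<times> edges (\<phi> k))
      (hidden_planted (M k) (pds (\<phi> k) (h0 k) (h1 k) (\<rho> (\<phi> k))) (erdos_renyi (\<phi> k) (h0 k)))
      (hidden_null (M k) (erdos_renyi (\<phi> k) (h0 k)))"
      by (intro always_eventually allI Adv_ge_1)
    show "\<forall>\<^sub>F k in sequentially. Adv (D k) ({..<M k} \<times> edges (\<phi> k))
      (hidden_planted (M k) (pds (\<phi> k) (h0 k) (h1 k) (\<rho> (\<phi> k))) (erdos_renyi (\<phi> k) (h0 k)))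
      (hidden_null (M k) (erdos_renyi (\<phi> k) (h0 k)))
      \<le> ereal (sqrt (1 + \<Delta> k / real (M k)))"
      by (intro always_eventually allI at(2)[OF M0])
  qed simp
  define R where "R k d w P Q S \<longleftrightarrow> (\<forall>e. snd (w e) \<longrightarrow> e \<in> edges (\<phi> k)) \<and>
    0 \<le> P \<and> real_of_int P \<le> 5 * real (\<phi> k) ^ 2 \<and> 0 \<le> Q \<and> real_of_int Q \<le> 2 * real (\<phi> k) ^ 2 \<and>
    0 \<le> S \<and> real_of_int S \<le> 5 * real (\<phi> k) ^ 4 \<and>
    error_sum (hidden_planted (M k) (pds (\<phi> k) (h0 k) (h1 k) (\<rho> (\<phi> k))) (erdos_renyi (\<phi> k) (h0 k)))
      (hidden_null (M k) (erdos_renyi (\<phi> k) (h0 k))) (r (\<phi> k) * M k)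
      (\<lambda>y \<omega>. \<exists>j<M k. scan_accepts (\<phi> k) P Q S
        (entry d (X (\<phi> k) (thin w (\<lambda>e. y (j, e))) (\<lambda>z. \<omega> (z * M k + j))))
        (thin w (\<lambda>e. y (j, e))) (\<lambda>e. y (j, e))) \<le> 1 - c / 16" for k d w P Q S
  have ex: "\<exists>d w P Q S. R k d w P Q S" for k
  proof -
    have "32 \<le> k0 * regime_at.L (\<phi> k)" unfolding L_eq L_def by (rule \<phi>(8))
    from regime_at.scan_detects[OF \<phi>(2)[of k] c(1) \<phi>(3)[of k] c(2) \<kappa>_def k0_def \<epsilon>(3) this
      \<phi>(6)[of k] \<phi>(5)[of k] \<phi>(7)[of k] M0[of k] M(3)[of k, unfolded \<Delta>_def]]
    show ?thesis unfolding R_def h0_def h1_def .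
  qed
  then obtain d w P Q S where "\<And>k. R k (d k) (w k) (P k) (Q k) (S k)" by metis
  note R_test = this[unfolded R_def]
  note test = R_test[THEN conjunct1, rule_format]
    R_test[THEN conjunct2, THEN conjunct1]
    R_test[THEN conjunct2, THEN conjunct2, THEN conjunct1]
    R_test[THEN conjunct2, THEN conjunct2, THEN conjunct2, THEN conjunct1]
    R_test[THEN conjunct2, THEN conjunct2, THEN conjunct2, THEN conjunct2, THEN conjunct1]
    R_test[THEN conjunct2, THEN conjunct2, THEN conjunct2, THEN conjunct2, THEN conjunct2, THEN conjunct1]
    R_test[THEN conjunct2, THEN conjunct2, THEN conjunct2, THEN conjunct2, THEN conjunct2, THEN conjunct2, THEN conjunct1]
    R_test[THEN conjunct2, THEN conjunct2, THEN conjunct2, THEN conjunct2, THEN conjunct2, THEN conjunct2, THEN conjunct2]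
  define A where "A k = (\<lambda>y \<omega>. \<exists>j<M k. scan_accepts (\<phi> k) (P k) (Q k) (S k)
        (entry (d k) (X (\<phi> k) (thin (w k) (\<lambda>e. y (j, e))) (\<lambda>z. \<omega> (z * M k + j))))
        (thin (w k) (\<lambda>e. y (j, e))) (\<lambda>e. y (j, e)))" for k
  have time: "\<exists>\<tau>. computes_in_time (hidden_edge_addr (\<phi> k)) ({..<M k} \<times> edges (\<phi> k)) (r (\<phi> k) * M k) out_bit (A k) \<tau> \<and>
      \<tau> \<le> exp (60 + 18 * L k + 96 * V k) * (T (\<phi> k))\<^sup>2" for k
    using regime_at.scan_time[OF \<phi>(2)[of k] \<phi>(4)[of k] test(1)[of k] test(2)[of k] test(3)[of k] test(4)[of k]
      test(5)[of k] test(6)[of k] test(7)[of k] M0[of k] M(3)[of k, unfolded \<Delta>_def] T2[of k]]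
    unfolding A_def V_def L_eq .
  \<comment> \<open>With V <= 4 \<beta> + L and T^2 <= exp \<beta>, the exponent is at most 60 + 114
    L + 385 \<beta>, and by \<beta> > 1 at most \<beta> (445 + 114 L). This is linear in L, whereas
    D / C is of order \<beta> L^2 with C a constant.\<close>
  have budget: "exp (60 + 18 * L k + 96 * V k) * (T (\<phi> k))\<^sup>2 \<le> exp (real (D k) / C)"
    if "C * (445 + 114 * L k) + 1 \<le> (L k)\<^sup>2" for k
  proof -
    let ?b = "\<beta> (\<phi> k)"
    have "(T (\<phi> k))\<^sup>2 \<le> (exp (1 / 2 * ?b))\<^sup>2"
      using \<phi>(1)[of k] T2[of k] by (intro power_mono) auto
    also have "\<dots> = exp ?b" using exp_of_nat_mult[of 2 "1 / 2 * ?b"] by simp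
    finally have T: "(T (\<phi> k))\<^sup>2 \<le> exp ?b" .
    have "V k \<le> 4 * ?b + L k"
      using regime_at.V_le[OF \<phi>(2), of k] l(1)[of k]
      unfolding V_def \<beta> L_eq l_def regime_at.V_def[OF \<phi>(2)] by simp
    then have "C * (60 + 18 * L k + 96 * V k + ?b) \<le> C * (60 + 114 * L k + 385 * ?b)"
      using C by (intro mult_left_mono) auto
    also have "\<dots> \<le> C * (?b * (445 + 114 * L k))"
    proof (rule mult_left_mono)
      have "60 * 1 \<le> 60 * ?b" "114 * L k * 1 \<le> 114 * L k * ?b"
        using \<beta>1[of k] L4[of k] by (intro mult_left_mono; simp)+
      then show "60 + 114 * L k + 385 * ?b \<le> ?b * (445 + 114 * L k)" by (simp add: algebra_simps)
    qed (use C in simp)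
    also have "\<dots> = ?b * (C * (445 + 114 * L k) + 1) - ?b" by (simp add: algebra_simps)
    also have "\<dots> \<le> ?b * (L k)\<^sup>2 - 1"
      using that \<beta>1[of k] by (intro diff_mono mult_left_mono) auto
    also have "\<dots> \<le> real (D k)" by (rule D(2))
    finally have "60 + 18 * L k + 96 * V k + ?b \<le> real (D k) / C"
      using C by (simp add: pos_le_divide_eq mult.commute)
    then have "exp (60 + 18 * L k + 96 * V k) * exp ?b \<le> exp (real (D k) / C)" by (simp flip: exp_add)
    moreover have "exp (60 + 18 * L k + 96 * V k) * (T (\<phi> k))\<^sup>2 \<le> exp (60 + 18 * L k + 96 * V k) * exp ?b"
      using T by (intro mult_left_mono) auto
    ultimately show ?thesis by linarith
  qed
  have "\<forall>\<^sub>F y in at_top. C * (445 + 114 * y) + 1 \<le> (y :: real)\<^sup>2" by real_asymp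
  then have ev: "\<forall>\<^sub>F k in sequentially. C * (445 + 114 * L k) + 1 \<le> (L k)\<^sup>2"
    using ln_lim unfolding L_def by (rule eventually_compose_filterlim)
  have powr: "real (card ({..<M k} \<times> edges (\<phi> k))) powr (real (D k) / (C * ln (real (card ({..<M k} \<times> edges (\<phi> k))))))
      = exp (real (D k) / C)" for k
  proof -
    have "1 * 2 \<le> M k * card (edges (\<phi> k))" using M(1,5)[of k] by (intro mult_le_mono) auto
    then have "1 < card ({..<M k} \<times> edges (\<phi> k))" by (simp add: card_cartesian_product)
    then have N: "1 < real (card ({..<M k} \<times> edges (\<phi> k)))" by linarith
    then have "ln (real (card ({..<M k} \<times> edges (\<phi> k)))) \<noteq> 0" "real (card ({..<M k} \<times> edges (\<phi> k))) \<noteq> 0"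
      using ln_gt_zero[OF N] by linarith+
    then show ?thesis unfolding powr_def by (simp del: card_cartesian_product of_nat_eq_0_iff)
  qed
  have fast: "\<forall>\<^sub>F k in sequentially. computes_in_time (hidden_edge_addr (\<phi> k)) ({..<M k} \<times> edges (\<phi> k)) (r (\<phi> k) * M k) out_bit (A k)
      (real (card ({..<M k} \<times> edges (\<phi> k))) powr (real (D k) / (C * ln (real (card ({..<M k} \<times> edges (\<phi> k)))))))"
    using ev
  proof (rule eventually_mono)
    fix k assume "C * (445 + 114 * L k) + 1 \<le> (L k)\<^sup>2"
    then have "exp (60 + 18 * L k + 96 * V k) * (T (\<phi> k))\<^sup>2 \<le> exp (real (D k) / C)" by (rule budget)
    then show "computes_in_time (hidden_edge_addr (\<phi> k)) ({..<M k} \<times> edges (\<phi> k)) (r (\<phi> k) * M k) out_bit (A k)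
      (real (card ({..<M k} \<times> edges (\<phi> k))) powr (real (D k) / (C * ln (real (card ({..<M k} \<times> edges (\<phi> k)))))))"
      unfolding powr using time[of k] computes_in_time_mono order_trans by blast
  qed
  have weak: "weak_detection
      (\<lambda>k. hidden_planted (M k) (pds (\<phi> k) (h0 k) (h1 k) (\<rho> (\<phi> k))) (erdos_renyi (\<phi> k) (h0 k)))
      (\<lambda>k. hidden_null (M k) (erdos_renyi (\<phi> k) (h0 k))) (\<lambda>k. r (\<phi> k) * M k) A"
    unfolding weak_detection_def A_def using test(8) c(1)
    by (intro exI[of _ "c / 16"] conjI always_eventually allI) auto
  note no_test = ldh[unfolded low_degree_heuristic_def Let_def, THEN conjunct2, THEN mp, OF adv]
  show False
    by (rule notE[OF no_test], rule exI[of _ "\<lambda>k. r (\<phi> k) * M k"], rule exI[of _ A],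
      rule conjI[OF fast weak])
qed

end
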